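(* Let $n\ge 3$, $\alpha\in(0,n)$ and $q>1$, and consider the integral equation $$u(x)=\int_{\mathbb{R}^n}g_\alpha(x-y)u^q(y)\,dy,\qquad u>0\text{ in }\mathbb{R}^n, \qquad ( * )$$ where $g_\alpha$ is the Bessel kernel of order $\alpha$. (1) If $q<\frac{n+\alpha}{n-\alpha}$, then $( * )$ has a positive solution $u$ in $L^{q+1}(\mathbb{R}^n)$. Moreover, if $\alpha>1$, then $u\in C^1(\mathbb{R}^n)$. (2) If $( * )$ has a positive solution $u\in C^1(\mathbb{R}^n)\cap L^{q+1}(\mathbb{R}^n)$, then $q<\frac{n+\alpha}{n-\alpha}$.
   Context: The Bessel kernel $g_\alpha$ is the positive integrable function with Fourier transform $\hat g_\alpha(\xi)=(1+4\pi^2|\xi|^2)^{-\alpha/2}$, where $\hat f(\xi)=\int f(x)e^{-2\pi i x\cdot\xi}dx$. *)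

theory Defs
  imports "HOL-Analysis.Analysis"
begin

definition fourier :: "('a::euclidean_space \<Rightarrow> complex) \<Rightarrow> 'a \<Rightarrow> complex" where
  "fourier f \<xi> = (LINT x|lebesgue. f x * exp (- 2 * complex_of_real pi * \<i> * complex_of_real (x \<bullet> \<xi>)))"

text \<open>The Fourier transform determines an integrable function only up to null sets, so the Bessel
  kernel is given by a predicate on its representatives. In particular the (real) value at the
  origin, where the kernel of order less than the dimension is singular, is irrelevant.\<close>

definition is_bessel_kernel :: "real \<Rightarrow> ('a::euclidean_space \<Rightarrow> real) \<Rightarrow> bool" where
  "is_bessel_kernel \<alpha> g \<longleftrightarrow>
     integrable lebesgue g \<and> (\<forall>x. g x > 0) \<and>
     (\<forall>\<xi>. fourier (\<lambda>x. complex_of_real (g x)) \<xi>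
          = complex_of_real ((1 + 4 * pi\<^sup>2 * (norm \<xi>)\<^sup>2) powr (- \<alpha> / 2)))"

text \<open>Integrability is required explicitly because the Bochner integral of a non-integrable function
  is 0 by convention. The equation holds at every point, not just almost everywhere.\<close>

definition positive_solution ::
    "('a::euclidean_space \<Rightarrow> real) \<Rightarrow> real \<Rightarrow> ('a \<Rightarrow> real) \<Rightarrow> bool" where
  "positive_solution g q u \<longleftrightarrow>
     (\<forall>x. u x > 0) \<and>
     (\<forall>x. integrable lebesgue (\<lambda>y. g (x - y) * u y powr q) \<and>
          u x = (LINT y|lebesgue. g (x - y) * u y powr q))"

definition in_Lp :: "real \<Rightarrow> ('a::euclidean_space \<Rightarrow> real) \<Rightarrow> bool" where
  "in_Lp p f \<longleftrightarrow>
     f \<in> borel_measurable lebesgue \<and> integrable lebesgue (\<lambda>x. \<bar>f x\<bar> powr p)"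

definition is_C1 :: "('a::euclidean_space \<Rightarrow> real) \<Rightarrow> bool" where
  "is_C1 f \<longleftrightarrow>
     (\<exists>f' :: 'a \<Rightarrow> 'a \<Rightarrow>\<^sub>L real.
        (\<forall>x. (f has_derivative blinfun_apply (f' x)) (at x)) \<and> continuous_on UNIV f')"

end

theory Submission
  imports Defs "HOL-Probability.Probability"
begin

text \<open>The kernel is almost everywhere a superposition of Gaussians \<open>exp (- pi |z|^2 / s)\<close> with an
  explicit weight in \<open>s\<close>, by uniqueness of Fourier transforms. Hence it is radially decreasing, bounded
  by a multiple of \<open>|z|^(\<alpha> - n)\<close>, and its quadratic form \<open>B(f, h)\<close> is positive.

  Existence: maximise \<open>B(f, f)\<close> over the radially decreasing functions in the unit ball of \<open>L^p\<close>,
  \<open>p = (q + 1) / q\<close>. They all lie below one multiple of \<open>|x|^(- n / p)\<close>, for which \<open>B\<close> is finite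
  exactly because \<open>q\<close> is subcritical, so Helly's theorem and dominated convergence give a maximiser
  \<open>F\<close>. Convolution with the kernel preserves radial monotonicity (compare reflected points), so
  powers of the truncations of \<open>g * F\<close> are admissible competitors; with
  \<open>2 B(f, h) \<le> B(f, f) + B(h, h)\<close> this forces equality in Young's inequality, which is the equation up
  to a constant. Iterating the equation on power bounds at the origin makes the solution bounded.

  Nonexistence: test with truncations of the dilation field \<open>x\<close>. For each Gaussian, integration by parts
  followed by symmetrisation in \<open>x\<close> and \<open>y\<close> leaves only the Lipschitz quantity
  \<open>(X x - X y) \<bullet> (x - y)\<close>, so one can integrate in \<open>s\<close> and remove the truncation without any decay of
  \<open>u\<close>. As the kernel scales with degree strictly above \<open>\<alpha> - n\<close>, the resulting identity says
  \<open>(n - \<alpha>) I < 2 n I / (q + 1)\<close> for \<open>I\<close> the integral of \<open>u^(q + 1)\<close>.\<close>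

section \<open>Gaussians and uniqueness of Fourier transforms\<close>

text \<open>The variational problem is posed for \<open>F\<close>, which plays the role of
  \<open>u^q\<close>, so only a quadratic form and an \<open>L^p\<close> norm occur and no Sobolev
  space. With \<open>p = (q + 1) / q\<close>, subcriticality reads
  \<open>2 * n / p < n + \<alpha>\<close>; the iteration at the origin uses it in the form
  \<open>(q - 1) * n / (q + 1) < \<alpha>\<close>. Restricting to radially decreasing functions
  removes the loss of compactness by translations and any need to rearrange, but it forbids
  arbitrary variations of the maximiser; hence competitors that stay in the class. Values in
  \<open>[0, \<infinity>]\<close> make Tonelli's theorem unconditional, at the price of having no
  subtraction, so positivity of the form is stated with sums only.

  For nonexistence, nothing is known about the growth of the gradient of \<open>u\<close>. It occurs
  in two truncated identities with the same factor and is eliminated between them before the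
  truncation is removed. The strict inequality, which excludes the critical exponent too, comes from
  the factor \<open>exp (- s / (4 * pi))\<close> that distinguishes the Bessel weight from the
  homogeneous Riesz weight.\<close>

lemma nn_integral_lborel_affine_euclidean:
  fixes F :: "'a::euclidean_space \<Rightarrow> ennreal"
  assumes [measurable]: "F \<in> borel_measurable borel" and c: "c \<noteq> 0"
  shows "(\<integral>\<^sup>+x. F x \<partial>lborel) = ennreal (\<bar>c\<bar> ^ DIM('a)) * (\<integral>\<^sup>+x. F (t + c *\<^sub>R x) \<partial>lborel)"
proof -
  have "(\<integral>\<^sup>+x. F x \<partial>lborel) = (\<integral>\<^sup>+x. F x \<partial>density (distr lborel borel (\<lambda>x. t + c *\<^sub>R x)) (\<lambda>_. \<bar>c\<bar>^DIM('a)))"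
    using lborel_affine[OF c, of t] by simp
  also have "\<dots> = (\<integral>\<^sup>+x. ennreal (\<bar>c\<bar> ^ DIM('a)) * F (t + c *\<^sub>R x) \<partial>lborel)"
    by (simp add: nn_integral_density nn_integral_distr)
  also have "\<dots> = ennreal (\<bar>c\<bar> ^ DIM('a)) * (\<integral>\<^sup>+x. F (t + c *\<^sub>R x) \<partial>lborel)"
    by (simp add: nn_integral_cmult)
  finally show ?thesis .
qed

lemma nn_integral_lborel_reflect:
  fixes F :: "'a::euclidean_space \<Rightarrow> ennreal"
  assumes [measurable]: "F \<in> borel_measurable borel"
  shows "(\<integral>\<^sup>+y. F (x - y) \<partial>lborel) = (\<integral>\<^sup>+y. F y \<partial>lborel)"
  using nn_integral_lborel_affine_euclidean[OF assms, of "-1" x] by simp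

lemma nn_integral_lborel_shift:
  fixes F :: "'a::euclidean_space \<Rightarrow> ennreal"
  assumes [measurable]: "F \<in> borel_measurable borel"
  shows "(\<integral>\<^sup>+y. F (y - x) \<partial>lborel) = (\<integral>\<^sup>+y. F y \<partial>lborel)"
  using nn_integral_lborel_affine_euclidean[OF assms, of "1" "-x"] by simp

text \<open>Up to normalisation this is the heat kernel at time \<open>s / (4 * pi)\<close>. With
  the convention of \<open>fourier\<close> the case \<open>s = 1\<close> is its own
  transform.\<close>

definition gauss :: "real \<Rightarrow> 'a::real_normed_vector \<Rightarrow> real" where
  "gauss s z = exp (- (pi * (norm z)\<^sup>2 / s))"

lemma gauss_pos [simp]: "0 < gauss s z" and gauss_nonneg [simp]: "0 \<le> gauss s z"
  by (simp_all add: gauss_def)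

lemma gauss_diff_commute: "gauss s (x - y) = gauss s (y - x)"
  by (simp add: gauss_def norm_minus_commute)

lemma gauss_le_1: "0 < s \<Longrightarrow> gauss s z \<le> 1"
  by (simp add: gauss_def)

lemma measurable_gauss [measurable]:
  fixes f :: "'b \<Rightarrow> 'a::{second_countable_topology,real_normed_vector}"
  assumes [measurable]: "f \<in> borel_measurable M" "h \<in> borel_measurable M"
  shows "(\<lambda>x. gauss (h x) (f x)) \<in> borel_measurable M"
  unfolding gauss_def by measurable

abbreviation "wave t \<equiv> exp (- 2 * complex_of_real pi * \<i> * complex_of_real t)"

lemma norm_wave: "norm (wave t) = 1"
  by (simp add: norm_exp_eq_Re)

text \<open>Rescaling by the standard deviation \<open>\<sigma>\<close> reduces both claims to the
  characteristic function of the standard normal distribution, evaluated at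
  \<open>t\<close>.\<close>

lemma gauss_fourier_real:
  fixes s \<xi> :: real
  assumes s: "s > 0"
  shows "integrable lborel (\<lambda>x::real. complex_of_real (exp (- (pi * x\<^sup>2 / s))) * wave (x * \<xi>))"
    and "(LINT x|lborel. complex_of_real (exp (- (pi * x\<^sup>2 / s))) * wave (x * \<xi>))
         = complex_of_real (sqrt s * exp (- (pi * s * \<xi>\<^sup>2)))"
proof -
  define \<sigma> where "\<sigma> = sqrt (s / (2 * pi))"
  have \<sigma>: "\<sigma> > 0" "\<sigma>\<^sup>2 = s / (2 * pi)" using s by (simp_all add: \<sigma>_def)
  define t where "t = - 2 * pi * \<sigma> * \<xi>"
  have t2: "t\<^sup>2 / 2 = pi * s * \<xi>\<^sup>2" using s by (simp add: t_def power_mult_distrib \<sigma>(2)) (simp add: power2_eq_square)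
  have i0: "integrable lborel (\<lambda>x. std_normal_density x *\<^sub>R iexp (t * x))"
  proof (rule Bochner_Integration.integrable_bound)
    show "integrable lborel std_normal_density" by (simp add: integrable_std_normal_distribution_moment)
  qed (auto simp: norm_exp_eq_Re)
  have "char std_normal_distribution t = (LINT x|lborel. std_normal_density x *\<^sub>R iexp (t * x))"
    unfolding char_def by (subst integral_density) (auto simp: normal_density_nonneg)
  then have e: "(LINT x|lborel. std_normal_density x *\<^sub>R iexp (t * x)) = exp (- (t^2) / 2)"
    by (simp add: char_std_normal_distribution)
  have eq: "complex_of_real (exp (- (pi * (0 + \<sigma> * x)\<^sup>2 / s))) * wave ((0 + \<sigma> * x) * \<xi>)
       = complex_of_real (sqrt (2 * pi)) * (std_normal_density x *\<^sub>R iexp (t * x))" for x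
  proof -
    have "pi * (\<sigma> * x)\<^sup>2 / s = x\<^sup>2 / 2" using s by (simp add: power_mult_distrib \<sigma>)
    then show ?thesis
      by (simp add: std_normal_density_def scaleR_conv_of_real t_def mult_ac flip: exp_minus)
  qed
  have i1: "integrable lborel (\<lambda>x. complex_of_real (sqrt (2 * pi)) * (std_normal_density x *\<^sub>R iexp (t * x)))"
    by (intro integrable_mult_right i0)
  show "integrable lborel (\<lambda>x::real. complex_of_real (exp (- (pi * x\<^sup>2 / s))) * wave (x * \<xi>))"
    by (subst lborel_integrable_real_affine_iff[of \<sigma> _ 0, symmetric])
       (use \<sigma> in simp, simp only: eq, rule i1)
  have "(LINT x|lborel. complex_of_real (exp (- (pi * x\<^sup>2 / s))) * wave (x * \<xi>))
     = \<sigma> *\<^sub>R (complex_of_real (sqrt (2 * pi)) * exp (- (t^2) / 2))"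
    using \<sigma> by (subst lborel_integral_real_affine[of \<sigma> _ 0]) (simp, simp only: eq integral_mult_right_zero e, simp)
  also have "\<sigma> *\<^sub>R (complex_of_real (sqrt (2 * pi)) * exp (- (t^2) / 2)) = complex_of_real (sqrt s * exp (- (t\<^sup>2 / 2)))"
  proof -
    have "\<sigma> * sqrt (2 * pi) = sqrt s" by (simp add: \<sigma>_def real_sqrt_divide)
    then show ?thesis by (simp add: scaleR_conv_of_real mult.assoc[symmetric] flip: of_real_mult)
  qed
  finally show "(LINT x|lborel. complex_of_real (exp (- (pi * x\<^sup>2 / s))) * wave (x * \<xi>))
         = complex_of_real (sqrt s * exp (- (pi * s * \<xi>\<^sup>2)))"
    by (simp only: t2)
qed

lemma norm_power2_Basis_sum:
  fixes f :: "'a::euclidean_space \<Rightarrow> real"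
  shows "(norm (\<Sum>b\<in>Basis. f b *\<^sub>R b))\<^sup>2 = (\<Sum>b\<in>Basis. (f b)\<^sup>2)"
proof -
  have "(norm (\<Sum>b\<in>Basis. f b *\<^sub>R b))\<^sup>2
      = (\<Sum>b\<in>Basis. ((\<Sum>b\<in>Basis. f b *\<^sub>R b) \<bullet> b) * ((\<Sum>b\<in>Basis. f b *\<^sub>R b) \<bullet> b))"
    unfolding power2_norm_eq_inner by (rule euclidean_inner)
  also have "\<dots> = (\<Sum>b\<in>Basis. (f b)\<^sup>2)"
    by (intro sum.cong refl) (simp only: inner_sum_left_Basis power2_eq_square)
  finally show ?thesis .
qed

text \<open>Both the Gaussian and the character factor over the coordinates, so the one-dimensional
  formula can be multiplied over \<open>Basis\<close>.\<close>

lemma gauss_fourier: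
  fixes \<xi> :: "'a::euclidean_space"
  assumes s: "s > 0"
  shows "integrable lborel (\<lambda>x::'a. complex_of_real (gauss s x) * wave (x \<bullet> \<xi>))"
    and "(LINT x|lborel. complex_of_real (gauss s x) * wave (x \<bullet> \<xi>))
         = complex_of_real (s powr (DIM('a) / 2) * exp (- (pi * s * (norm \<xi>)\<^sup>2)))"
proof -
  interpret P: product_sigma_finite "\<lambda>_::'a. lborel :: real measure" ..
  let ?F = "\<lambda>b (x::real). complex_of_real (exp (- (pi * x\<^sup>2 / s))) * wave (x * (\<xi> \<bullet> b))"
  let ?T = "\<lambda>f. \<Sum>b\<in>Basis. f b *\<^sub>R b"
  let ?P = "Pi\<^sub>M Basis (\<lambda>_::'a. lborel :: real measure)"
  have eq: "complex_of_real (gauss s (?T f)) * wave (?T f \<bullet> \<xi>) = (\<Prod>b\<in>Basis. ?F b (f b))" for f :: "'a \<Rightarrow> real"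
  proof -
    have "?T f \<bullet> \<xi> = (\<Sum>b\<in>Basis. f b * (\<xi> \<bullet> b))"
      unfolding inner_sum_left by (intro sum.cong refl) (simp add: inner_commute)
    then have "wave (?T f \<bullet> \<xi>) = (\<Prod>b\<in>Basis. wave (f b * (\<xi> \<bullet> b)))"
      by (simp add: sum_distrib_left exp_sum[symmetric])
    moreover have "gauss s (?T f) = (\<Prod>b\<in>Basis. exp (- (pi * (f b)\<^sup>2 / s)))"
      by (simp add: gauss_def norm_power2_Basis_sum sum_distrib_left sum_divide_distrib sum_negf exp_sum[symmetric])
    ultimately show ?thesis by (simp add: prod.distrib)
  qed
  have [measurable]: "?T \<in> ?P \<rightarrow>\<^sub>M borel" by measurable
  have i: "integrable ?P (\<lambda>f. \<Prod>b\<in>Basis. ?F b (f b))"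
    by (rule P.product_integrable_prod) (use gauss_fourier_real[OF s] in auto)
  show "integrable lborel (\<lambda>x::'a. complex_of_real (gauss s x) * wave (x \<bullet> \<xi>))"
    by (subst lborel_eq, subst integrable_distr_eq) (simp, simp, simp only: eq, rule i)
  have "(LINT x|lborel. complex_of_real (gauss s x) * wave (x \<bullet> \<xi>)) = (LINT f|?P. (\<Prod>b\<in>Basis. ?F b (f b)))"
    by (subst lborel_eq, subst integral_distr) (simp, simp, simp only: eq)
  also have "\<dots> = (\<Prod>b\<in>Basis. complex_of_real (sqrt s * exp (- (pi * s * (\<xi> \<bullet> b)\<^sup>2))))"
    by (subst P.product_integral_prod) (simp_all only: gauss_fourier_real[OF s], simp_all)
  also have "\<dots> = complex_of_real (sqrt s ^ DIM('a) * exp (- (pi * s * (\<Sum>b\<in>Basis. (\<xi> \<bullet> b)\<^sup>2))))"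
    by (simp add: prod.distrib exp_sum[symmetric] sum_distrib_left sum_negf flip: of_real_prod)
  also have "(\<Sum>b\<in>Basis. (\<xi> \<bullet> b)\<^sup>2) = (norm \<xi>)\<^sup>2"
    unfolding power2_norm_eq_inner euclidean_inner[of \<xi> \<xi>] by (simp add: power2_eq_square)
  also have "sqrt s ^ DIM('a) = s powr (DIM('a) / 2)"
    using s by (simp add: powr_half_sqrt[symmetric] powr_powr flip: powr_realpow)
  finally show "(LINT x|lborel. complex_of_real (gauss s x) * wave (x \<bullet> \<xi>))
         = complex_of_real (s powr (DIM('a) / 2) * exp (- (pi * s * (norm \<xi>)\<^sup>2)))" .
qed

lemma integrable_gauss: "s > 0 \<Longrightarrow> integrable lborel (gauss s :: 'a::euclidean_space \<Rightarrow> real)"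
  and integral_gauss: "s > 0 \<Longrightarrow> (LINT x|lborel. gauss s (x::'a::euclidean_space)) = s powr (DIM('a) / 2)"
proof -
  assume s: "s > 0"
  show "integrable lborel (gauss s :: 'a \<Rightarrow> real)"
    using integrable_Re[OF gauss_fourier(1)[OF s, of "0::'a"]] by simp
  show "(LINT x|lborel. gauss s (x::'a)) = s powr (DIM('a) / 2)"
    using gauss_fourier(2)[OF s, of "0::'a"] by simp
qed

lemma nn_integral_gauss:
  "s > 0 \<Longrightarrow> (\<integral>\<^sup>+x. ennreal (gauss s (x::'a::euclidean_space)) \<partial>lborel) = ennreal (s powr (DIM('a) / 2))"
  by (simp add: nn_integral_eq_integral integrable_gauss integral_gauss)

section \<open>Nonnegative functions with equal Fourier transforms\<close>

text \<open>A Gaussian is itself the transform of a Gaussian of parameter \<open>1 / s\<close>;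
  inserting this and exchanging the integrals moves the transform onto \<open>f\<close>. Hence the
  Fourier transform of \<open>f\<close> determines all its Gaussian averages.\<close>

lemma integral_gauss_eq_fourier:
  fixes f :: "'a::euclidean_space \<Rightarrow> real"
  assumes f: "integrable lborel f" and s: "s > 0"
  shows "complex_of_real (LINT x|lborel. f x * gauss s (x - a))
    = complex_of_real (s powr (DIM('a) / 2)) * (LINT \<xi>|lborel. gauss (1/s) \<xi> * wave (- (\<xi> \<bullet> a)) *
         (LINT x|lborel. f x * wave (x \<bullet> \<xi>)))"
proof -
  let ?c = "complex_of_real (s powr (DIM('a) / 2))"
  let ?H = "\<lambda>x \<xi>. complex_of_real (f x) * (complex_of_real (gauss (1/s) \<xi>) * wave (\<xi> \<bullet> (x - a)))"
  have [measurable]: "f \<in> borel_measurable lborel" using f by auto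
  have g1: "integrable lborel (gauss (1/s) :: 'a \<Rightarrow> real)" using s by (simp add: integrable_gauss)
  have g: "integrable lborel (\<lambda>\<xi>::'a. complex_of_real (gauss (1/s) \<xi>) * wave (\<xi> \<bullet> z))"
     "(LINT \<xi>|lborel. complex_of_real (gauss (1/s) (\<xi>::'a)) * wave (\<xi> \<bullet> z))
        = complex_of_real ((1/s) powr (DIM('a) / 2)) * complex_of_real (gauss s z)" for z :: 'a
    using gauss_fourier[of "1/s" z] s by (simp_all add: gauss_def)
  have c: "?c * complex_of_real ((1/s) powr (DIM('a) / 2)) = 1"
    using s by (simp add: powr_divide flip: of_real_mult)
  have int: "integrable (lborel \<Otimes>\<^sub>M lborel) (\<lambda>(x, \<xi>). ?H x \<xi>)"
  proof (rule lborel_pair.Fubini_integrable)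
    have "norm (?H x \<xi>) = \<bar>f x\<bar> * gauss (1/s) \<xi>" for x \<xi>
      by (simp add: norm_mult norm_wave del: minus_mult_left[symmetric])
    then show "integrable lborel (\<lambda>x. LINT \<xi>|lborel. norm (case (x, \<xi>) of (x, \<xi>) \<Rightarrow> ?H x \<xi>))"
      using f by simp
    show "AE x in lborel. integrable lborel (\<lambda>\<xi>. case (x, \<xi>) of (x, \<xi>) \<Rightarrow> ?H x \<xi>)"
      by (intro AE_I2) (simp only: prod.case, rule integrable_mult_right, rule g(1))
  qed simp
  have "complex_of_real (LINT x|lborel. f x * gauss s (x - a))
     = (LINT x|lborel. complex_of_real (f x) * complex_of_real (gauss s (x - a)))"
    by (subst integral_complex_of_real[symmetric]) simp
  also have "\<dots> = (LINT x|lborel. ?c * (LINT \<xi>|lborel. ?H x \<xi>))"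
    unfolding integral_mult_right_zero g(2)
    using c by (subst integral_mult_right_zero[symmetric])
      (intro Bochner_Integration.integral_cong refl, simp add: mult.left_commute[of _ ?c] mult.assoc[symmetric])
  also have "\<dots> = ?c * (LINT x|lborel. (LINT \<xi>|lborel. ?H x \<xi>))" by simp
  also have "(LINT x|lborel. (LINT \<xi>|lborel. ?H x \<xi>)) = (LINT \<xi>|lborel. (LINT x|lborel. ?H x \<xi>))"
    by (rule lborel_pair.Fubini_integral[symmetric, OF int])
  also have "\<dots> = (LINT \<xi>|lborel. gauss (1/s) \<xi> * wave (- (\<xi> \<bullet> a)) * (LINT x|lborel. f x * wave (x \<bullet> \<xi>)))"
  proof (intro Bochner_Integration.integral_cong refl)
    fix \<xi> :: 'a
    have H: "?H x \<xi> = gauss (1/s) \<xi> * wave (- (\<xi> \<bullet> a)) * (f x * wave (x \<bullet> \<xi>))" for x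
      by (simp add: inner_diff_right algebra_simps exp_diff exp_minus inner_commute divide_simps)
    show "(LINT x|lborel. ?H x \<xi>) = gauss (1/s) \<xi> * wave (- (\<xi> \<bullet> a)) * (LINT x|lborel. f x * wave (x \<bullet> \<xi>))"
      by (simp only: H integral_mult_right_zero)
  qed
  finally show ?thesis .
qed

text \<open>Tonelli's theorem moves the averaging from \<open>f\<close> to \<open>\<phi>\<close>.
  Continuity is therefore asked of \<open>\<phi>\<close> alone, and since \<open>\<phi>\<close> is
  at most 1 the integrable \<open>f\<close> itself is the dominating function.\<close>

lemma gauss_approx_identity:
  fixes \<phi> :: "'a::euclidean_space \<Rightarrow> real" and f :: "'a \<Rightarrow> ennreal"
  assumes \<phi>: "continuous_on UNIV \<phi>" "\<And>x. 0 \<le> \<phi> x" "\<And>x. \<phi> x \<le> 1"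
    and [measurable]: "f \<in> borel_measurable borel" and fin: "(\<integral>\<^sup>+x. f x \<partial>lborel) < \<infinity>"
  shows "(\<lambda>m. ennreal (real (Suc m) ^ DIM('a)) *
      (\<integral>\<^sup>+a. \<phi> a * (\<integral>\<^sup>+x. f x * gauss (1 / (real (Suc m))\<^sup>2) (x - a) \<partial>lborel) \<partial>lborel))
    \<longlonglongrightarrow> (\<integral>\<^sup>+x. f x * \<phi> x \<partial>lborel)"
proof -
  have [measurable]: "\<phi> \<in> borel_measurable borel" using \<phi>(1) by (rule borel_measurable_continuous_onI)
  \<comment> \<open>The parameter \<open>1 / (m + 1)^2\<close> means width
    \<open>1 / (m + 1)\<close>; the substitution \<open>a = x - y / (m + 1)\<close> uses up the
    prefactor \<open>(m + 1)^n\<close> and leaves an average against the fixed density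
    \<open>gauss 1\<close>.\<close>
  let ?T = "\<lambda>m x. \<integral>\<^sup>+y. \<phi> (x - (1 / real (Suc m)) *\<^sub>R y) * gauss 1 y \<partial>lborel"
  have g1: "(\<integral>\<^sup>+y. gauss 1 (y::'a) \<partial>lborel) = 1" by (simp add: nn_integral_gauss)
  have eq: "ennreal (real (Suc m) ^ DIM('a)) *
      (\<integral>\<^sup>+a. \<phi> a * (\<integral>\<^sup>+x. f x * gauss (1 / (real (Suc m))\<^sup>2) (x - a) \<partial>lborel) \<partial>lborel)
      = (\<integral>\<^sup>+x. f x * ?T m x \<partial>lborel)" for m
  proof -
    let ?c = "ennreal (real (Suc m) ^ DIM('a))"
    have T: "?T m x = ?c * (\<integral>\<^sup>+a. \<phi> a * gauss (1 / (real (Suc m))\<^sup>2) (x - a) \<partial>lborel)" for x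
    proof -
      have "(\<integral>\<^sup>+a. ennreal (\<phi> a * gauss (1 / (real (Suc m))\<^sup>2) (x - a)) \<partial>lborel)
         = ennreal (\<bar>- (1 / real (Suc m))\<bar> ^ DIM('a)) *
          (\<integral>\<^sup>+y. ennreal (\<phi> (x + (- (1 / real (Suc m))) *\<^sub>R y) * gauss (1 / (real (Suc m))\<^sup>2) (x - (x + (- (1 / real (Suc m))) *\<^sub>R y))) \<partial>lborel)"
        by (rule nn_integral_lborel_affine_euclidean) auto
      also have "(\<lambda>y. ennreal (\<phi> (x + (- (1 / real (Suc m))) *\<^sub>R y) * gauss (1 / (real (Suc m))\<^sup>2) (x - (x + (- (1 / real (Suc m))) *\<^sub>R y))))
         = (\<lambda>y. ennreal (\<phi> (x - (1 / real (Suc m)) *\<^sub>R y) * gauss 1 y))"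
        by (intro ext arg_cong[where f=ennreal]) (simp add: gauss_def power_mult_distrib power_divide)
      finally show ?thesis
        by (simp add: mult.assoc[symmetric] power_one_over del: of_nat_Suc flip: ennreal_mult)
    qed
    have "(\<integral>\<^sup>+x. f x * ?T m x \<partial>lborel) = (\<integral>\<^sup>+x. ?c * (\<integral>\<^sup>+a. f x * (\<phi> a * gauss (1 / (real (Suc m))\<^sup>2) (x - a)) \<partial>lborel) \<partial>lborel)"
      unfolding T by (intro nn_integral_cong) (simp add: nn_integral_cmult ennreal_mult' \<phi> mult_ac del: of_nat_Suc)
    also have "\<dots> = ?c * (\<integral>\<^sup>+x. (\<integral>\<^sup>+a. f x * (\<phi> a * gauss (1 / (real (Suc m))\<^sup>2) (x - a)) \<partial>lborel) \<partial>lborel)"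
      by (simp add: nn_integral_cmult del: of_nat_Suc)
    also have "(\<integral>\<^sup>+x. (\<integral>\<^sup>+a. f x * (\<phi> a * gauss (1 / (real (Suc m))\<^sup>2) (x - a)) \<partial>lborel) \<partial>lborel)
       = (\<integral>\<^sup>+a. (\<integral>\<^sup>+x. f x * (\<phi> a * gauss (1 / (real (Suc m))\<^sup>2) (x - a)) \<partial>lborel) \<partial>lborel)"
      by (rule lborel_pair.Fubini') simp
    also have "\<dots> = (\<integral>\<^sup>+a. \<phi> a * (\<integral>\<^sup>+x. f x * gauss (1 / (real (Suc m))\<^sup>2) (x - a) \<partial>lborel) \<partial>lborel)"
      by (intro nn_integral_cong, subst nn_integral_cmult[symmetric]) (auto intro!: nn_integral_cong simp: ennreal_mult' \<phi> mult_ac simp del: of_nat_Suc)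
    finally show ?thesis by simp
  qed
  have Tlim: "(\<lambda>m. ?T m x) \<longlonglongrightarrow> ennreal (\<phi> x)" for x
  proof -
    have "(\<lambda>m. ?T m x) \<longlonglongrightarrow> (\<integral>\<^sup>+y. \<phi> x * gauss 1 (y::'a) \<partial>lborel)"
    proof (rule nn_integral_dominated_convergence[where w="\<lambda>y. ennreal (gauss 1 y)"])
      show "AE y in lborel. (\<lambda>m. ennreal (\<phi> (x - (1 / real (Suc m)) *\<^sub>R y) * gauss 1 y)) \<longlonglongrightarrow> ennreal (\<phi> x * gauss 1 y)"
      proof (intro AE_I2 tendsto_ennrealI tendsto_mult tendsto_const)
        fix y
        have "(\<lambda>m. x - (1 / real (Suc m)) *\<^sub>R y) \<longlonglongrightarrow> x - 0 *\<^sub>R y"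
          by (intro tendsto_intros LIMSEQ_inverse_real_of_nat[unfolded inverse_eq_divide])
        then show "(\<lambda>m. \<phi> (x - (1 / real (Suc m)) *\<^sub>R y)) \<longlonglongrightarrow> \<phi> x"
          using continuous_on_tendsto_compose[OF \<phi>(1), of _ x sequentially] by simp
      qed
    qed (use \<phi> g1 in \<open>auto intro!: ennreal_leI mult_left_le_one_le\<close>)
    also have "(\<integral>\<^sup>+y. \<phi> x * gauss 1 (y::'a) \<partial>lborel) = \<phi> x"
      using g1 by (simp add: ennreal_mult' \<phi> nn_integral_cmult)
    finally show ?thesis .
  qed
  have T1: "?T m x \<le> 1" for m x
  proof -
    have "?T m x \<le> (\<integral>\<^sup>+y. gauss 1 (y::'a) \<partial>lborel)"
      by (intro nn_integral_mono ennreal_leI mult_left_le_one_le) (use \<phi> in auto)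
    then show ?thesis by (simp add: g1)
  qed
  show ?thesis unfolding eq
  proof (rule nn_integral_dominated_convergence[where w=f])
    show "AE x in lborel. f x * ?T m x \<le> f x" for m
      using T1 by (intro AE_I2) (metis mult.right_neutral mult_left_mono zero_le)
    have "AE x in lborel. f x \<noteq> \<infinity>" using fin by (intro nn_integral_PInf_AE) auto
    then show "AE x in lborel. (\<lambda>m. f x * ?T m x) \<longlonglongrightarrow> f x * \<phi> x"
      by eventually_elim (intro tendsto_mult_ennreal tendsto_const Tlim, auto)
  qed (use fin in auto)
qed

text \<open>Equal Gaussian averages give equal integrals against continuous functions into
  \<open>[0, 1]\<close>, hence equal masses of closed sets. These form an intersection-stable
  generator, so the two densities define the same finite measure.\<close>

lemma fourier_unique_nonneg:
  fixes f g :: "'a::euclidean_space \<Rightarrow> real"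
  assumes f: "integrable lborel f" "\<And>x. 0 \<le> f x" and g: "integrable lborel g" "\<And>x. 0 \<le> g x"
    and eq: "\<And>\<xi>. (LINT x|lborel. complex_of_real (f x) * wave (x \<bullet> \<xi>)) = (LINT x|lborel. complex_of_real (g x) * wave (x \<bullet> \<xi>))"
  shows "AE x in lborel. f x = g x"
proof -
  have [measurable]: "f \<in> borel_measurable borel" "g \<in> borel_measurable borel"
    using f(1) g(1) by (auto simp: borel_measurable_integrable)
  have G: "(\<integral>\<^sup>+x. ennreal (h x) * ennreal (gauss s (x - a)) \<partial>lborel) = ennreal (LINT x|lborel. h x * gauss s (x - a))"
    if h: "integrable lborel h" "\<And>x. 0 \<le> h x" and "s > 0" for h :: "'a \<Rightarrow> real" and s a
  proof -
    have "integrable lborel (\<lambda>x. h x * gauss s (x - a))"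
      by (rule Bochner_Integration.integrable_bound[OF h(1)])
         (use h \<open>s > 0\<close> gauss_le_1[of s] in \<open>auto intro!: mult_left_le simp: abs_mult\<close>)
    then show ?thesis using h
      by (subst nn_integral_eq_integral[symmetric]) (auto simp: ennreal_mult')
  qed
  have Geq: "(LINT x|lborel. f x * gauss s (x - a)) = (LINT x|lborel. g x * gauss s (x - a))" if "s > 0" for s a
    using integral_gauss_eq_fourier[OF f(1) that, of a] integral_gauss_eq_fourier[OF g(1) that, of a]
    by (simp only: eq) (metis of_real_eq_iff)
  have fin: "(\<integral>\<^sup>+x. ennreal (h x) \<partial>lborel) < \<infinity>" if "integrable lborel h" "\<And>x. 0 \<le> h x" for h :: "'a \<Rightarrow> real"
    using that by (simp add: nn_integral_eq_integral)
  have cont: "(\<integral>\<^sup>+x. ennreal (f x) * ennreal (\<phi> x) \<partial>lborel) = (\<integral>\<^sup>+x. ennreal (g x) * ennreal (\<phi> x) \<partial>lborel)"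
    if \<phi>: "continuous_on UNIV \<phi>" "\<And>x. 0 \<le> \<phi> x" "\<And>x. \<phi> x \<le> 1" for \<phi> :: "'a \<Rightarrow> real"
  proof (rule LIMSEQ_unique)
    show "(\<lambda>m. ennreal (real (Suc m) ^ DIM('a)) *
      (\<integral>\<^sup>+a. \<phi> a * (\<integral>\<^sup>+x. g x * ennreal (gauss (1 / (real (Suc m))\<^sup>2) (x - a)) \<partial>lborel) \<partial>lborel))
      \<longlonglongrightarrow> (\<integral>\<^sup>+x. g x * ennreal (\<phi> x) \<partial>lborel)"
      by (rule gauss_approx_identity[OF \<phi>]) (use fin[OF g] in auto)
    have "(\<lambda>m. ennreal (real (Suc m) ^ DIM('a)) *
      (\<integral>\<^sup>+a. \<phi> a * (\<integral>\<^sup>+x. f x * ennreal (gauss (1 / (real (Suc m))\<^sup>2) (x - a)) \<partial>lborel) \<partial>lborel))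
      \<longlonglongrightarrow> (\<integral>\<^sup>+x. f x * ennreal (\<phi> x) \<partial>lborel)"
      by (rule gauss_approx_identity[OF \<phi>]) (use fin[OF f] in auto)
    then show "(\<lambda>m. ennreal (real (Suc m) ^ DIM('a)) *
      (\<integral>\<^sup>+a. \<phi> a * (\<integral>\<^sup>+x. g x * ennreal (gauss (1 / (real (Suc m))\<^sup>2) (x - a)) \<partial>lborel) \<partial>lborel))
      \<longlonglongrightarrow> (\<integral>\<^sup>+x. f x * ennreal (\<phi> x) \<partial>lborel)"
      by (simp add: G f g Geq del: of_nat_Suc)
  qed
  have closed_eq: "(\<integral>\<^sup>+x. ennreal (f x) * indicator C x \<partial>lborel) = (\<integral>\<^sup>+x. ennreal (g x) * indicator C x \<partial>lborel)"
    if C: "closed C" "C \<noteq> {}" for C :: "'a set"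
  proof (rule LIMSEQ_unique)
    \<comment> \<open>Tents of slope \<open>m\<close> over the distance to \<open>C\<close>: they
      are 1 on \<open>C\<close> and eventually vanish at every other point because \<open>C\<close>
      is closed.\<close>
    let ?\<phi> = "\<lambda>m x. max 0 (1 - real m * infdist x C)"
    have lim: "(\<lambda>m. \<integral>\<^sup>+x. ennreal (h x) * ennreal (?\<phi> m x) \<partial>lborel) \<longlonglongrightarrow> (\<integral>\<^sup>+x. ennreal (h x) * indicator C x \<partial>lborel)"
      if h: "integrable lborel h" "\<And>x. 0 \<le> h x" for h
    proof (rule nn_integral_dominated_convergence[where w="\<lambda>x. ennreal (h x)"])
      have [measurable]: "h \<in> borel_measurable lborel" using h by auto
      have [measurable]: "(\<lambda>x. infdist x C) \<in> borel_measurable borel"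
        by (intro borel_measurable_continuous_onI continuous_intros)
      show "(\<lambda>x. ennreal (h x) * ennreal (?\<phi> m x)) \<in> borel_measurable lborel" for m by measurable
      have [measurable]: "C \<in> sets borel" using C by auto
      show "(\<lambda>x. ennreal (h x) * indicator C x) \<in> borel_measurable lborel" by measurable
      show "AE x in lborel. (\<lambda>m. ennreal (h x) * ennreal (?\<phi> m x)) \<longlonglongrightarrow> ennreal (h x) * indicator C x"
      proof (intro AE_I2 tendsto_mult_ennreal tendsto_const)
        fix x
        show "(\<lambda>m. ennreal (?\<phi> m x)) \<longlonglongrightarrow> indicator C x"
        proof (cases "x \<in> C")
          case True then show ?thesis by simp
        next
          case False
          then have d: "infdist x C > 0" using C by (simp add: infdist_pos_not_in_closed)
          have "eventually (\<lambda>m. ennreal (?\<phi> m x) = 0) sequentially"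
          proof (rule eventually_sequentiallyI[of "nat \<lceil>1 / infdist x C\<rceil>"])
            fix m assume "nat \<lceil>1 / infdist x C\<rceil> \<le> m"
            then have "1 / infdist x C \<le> m" by linarith
            then show "ennreal (?\<phi> m x) = 0" using d by (simp add: field_simps)
          qed
          then show ?thesis using False by (simp add: tendsto_eventually)
        qed
      qed (auto simp: indicator_def split: if_splits)
      show "AE x in lborel. ennreal (h x) * ennreal (?\<phi> m x) \<le> ennreal (h x)" for m
        using infdist_nonneg[of _ C] by (intro AE_I2) (simp add: h mult_left_le flip: ennreal_mult)
    qed (use fin[OF h] h in auto)
    show "(\<lambda>m. \<integral>\<^sup>+x. ennreal (g x) * ennreal (?\<phi> m x) \<partial>lborel) \<longlonglongrightarrow> (\<integral>\<^sup>+x. ennreal (g x) * indicator C x \<partial>lborel)"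
      by (rule lim[OF g])
    have "(\<integral>\<^sup>+x. ennreal (f x) * ennreal (?\<phi> m x) \<partial>lborel) = (\<integral>\<^sup>+x. ennreal (g x) * ennreal (?\<phi> m x) \<partial>lborel)" for m
      using infdist_nonneg[of _ C] by (intro cont continuous_intros) auto
    then show "(\<lambda>m. \<integral>\<^sup>+x. ennreal (g x) * ennreal (?\<phi> m x) \<partial>lborel) \<longlonglongrightarrow> (\<integral>\<^sup>+x. ennreal (f x) * indicator C x \<partial>lborel)"
      using lim[OF f] by simp
  qed
  have "density lborel (\<lambda>x. ennreal (f x)) = density lborel (\<lambda>x. ennreal (g x))"
  proof (rule measure_eqI_generator_eq[where E="{C. closed C}" and \<Omega>=UNIV and A="\<lambda>_. UNIV"])
    show "Int_stable {C::'a set. closed C}" by (auto simp: Int_stable_def)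
    have sb: "sets (borel :: 'a measure) = sigma_sets UNIV {C. closed C}"
      by (simp add: borel_eq_closed)
    show "sets (density lborel (\<lambda>x. ennreal (f x))) = sigma_sets UNIV {C::'a set. closed C}"
       "sets (density lborel (\<lambda>x. ennreal (g x))) = sigma_sets UNIV {C::'a set. closed C}"
      by (simp_all add: sb)
    show "emeasure (density lborel (\<lambda>x. ennreal (f x))) C = emeasure (density lborel (\<lambda>x. ennreal (g x))) C"
      if "C \<in> {C. closed C}" for C
      using that closed_eq[of C] by (cases "C = {}") (auto simp: emeasure_density)
    show "emeasure (density lborel (\<lambda>x. ennreal (f x))) UNIV \<noteq> \<infinity>"
      using fin[OF f] by (simp add: emeasure_density)
  qed auto
  then have "AE x in lborel. ennreal (f x) = ennreal (g x)"
    by (intro sigma_finite_measure.density_unique[OF sigma_finite_lborel]) auto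
  then show ?thesis using f g by simp
qed

section \<open>The Bessel kernel as a mixture of Gaussians\<close>

text \<open>Extended nonnegative values allow the integrals to be exchanged before any finiteness is
  known.\<close>

definition bform :: "('a::euclidean_space \<Rightarrow> ennreal) \<Rightarrow> ('a \<Rightarrow> ennreal) \<Rightarrow> ('a \<Rightarrow> ennreal) \<Rightarrow> ennreal" where
  "bform k f h = (\<integral>\<^sup>+x. \<integral>\<^sup>+y. f x * k (x - y) * h y \<partial>lborel \<partial>lborel)"

text \<open>This comes from writing \<open>(1 + 4 pi^2 r)^(- \<alpha> / 2)\<close> as a Gamma
  integral in \<open>s\<close>; the power \<open>s^(- n / 2)\<close> in it compensates the mass of
  the Gaussian. Without the exponential factor the mixture would be a Riesz kernel, homogeneous of
  degree \<open>\<alpha> - n\<close>.\<close>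

definition bessel_weight :: "real \<Rightarrow> real \<Rightarrow> real \<Rightarrow> real" where
  "bessel_weight n \<alpha> s = (if s > 0 then s powr ((\<alpha> - n) / 2 - 1) * exp (- s / (4 * pi)) / ((4 * pi) powr (\<alpha> / 2) * Gamma (\<alpha> / 2)) else 0)"

text \<open>The values are extended because for \<open>0 < \<alpha> \<le> n\<close> the integral
  diverges at the origin.\<close>

definition bessel_kernel :: "real \<Rightarrow> 'a::euclidean_space \<Rightarrow> ennreal" where
  "bessel_kernel \<alpha> z = (\<integral>\<^sup>+s. ennreal (bessel_weight DIM('a) \<alpha> s) * ennreal (gauss s z) \<partial>lborel)"

lemma measurable_bessel_weight [measurable]: "bessel_weight n \<alpha> \<in> borel_measurable borel"
  unfolding bessel_weight_def[abs_def] by measurable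

lemma bessel_weight_nonneg: "\<alpha> > 0 \<Longrightarrow> 0 \<le> bessel_weight n \<alpha> s"
  by (simp add: bessel_weight_def Gamma_real_pos less_imp_le)

lemma bessel_weight_pos: "\<alpha> > 0 \<Longrightarrow> s > 0 \<Longrightarrow> 0 < bessel_weight n \<alpha> s"
  by (simp add: bessel_weight_def Gamma_real_pos)

lemma bessel_weight_0: "s \<le> 0 \<Longrightarrow> bessel_weight n \<alpha> s = 0"
  by (simp add: bessel_weight_def)

lemma measurable_bessel_kernel [measurable]: "bessel_kernel \<alpha> \<in> borel_measurable borel"
  unfolding bessel_kernel_def[abs_def] by measurable

text \<open>The powers of \<open>s\<close> that depend on \<open>n\<close> cancel and the
  exponentials combine to the single rate \<open>l\<close>. What remains is a Gamma integral, and
  \<open>4 * pi * l\<close> equals \<open>1 + 4 * pi^2 * r\<close>.\<close>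

lemma nn_integral_bessel_weight_exp:
  fixes n :: real
  assumes \<alpha>: "\<alpha> > 0" and r: "r \<ge> 0"
  shows "(\<integral>\<^sup>+s. ennreal (bessel_weight n \<alpha> s) * ennreal (s powr (n / 2) * exp (- (pi * s * r))) \<partial>lborel)
    = ennreal ((1 + 4 * pi\<^sup>2 * r) powr (- \<alpha> / 2))"
proof -
  define l where "l = 1 / (4 * pi) + pi * r"
  define C where "C = (4 * pi) powr (\<alpha> / 2) * Gamma (\<alpha> / 2)"
  have l: "l > 0" using r by (simp add: l_def add_pos_nonneg)
  have G: "Gamma (\<alpha> / 2) > 0" using \<alpha> by (simp add: Gamma_real_pos)
  have C: "C > 0" using G by (simp add: C_def)
  let ?h = "\<lambda>t. ennreal (indicator {0..} t * t powr (\<alpha> / 2 - 1) / exp t)"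
  have "(\<integral>\<^sup>+s. ennreal (bessel_weight n \<alpha> s) * ennreal (s powr (n / 2) * exp (- (pi * s * r))) \<partial>lborel)
     = (\<integral>\<^sup>+s. ennreal (l powr (1 - \<alpha> / 2) / C) * ?h (0 + l * s) \<partial>lborel)"
  proof (rule nn_integral_cong_AE, rule AE_mp[OF AE_lborel_singleton[of 0]], intro AE_I2 impI)
    fix s :: real assume s0: "s \<noteq> 0"
    show "ennreal (bessel_weight n \<alpha> s) * ennreal (s powr (n / 2) * exp (- (pi * s * r)))
      = ennreal (l powr (1 - \<alpha> / 2) / C) * ?h (0 + l * s)"
    proof (cases "s > 0")
      case True
      have "s powr ((\<alpha> - n) / 2 - 1) * s powr (n / 2) = s powr (\<alpha> / 2 - 1)"
        by (simp only: powr_add[symmetric], rule arg_cong[where f="(powr) s"]) (simp add: field_simps)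
      moreover have "l powr (1 - \<alpha> / 2) * (l * s) powr (\<alpha> / 2 - 1) = s powr (\<alpha> / 2 - 1)"
      proof -
        have "l powr (1 - \<alpha> / 2) * l powr (\<alpha> / 2 - 1) = 1" using l by (simp flip: powr_add)
        then show ?thesis using l True by (simp add: powr_mult)
      qed
      moreover have "exp (- s / (4 * pi)) * exp (- (pi * s * r)) = inverse (exp (l * s))"
        unfolding exp_minus[symmetric] mult_exp_exp by (simp add: l_def algebra_simps)
      moreover have "bessel_weight n \<alpha> s * (s powr (n / 2) * exp (- (pi * s * r)))
         = (s powr ((\<alpha> - n) / 2 - 1) * s powr (n / 2)) * (exp (- s / (4 * pi)) * exp (- (pi * s * r))) / C"
        using True by (simp add: bessel_weight_def C_def)
      moreover have "l powr (1 - \<alpha> / 2) / C * (indicator {0..} (l * s) * (l * s) powr (\<alpha> / 2 - 1) / exp (l * s))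
         = (l powr (1 - \<alpha> / 2) * (l * s) powr (\<alpha> / 2 - 1)) * inverse (exp (l * s)) / C"
      proof -
        have "indicator {0..} (l * s) = (1::real)" using True l by simp
        then show ?thesis by (simp only: divide_inverse mult_1 mult_ac)
      qed
      ultimately have "bessel_weight n \<alpha> s * (s powr (n / 2) * exp (- (pi * s * r)))
         = l powr (1 - \<alpha> / 2) / C * (indicator {0..} (l * s) * (l * s) powr (\<alpha> / 2 - 1) / exp (l * s))"
        by (simp only:)
      then show ?thesis
        using C bessel_weight_nonneg[OF \<alpha>] by (simp flip: ennreal_mult)
    next
      case False
      then have "l * s < 0" using s0 l by (simp add: mult_less_0_iff)
      then show ?thesis using False by (simp add: bessel_weight_def)
    qed
  qed
  also have "\<dots> = ennreal (l powr (1 - \<alpha> / 2) / C) * (\<integral>\<^sup>+s. ?h (0 + l * s) \<partial>lborel)"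
    by (simp add: nn_integral_cmult)
  also have "(\<integral>\<^sup>+s. ?h (0 + l * s) \<partial>lborel) = ennreal (Gamma (\<alpha> / 2) / l)"
  proof -
    have "ennreal (Gamma (\<alpha> / 2)) = ennreal l * (\<integral>\<^sup>+s. ?h (0 + l * s) \<partial>lborel)"
      using l \<alpha> nn_integral_real_affine[of ?h l 0] by (simp add: Gamma_conv_nn_integral_real)
    then have "ennreal (1 / l) * ennreal (Gamma (\<alpha> / 2)) = (ennreal (1/l) * ennreal l) * (\<integral>\<^sup>+s. ?h (0 + l * s) \<partial>lborel)"
      by (simp add: mult.assoc)
    then show ?thesis using l by (simp add: ennreal_mult'[symmetric])
  qed
  also have "ennreal (l powr (1 - \<alpha> / 2) / C) * ennreal (Gamma (\<alpha> / 2) / l)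
      = ennreal (l powr (1 - \<alpha> / 2) / C * (Gamma (\<alpha> / 2) / l))"
    using C G l by (intro ennreal_mult[symmetric]) auto
  also have "l powr (1 - \<alpha> / 2) / C * (Gamma (\<alpha> / 2) / l) = (4 * pi * l) powr (- \<alpha> / 2)"
  proof -
    have "l powr (1 - \<alpha> / 2) = l * l powr (- \<alpha> / 2)"
      using l powr_add[of l 1 "- \<alpha> / 2"] by simp
    then have "l powr (1 - \<alpha> / 2) / C * (Gamma (\<alpha> / 2) / l) = l powr (- \<alpha> / 2) * (4 * pi) powr (- \<alpha> / 2)"
      using l G by (simp add: C_def powr_minus_divide)
    then show ?thesis using l by (simp add: powr_mult)
  qed
  also have "4 * pi * l = 1 + 4 * pi\<^sup>2 * r"
    by (simp add: l_def field_simps power2_eq_square)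
  finally show ?thesis .
qed

text \<open>This is the frequency zero case of the Gamma integral above. In particular the kernel is
  finite almost everywhere.\<close>

lemma nn_integral_bessel_kernel:
  assumes \<alpha>: "\<alpha> > 0"
  shows "(\<integral>\<^sup>+z. bessel_kernel \<alpha> (z::'a::euclidean_space) \<partial>lborel) = 1"
proof -
  have "(\<integral>\<^sup>+z. bessel_kernel \<alpha> (z::'a) \<partial>lborel)
      = (\<integral>\<^sup>+s. \<integral>\<^sup>+z. ennreal (bessel_weight DIM('a) \<alpha> s) * ennreal (gauss s (z::'a)) \<partial>lborel \<partial>lborel)"
    unfolding bessel_kernel_def by (rule lborel_pair.Fubini') simp
  also have "\<dots> = (\<integral>\<^sup>+s. ennreal (bessel_weight DIM('a) \<alpha> s) * ennreal (s powr (DIM('a) / 2) * exp (- (pi * s * 0))) \<partial>lborel)"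
  proof (rule nn_integral_cong)
    fix s :: real
    show "(\<integral>\<^sup>+z. ennreal (bessel_weight DIM('a) \<alpha> s) * ennreal (gauss s (z::'a)) \<partial>lborel) = ennreal (bessel_weight DIM('a) \<alpha> s) * ennreal (s powr (DIM('a) / 2) * exp (- (pi * s * 0)))"
      by (cases "s > 0") (simp_all add: nn_integral_cmult nn_integral_gauss bessel_weight_0)
  qed
  also have "\<dots> = 1" using nn_integral_bessel_weight_exp[OF \<alpha>, of 0 "DIM('a)"] by simp
  finally show ?thesis .
qed

lemma bessel_kernel_fourier:
  fixes \<xi> :: "'a::euclidean_space"
  assumes \<alpha>: "\<alpha> > 0"
  shows "integrable lborel (\<lambda>z::'a. enn2real (bessel_kernel \<alpha> z))"
    and "(LINT z|lborel. complex_of_real (enn2real (bessel_kernel \<alpha> z)) * wave (z \<bullet> \<xi>))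
       = complex_of_real ((1 + 4 * pi\<^sup>2 * (norm \<xi>)\<^sup>2) powr (- \<alpha> / 2))"
proof -
  let ?w = "bessel_weight DIM('a) \<alpha>"
  note w0 = bessel_weight_nonneg[OF \<alpha>]
  have fin: "AE z in lborel. bessel_kernel \<alpha> (z::'a) \<noteq> \<infinity>"
    using nn_integral_bessel_kernel[OF \<alpha>, where 'a='a] by (intro nn_integral_PInf_AE) auto
  then have AE: "AE z in lborel. ennreal (enn2real (bessel_kernel \<alpha> (z::'a))) = bessel_kernel \<alpha> z"
    by eventually_elim (simp add: top.not_eq_extremum)
  have "(\<integral>\<^sup>+z. ennreal (enn2real (bessel_kernel \<alpha> (z::'a))) \<partial>lborel) = 1"
    by (subst nn_integral_cong_AE[OF AE]) (rule nn_integral_bessel_kernel[OF \<alpha>])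
  then show int: "integrable lborel (\<lambda>z::'a. enn2real (bessel_kernel \<alpha> z))"
    by (intro integrableI_nonneg) auto
  let ?H = "\<lambda>z::'a. \<lambda>s. complex_of_real (?w s * gauss s z) * wave (z \<bullet> \<xi>)"
  have i2: "integrable (lborel \<Otimes>\<^sub>M lborel) (\<lambda>(z, s). ?H z s)"
  proof (subst integrable_iff_bounded, intro conjI)
    have "(\<integral>\<^sup>+p. ennreal (norm (case p of (z, s) \<Rightarrow> ?H z s)) \<partial>(lborel \<Otimes>\<^sub>M lborel))
        = (\<integral>\<^sup>+p. (case p of (z::'a, s) \<Rightarrow> ennreal (?w s) * ennreal (gauss s z)) \<partial>(lborel \<Otimes>\<^sub>M lborel))"
      by (intro nn_integral_cong)
        (auto simp: norm_mult norm_wave w0 ennreal_mult' simp del: minus_mult_left[symmetric] of_real_mult)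
    also have "\<dots> = (\<integral>\<^sup>+z. bessel_kernel \<alpha> (z::'a) \<partial>lborel)"
      unfolding bessel_kernel_def by (subst lborel.nn_integral_fst[symmetric]) auto
    finally show "(\<integral>\<^sup>+p. ennreal (norm (case p of (z, s) \<Rightarrow> ?H z s)) \<partial>(lborel \<Otimes>\<^sub>M lborel)) < \<infinity>"
      by (simp add: nn_integral_bessel_kernel[OF \<alpha>])
  qed simp
  have "(LINT z|lborel. complex_of_real (enn2real (bessel_kernel \<alpha> z)) * wave (z \<bullet> \<xi>))
     = (LINT z|lborel. LINT s|lborel. ?H z s)"
  proof (rule integral_cong_AE)
    show "AE z in lborel. complex_of_real (enn2real (bessel_kernel \<alpha> z)) * wave (z \<bullet> \<xi>) = (LINT s|lborel. ?H z s)"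
      using fin
    proof eventually_elim
      case (elim z)
      have "enn2real (bessel_kernel \<alpha> z) = (LINT s|lborel. ?w s * gauss s z)"
        unfolding bessel_kernel_def by (subst integral_eq_nn_integral) (auto simp: w0 ennreal_mult')
      then show ?case
        by (simp only: integral_complex_of_real integral_mult_left_zero)
    qed
  qed (simp_all)
  also have "\<dots> = (LINT s|lborel. LINT z|lborel. ?H z s)"
    by (rule lborel_pair.Fubini_integral[symmetric, OF i2])
  also have "\<dots> = (LINT s|lborel. complex_of_real (?w s * (s powr (DIM('a) / 2) * exp (- (pi * s * (norm \<xi>)\<^sup>2)))))"
  proof (rule Bochner_Integration.integral_cong[OF refl])
    fix s :: real
    have "?H z s = complex_of_real (?w s) * (complex_of_real (gauss s z) * wave (z \<bullet> \<xi>))" for z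
      by (simp add: mult.assoc)
    then show "(LINT z|lborel. ?H z s) = complex_of_real (?w s * (s powr (DIM('a) / 2) * exp (- (pi * s * (norm \<xi>)\<^sup>2))))"
      by (cases "s > 0") (simp_all only: integral_mult_right_zero gauss_fourier(2) of_real_mult bessel_weight_0 not_less, simp_all)
  qed
  also have "\<dots> = complex_of_real (LINT s|lborel. ?w s * (s powr (DIM('a) / 2) * exp (- (pi * s * (norm \<xi>)\<^sup>2))))"
    by (rule integral_complex_of_real)
  also have "(LINT s|lborel. ?w s * (s powr (DIM('a) / 2) * exp (- (pi * s * (norm \<xi>)\<^sup>2))))
     = (1 + 4 * pi\<^sup>2 * (norm \<xi>)\<^sup>2) powr (- \<alpha> / 2)"
    by (subst integral_eq_nn_integral)
       (use nn_integral_bessel_weight_exp[OF \<alpha>, of "(norm \<xi>)\<^sup>2" "DIM('a)"] in \<open>auto simp: w0 ennreal_mult'\<close>)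
  finally show "(LINT z|lborel. complex_of_real (enn2real (bessel_kernel \<alpha> z)) * wave (z \<bullet> \<xi>))
       = complex_of_real ((1 + 4 * pi\<^sup>2 * (norm \<xi>)\<^sup>2) powr (- \<alpha> / 2))" .
qed

lemma is_bessel_kernel_AE:
  fixes g :: "'a::euclidean_space \<Rightarrow> real"
  assumes g: "is_bessel_kernel \<alpha> g" and \<alpha>: "\<alpha> > 0"
  shows "AE x in lborel. ennreal (g x) = bessel_kernel \<alpha> x"
proof -
  have gm: "g \<in> borel_measurable lebesgue" and gi: "integrable lebesgue g" and g0: "\<And>x. g x > 0"
    and ft: "\<And>\<xi>. fourier (\<lambda>x. complex_of_real (g x)) \<xi> = complex_of_real ((1 + 4 * pi\<^sup>2 * (norm \<xi>)\<^sup>2) powr (- \<alpha> / 2))"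
    using g by (auto simp: is_bessel_kernel_def)
  obtain g1 where g1 [measurable]: "g1 \<in> borel_measurable lborel" and eq1: "AE x in lborel. g x = g1 x"
    using completion_ex_borel_measurable_real[OF gm] by blast
  \<comment> \<open>A Borel representative of \<open>g\<close> inherits positivity only almost
    everywhere; the absolute value makes it nonnegative everywhere, as
    \<open>fourier_unique_nonneg\<close> requires.\<close>
  define g2 where "g2 x = \<bar>g1 x\<bar>" for x
  have [measurable]: "g2 \<in> borel_measurable lborel" by (simp add: g2_def[abs_def])
  have eq2: "AE x in lborel. g x = g2 x"
    using eq1 by eventually_elim (metis abs_of_pos g0 g2_def)
  then have eq2': "AE x in lebesgue. g x = g2 x" by (rule AE_completion)
  have g2m: "g2 \<in> borel_measurable lebesgue" by (rule measurable_completion) simp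
  have i2: "integrable lborel g2"
    using gi integrable_cong_AE[OF gm g2m eq2'] integrable_completion[of g2 lborel] by simp
  have F: "(LINT x|lborel. complex_of_real (g2 x) * wave (x \<bullet> \<xi>)) = fourier (\<lambda>x. complex_of_real (g x)) \<xi>" for \<xi>
  proof -
    have m: "(\<lambda>x. wave (x \<bullet> \<xi>)) \<in> borel_measurable lebesgue"
      by (rule measurable_completion) simp
    have "fourier (\<lambda>x. complex_of_real (g x)) \<xi> = (LINT x|lebesgue. complex_of_real (g2 x) * wave (x \<bullet> \<xi>))"
      unfolding fourier_def
      by (rule integral_cong_AE)
         (use m gm g2m eq2' in \<open>auto intro!: borel_measurable_times borel_measurable_of_real\<close>)
    also have "\<dots> = (LINT x|lborel. complex_of_real (g2 x) * wave (x \<bullet> \<xi>))"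
      by (rule integral_completion) simp
    finally show ?thesis by simp
  qed
  have "AE x in lborel. g2 x = enn2real (bessel_kernel \<alpha> x)"
    by (rule fourier_unique_nonneg[OF i2 _ bessel_kernel_fourier(1)[OF \<alpha>]])
       (simp_all only: F ft bessel_kernel_fourier(2)[OF \<alpha>], simp_all add: g2_def)
  moreover have "AE z in lborel. bessel_kernel \<alpha> (z::'a) \<noteq> \<infinity>"
    using nn_integral_bessel_kernel[OF \<alpha>, where 'a='a] by (intro nn_integral_PInf_AE) auto
  ultimately show ?thesis using eq2
    by eventually_elim (simp add: top.not_eq_extremum)
qed

section \<open>Monotonicity, positivity and size of the kernel\<close>

lemma bessel_kernel_antimono:
  fixes x y :: "'a::euclidean_space"
  assumes "norm x \<le> norm y" "\<alpha> > 0"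
  shows "bessel_kernel \<alpha> y \<le> bessel_kernel \<alpha> x"
  unfolding bessel_kernel_def
proof (rule nn_integral_mono)
  fix s
  show "ennreal (bessel_weight DIM('a) \<alpha> s) * ennreal (gauss s y) \<le> ennreal (bessel_weight DIM('a) \<alpha> s) * ennreal (gauss s x)"
    using assms by (cases "s > 0")
      (auto simp: gauss_def bessel_weight_0 intro!: mult_left_mono ennreal_leI divide_right_mono mult_left_mono power_mono)
qed

lemma nn_integral_pos:
  fixes h :: "real \<Rightarrow> ennreal"
  assumes [measurable]: "h \<in> borel_measurable borel" and pos: "\<And>s. 0 < s \<Longrightarrow> s < 1 \<Longrightarrow> 0 < h s"
  shows "0 < (\<integral>\<^sup>+s. h s \<partial>lborel)"
proof (rule ccontr)
  assume "\<not> 0 < (\<integral>\<^sup>+s. h s \<partial>lborel)"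
  then have "AE s in lborel. h s = 0" by (simp add: nn_integral_0_iff_AE)
  then have "AE s in lborel. s \<notin> {0<..<1::real}"
  proof eventually_elim
    case (elim s)
    then show ?case using pos[of s] by auto
  qed
  then have "{0<..<1::real} \<in> null_sets lborel" by (subst AE_iff_null_sets) auto
  then show False by (simp add: null_sets_def)
qed

lemma bessel_kernel_pos: "\<alpha> > 0 \<Longrightarrow> 0 < bessel_kernel \<alpha> z"
  unfolding bessel_kernel_def using bessel_weight_pos[of \<alpha>]
  by (intro nn_integral_pos) (auto simp: ennreal_zero_less_mult_iff)

text \<open>Apply \<open>ln x \<le> x - 1\<close> at \<open>x = y / a\<close>, which is sharp at the
  maximum point \<open>y = a\<close> of \<open>y powr a * exp (- y)\<close>.\<close>

lemma powr_le_exp: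
  assumes "a > 0" "y > 0"
  shows "y powr a \<le> a powr a * exp (y::real)"
proof -
  have "ln (y / a) \<le> y / a - 1" using assms by (intro ln_le_minus_one) auto
  then have "a * ln y \<le> a * ln a + y - a" using assms by (simp add: ln_div field_simps)
  then have "exp (a * ln y) \<le> exp (a * ln a + y)" using assms by simp
  then show ?thesis using assms by (simp add: powr_def exp_add mult.commute)
qed

lemma nn_integral_powr_exp_inverse:
  assumes "e < -1"
  shows "(\<integral>\<^sup>+t. ennreal (indicator {0<..} t * t powr e * exp (- (pi / t))) \<partial>lborel) < \<infinity>"
proof -
  \<comment> \<open>This is the constant that \<open>powr_le_exp\<close> yields for
    \<open>y = pi / t\<close> and exponent \<open>- e\<close>. It serves \<open>t \<le> 1\<close>,
    where the exponential beats the singular power.\<close>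
  define C where "C = (- e) powr (- e) * pi powr e"
  have C: "C \<ge> 0" by (simp add: C_def)
  have b: "indicator {0<..} t * t powr e * exp (- (pi / t)) \<le> C * indicator {0..1} t + indicator {1..} t * t powr e" for t :: real
  proof (cases "0 < t \<and> t \<le> 1")
    case True
    have "(pi / t) powr (- e) \<le> (- e) powr (- e) * exp (pi / t)"
      using assms True by (intro powr_le_exp) auto
    then have "t powr e * exp (- (pi / t)) \<le> C"
      using True unfolding C_def by (simp add: powr_divide exp_minus powr_minus field_simps)
    then show ?thesis using True by (auto simp: indicator_def intro: add_increasing2)
  qed (auto simp: indicator_def C intro: mult_left_le)
  have "((\<lambda>x. x powr e) has_integral -(1 powr (e+1)) / (e+1)) {1..}"
    using assms by (intro has_integral_powr_to_inf) auto
  from nn_integral_has_integral_lebesgue[OF _ this]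
  have 1: "(\<integral>\<^sup>+t. ennreal (indicator {1..} t * t powr e) \<partial>lborel) < \<infinity>" by simp
  have "(\<integral>\<^sup>+t. ennreal (indicator {0<..} t * t powr e * exp (- (pi / t))) \<partial>lborel)
      \<le> (\<integral>\<^sup>+t. ennreal C * indicator {0..1} t + ennreal (indicator {1..} t * t powr e) \<partial>lborel)"
    using b C by (intro nn_integral_mono)
      (auto intro!: ennreal_leI simp: ennreal_indicator[symmetric] ennreal_mult'[symmetric] ennreal_plus[symmetric] simp del: ennreal_plus ennreal_indicator)
  also have "\<dots> = ennreal C + (\<integral>\<^sup>+t. ennreal (indicator {1..} t * t powr e) \<partial>lborel)"
    by (subst nn_integral_add) (auto simp: nn_integral_cmult_indicator)
  also have "\<dots> < \<infinity>" using 1 by (simp add: less_top)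
  finally show ?thesis .
qed

text \<open>Bounding \<open>exp (- s / (4 * pi))\<close> by 1 leaves a homogeneous integral, from
  which the substitution \<open>s = |z|^2 * t\<close> extracts the power of \<open>norm z\<close>.
  The remaining integral \<open>A\<close> converges at infinity because
  \<open>\<alpha> < n\<close>.\<close>

lemma bessel_kernel_le_riesz:
  fixes \<alpha> :: real
  assumes \<alpha>: "0 < \<alpha>" "\<alpha> < DIM('a)"
  obtains C where "C \<ge> 0" "\<And>z::'a::euclidean_space. z \<noteq> 0 \<Longrightarrow> bessel_kernel \<alpha> z \<le> ennreal (C * norm z powr (\<alpha> - DIM('a)))"
proof -
  define e where "e = (\<alpha> - DIM('a)) / 2 - 1"
  have e: "e < -1" using \<alpha> by (simp add: e_def)
  define A where "A = (\<integral>\<^sup>+t. ennreal (indicator {0<..} t * t powr e * exp (- (pi / t))) \<partial>lborel)"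
  have A: "A < \<infinity>" unfolding A_def by (rule nn_integral_powr_exp_inverse[OF e])
  define D where "D = (4 * pi) powr (\<alpha> / 2) * Gamma (\<alpha> / 2)"
  have D: "D > 0" using \<alpha> by (simp add: D_def Gamma_real_pos)
  have "bessel_kernel \<alpha> z \<le> ennreal (enn2real A / D * norm z powr (\<alpha> - DIM('a)))" if z: "z \<noteq> 0" for z :: 'a
  proof -
    let ?r = "(norm z)\<^sup>2"
    have r: "?r > 0" using z by simp
    have "bessel_kernel \<alpha> z \<le> (\<integral>\<^sup>+s. ennreal (1 / D) * ennreal (indicator {0<..} s * s powr e * exp (- (pi * ?r / s))) \<partial>lborel)"
      unfolding bessel_kernel_def
    proof (rule nn_integral_mono)
      fix s
      have "bessel_weight DIM('a) \<alpha> s = (if s > 0 then s powr e * exp (- s / (4 * pi)) / D else 0)"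
        by (simp only: bessel_weight_def D_def e_def)
      moreover have "s powr e * exp (- s / (4 * pi)) * exp (- (pi * ?r / s)) \<le> s powr e * 1 * exp (- (pi * ?r / s))" if "s > 0"
        using that by (intro mult_right_mono mult_left_mono) auto
      ultimately have "bessel_weight DIM('a) \<alpha> s * gauss s z \<le> 1 / D * (indicator {0<..} s * s powr e * exp (- (pi * ?r / s)))"
        using D by (auto simp: gauss_def intro!: divide_right_mono)
      then show "ennreal (bessel_weight DIM('a) \<alpha> s) * ennreal (gauss s z) \<le> ennreal (1 / D) * ennreal (indicator {0<..} s * s powr e * exp (- (pi * ?r / s)))"
        using D bessel_weight_nonneg[OF \<alpha>(1), of "DIM('a)" s] by (simp add: ennreal_leI flip: ennreal_mult)
    qed
    also have "\<dots> = ennreal (1 / D) * (\<integral>\<^sup>+s. ennreal (indicator {0<..} s * s powr e * exp (- (pi * ?r / s))) \<partial>lborel)"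
      by (simp add: nn_integral_cmult)
    also have "(\<integral>\<^sup>+s. ennreal (indicator {0<..} s * s powr e * exp (- (pi * ?r / s))) \<partial>lborel)
       = ennreal ?r * (\<integral>\<^sup>+t. ennreal (indicator {0<..} (0 + ?r * t) * (0 + ?r * t) powr e * exp (- (pi * ?r / (0 + ?r * t)))) \<partial>lborel)"
      using r by (subst nn_integral_real_affine[where c="?r" and t=0]) auto
    also have "\<dots> = ennreal ?r * (\<integral>\<^sup>+t. ennreal (?r powr e) * ennreal (indicator {0<..} t * t powr e * exp (- (pi / t))) \<partial>lborel)"
      using r z by (intro arg_cong2[where f="(*)"] refl nn_integral_cong)
        (auto simp: indicator_def powr_mult zero_less_mult_iff simp flip: ennreal_mult)
    also have "\<dots> = ennreal ?r * (ennreal (?r powr e) * A)"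
      by (simp add: nn_integral_cmult A_def)
    also have "A = ennreal (enn2real A)" using A by simp
    also have "ennreal (1 / D) * (ennreal ?r * (ennreal (?r powr e) * ennreal (enn2real A)))
        = ennreal (enn2real A / D * (?r * ?r powr e))"
      using D r by (simp add: mult_ac flip: ennreal_mult)
    also have "?r * ?r powr e = norm z powr (\<alpha> - DIM('a))"
    proof -
      have "?r = norm z powr 2" using z by simp
      then have "?r * ?r powr e = norm z powr (2 + 2 * e)"
        by (simp only: powr_powr powr_add)
      moreover have "2 + 2 * e = \<alpha> - DIM('a)" by (simp add: e_def field_simps)
      ultimately show ?thesis by simp
    qed
    finally show ?thesis .
  qed
  then show thesis using that[of "enn2real A / D"] D by simp
qed

section \<open>Positivity of the quadratic form\<close>

text \<open>Writing the larger number as the smaller one plus \<open>d\<close> replaces the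
  expansion of a square of a difference and covers infinite values.\<close>

lemma two_mult_le_squares:
  fixes a b :: ennreal
  shows "a * b + a * b \<le> a * a + b * b"
proof -
  have *: "a * b + a * b \<le> a * a + b * b" if "a \<le> b" for a b :: ennreal
  proof -
    obtain d where d: "b = a + d" using \<open>a \<le> b\<close> unfolding le_iff_add by blast
    have "a * b + a * b = (a * a + a * d) + (a * a + a * d)"
      unfolding d by (simp only: distrib_left)
    also have "\<dots> \<le> (a * a + a * d) + (a * a + a * d) + d * d"
      by (rule add_increasing2) auto
    also have "\<dots> = a * a + b * b" unfolding d by (simp only: distrib_left distrib_right ac_simps)
    finally show ?thesis .
  qed
  show ?thesis
  proof (cases "a \<le> b")
    case False
    then have "b * a + b * a \<le> b * b + a * a" by (intro *) simp
    then show ?thesis by (simp only: mult.commute[of b a] add.commute[of "b * b"])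
  qed (rule *)
qed

text \<open>The parallelogram law about the midpoint of \<open>x\<close> and \<open>y\<close> splits
  the exponent into a part depending on \<open>x - y\<close> and a Gaussian in
  \<open>z\<close>.\<close>

lemma gauss_semigroup:
  fixes x y :: "'a::euclidean_space"
  assumes s: "s > 0"
  shows "(\<integral>\<^sup>+z. ennreal (gauss (s / 2) (x - z)) * ennreal (gauss (s / 2) (y - z)) \<partial>lborel)
     = ennreal ((s / 4) powr (DIM('a) / 2)) * ennreal (gauss s (x - y))"
proof -
  have eq: "gauss (s / 2) (x - z) * gauss (s / 2) (y - z) = gauss s (x - y) * gauss (s / 4) (z - (1/2) *\<^sub>R (x + y))" for z
  proof -
    have "(norm (x - z))\<^sup>2 + (norm (y - z))\<^sup>2 = 2 * (norm (z - (1/2) *\<^sub>R (x + y)))\<^sup>2 + (norm (x - y))\<^sup>2 / 2"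
      by (simp add: power2_norm_eq_inner inner_diff inner_add algebra_simps inner_commute) (simp add: field_simps)
    then have "2 * pi / s * ((norm (x - z))\<^sup>2 + (norm (y - z))\<^sup>2)
      = 2 * pi / s * (2 * (norm (z - (1/2) *\<^sub>R (x + y)))\<^sup>2 + (norm (x - y))\<^sup>2 / 2)" by simp
    then have "pi * (norm (x - z))\<^sup>2 / (s / 2) + pi * (norm (y - z))\<^sup>2 / (s / 2)
      = pi * (norm (x - y))\<^sup>2 / s + pi * (norm (z - (1/2) *\<^sub>R (x + y)))\<^sup>2 / (s / 4)"
      by (simp only: ring_distribs) (simp add: mult_ac)
    then show ?thesis unfolding gauss_def mult_exp_exp by (simp del: times_divide_eq_right)
  qed
  have "(\<integral>\<^sup>+z. ennreal (gauss (s / 2) (x - z)) * ennreal (gauss (s / 2) (y - z)) \<partial>lborel)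
     = (\<integral>\<^sup>+z. ennreal (gauss s (x - y)) * ennreal (gauss (s / 4) (z - (1/2) *\<^sub>R (x + y))) \<partial>lborel)"
    by (simp add: eq flip: ennreal_mult)
  also have "\<dots> = ennreal (gauss s (x - y)) * ennreal ((s / 4) powr (DIM('a) / 2))"
    using s by (simp add: nn_integral_cmult nn_integral_gauss nn_integral_lborel_shift[where F="\<lambda>z. ennreal (gauss (s / 4) z)"])
  finally show ?thesis by (simp add: mult.commute)
qed

text \<open>A Gaussian is a multiple of the convolution of a narrower Gaussian with itself, so the
  form is an \<open>L^2\<close> pairing of the smoothed functions.\<close>

lemma bform_gauss:
  fixes f h :: "'a::euclidean_space \<Rightarrow> ennreal"
  assumes [measurable]: "f \<in> borel_measurable borel" "h \<in> borel_measurable borel" and s: "s > 0"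
  shows "ennreal ((s / 4) powr (DIM('a) / 2)) * bform (\<lambda>z. ennreal (gauss s z)) f h
     = (\<integral>\<^sup>+z. (\<integral>\<^sup>+x. f x * gauss (s / 2) (x - z) \<partial>lborel) * (\<integral>\<^sup>+x. h x * gauss (s / 2) (x - z) \<partial>lborel) \<partial>lborel)"
proof -
  let ?c = "ennreal ((s / 4) powr (DIM('a) / 2))"
  let ?g = "\<lambda>z::'a. ennreal (gauss (s / 2) z)"
  have "?c * bform (\<lambda>z. ennreal (gauss s z)) f h = (\<integral>\<^sup>+x. \<integral>\<^sup>+y. ?c * (f x * gauss s (x - y) * h y) \<partial>lborel \<partial>lborel)"
    by (simp add: bform_def nn_integral_cmult)
  also have "\<dots> = (\<integral>\<^sup>+x. \<integral>\<^sup>+y. \<integral>\<^sup>+z. f x * ?g (x - z) * (h y * ?g (y - z)) \<partial>lborel \<partial>lborel \<partial>lborel)"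
  proof (intro nn_integral_cong)
    fix x y
    have "?c * (f x * gauss s (x - y) * h y) = f x * h y * (?c * gauss s (x - y))" by (simp add: mult_ac)
    also have "\<dots> = (\<integral>\<^sup>+z. f x * h y * (?g (x - z) * ?g (y - z)) \<partial>lborel)"
      by (simp add: nn_integral_cmult gauss_semigroup[OF s])
    finally show "?c * (f x * gauss s (x - y) * h y) = (\<integral>\<^sup>+z. f x * ?g (x - z) * (h y * ?g (y - z)) \<partial>lborel)"
      by (simp add: mult_ac)
  qed
  also have "\<dots> = (\<integral>\<^sup>+x. \<integral>\<^sup>+z. \<integral>\<^sup>+y. f x * ?g (x - z) * (h y * ?g (y - z)) \<partial>lborel \<partial>lborel \<partial>lborel)"
    by (intro nn_integral_cong lborel_pair.Fubini') simp
  also have "\<dots> = (\<integral>\<^sup>+z. \<integral>\<^sup>+x. \<integral>\<^sup>+y. f x * ?g (x - z) * (h y * ?g (y - z)) \<partial>lborel \<partial>lborel \<partial>lborel)"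
    by (intro lborel_pair.Fubini') simp
  also have "\<dots> = (\<integral>\<^sup>+z. (\<integral>\<^sup>+x. f x * ?g (x - z) \<partial>lborel) * (\<integral>\<^sup>+x. h x * ?g (x - z) \<partial>lborel) \<partial>lborel)"
    by (intro nn_integral_cong) (simp add: nn_integral_cmult nn_integral_multc)
  finally show ?thesis .
qed

text \<open>Positive semidefiniteness stated without \<open>f - h\<close>. It is the pointwise bound
  \<open>2 F H \<le> F^2 + H^2\<close> for the smoothed functions, integrated.\<close>

lemma bform_gauss_le:
  fixes f h :: "'a::euclidean_space \<Rightarrow> ennreal"
  assumes [measurable]: "f \<in> borel_measurable borel" "h \<in> borel_measurable borel" and s: "s > 0"
  shows "bform (\<lambda>z. ennreal (gauss s z)) f h + bform (\<lambda>z. ennreal (gauss s z)) f h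
     \<le> bform (\<lambda>z. ennreal (gauss s z)) f f + bform (\<lambda>z. ennreal (gauss s z)) h h"
proof -
  let ?c = "ennreal ((s / 4) powr (DIM('a) / 2))"
  let ?B = "bform (\<lambda>z::'a. ennreal (gauss s z))"
  let ?F = "\<lambda>z. \<integral>\<^sup>+x. f x * gauss (s / 2) (x - z) \<partial>lborel"
  let ?H = "\<lambda>z. \<integral>\<^sup>+x. h x * gauss (s / 2) (x - z) \<partial>lborel"
  have "?c * (?B f h + ?B f h) = (\<integral>\<^sup>+z. ?F z * ?H z + ?F z * ?H z \<partial>lborel)"
    by (simp add: distrib_left bform_gauss[OF _ _ s] nn_integral_add)
  also have "\<dots> \<le> (\<integral>\<^sup>+z. ?F z * ?F z + ?H z * ?H z \<partial>lborel)"
    by (intro nn_integral_mono two_mult_le_squares)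
  also have "\<dots> = ?c * (?B f f + ?B h h)"
    by (simp add: distrib_left bform_gauss[OF _ _ s] nn_integral_add)
  finally have le: "?c * (?B f h + ?B f h) \<le> ?c * (?B f f + ?B h h)" .
  have "ennreal (inverse ((s / 4) powr (DIM('a) / 2))) * ?c = 1" using s by (simp flip: ennreal_mult)
  with mult_left_mono[OF le, of "ennreal (inverse ((s / 4) powr (DIM('a) / 2)))"] show ?thesis by (simp add: mult.assoc[symmetric])
qed

lemma bform_bessel_kernel:
  fixes f h :: "'a::euclidean_space \<Rightarrow> ennreal"
  assumes [measurable]: "f \<in> borel_measurable borel" "h \<in> borel_measurable borel"
  shows "bform (bessel_kernel \<alpha>) f h = (\<integral>\<^sup>+s. ennreal (bessel_weight DIM('a) \<alpha> s) * bform (\<lambda>z. ennreal (gauss s z)) f h \<partial>lborel)"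
proof -
  let ?w = "\<lambda>s. ennreal (bessel_weight DIM('a) \<alpha> s)"
  have "bform (bessel_kernel \<alpha>) f h = (\<integral>\<^sup>+x. \<integral>\<^sup>+y. \<integral>\<^sup>+s. ?w s * (f x * gauss s (x - y) * h y) \<partial>lborel \<partial>lborel \<partial>lborel)"
    unfolding bform_def bessel_kernel_def
    by (intro nn_integral_cong)
       (simp add: nn_integral_cmult[symmetric] nn_integral_multc[symmetric] mult_ac)
  also have "\<dots> = (\<integral>\<^sup>+x. \<integral>\<^sup>+s. \<integral>\<^sup>+y. ?w s * (f x * gauss s (x - y) * h y) \<partial>lborel \<partial>lborel \<partial>lborel)"
    by (intro nn_integral_cong lborel_pair.Fubini') simp
  also have "\<dots> = (\<integral>\<^sup>+s. \<integral>\<^sup>+x. \<integral>\<^sup>+y. ?w s * (f x * gauss s (x - y) * h y) \<partial>lborel \<partial>lborel \<partial>lborel)"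
    by (intro lborel_pair.Fubini') simp
  also have "\<dots> = (\<integral>\<^sup>+s. ?w s * bform (\<lambda>z. ennreal (gauss s z)) f h \<partial>lborel)"
    by (simp add: bform_def nn_integral_cmult)
  finally show ?thesis .
qed

lemma measurable_bform_gauss [measurable]:
  fixes f h :: "'a::euclidean_space \<Rightarrow> ennreal"
  assumes [measurable]: "f \<in> borel_measurable borel" "h \<in> borel_measurable borel"
  shows "(\<lambda>s. bform (\<lambda>z. ennreal (gauss s z)) f h) \<in> borel_measurable borel"
  unfolding bform_def by measurable

lemma bform_bessel_kernel_le:
  fixes f h :: "'a::euclidean_space \<Rightarrow> ennreal"
  assumes [measurable]: "f \<in> borel_measurable borel" "h \<in> borel_measurable borel"
  shows "bform (bessel_kernel \<alpha>) f h + bform (bessel_kernel \<alpha>) f h \<le> bform (bessel_kernel \<alpha>) f f + bform (bessel_kernel \<alpha>) h h"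
proof -
  let ?w = "\<lambda>s. ennreal (bessel_weight DIM('a) \<alpha> s)"
  let ?B = "\<lambda>s. bform (\<lambda>z::'a. ennreal (gauss s z))"
  have "bform (bessel_kernel \<alpha>) f h + bform (bessel_kernel \<alpha>) f h = (\<integral>\<^sup>+s. ?w s * (?B s f h + ?B s f h) \<partial>lborel)"
    by (simp add: bform_bessel_kernel distrib_left nn_integral_add)
  also have "\<dots> \<le> (\<integral>\<^sup>+s. ?w s * (?B s f f + ?B s h h) \<partial>lborel)"
  proof (rule nn_integral_mono)
    fix s
    show "?w s * (?B s f h + ?B s f h) \<le> ?w s * (?B s f f + ?B s h h)"
      by (cases "s > 0") (auto intro!: mult_left_mono bform_gauss_le simp: bessel_weight_0)
  qed
  also have "\<dots> = bform (bessel_kernel \<alpha>) f f + bform (bessel_kernel \<alpha>) h h"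
    by (simp add: bform_bessel_kernel distrib_left nn_integral_add)
  finally show ?thesis .
qed

section \<open>Riesz potentials and quadratic forms\<close>

text \<open>For \<open>s\<close> between \<open>|z|^2\<close> and \<open>2 |z|^2\<close> the
  Gaussian is at least \<open>exp (- pi)\<close>, and this interval has length \<open>|z|^2\<close>.
  A power of the norm is thus dominated by a mixture of Gaussians, whose integrals over space are
  explicit.\<close>

lemma norm_powr_le_gauss_integral:
  fixes z :: "'a::euclidean_space"
  assumes "z \<noteq> 0" "\<gamma> \<ge> 0" and S: "{(norm z)\<^sup>2..2 * (norm z)\<^sup>2} \<subseteq> S" and [measurable]: "S \<in> sets borel"
  shows "ennreal (norm z powr (- \<gamma>)) \<le> ennreal (exp pi * 2 powr (\<gamma> / 2 + 1)) *
     (\<integral>\<^sup>+s. ennreal (indicator S s * s powr (- \<gamma> / 2 - 1)) * ennreal (gauss s z) \<partial>lborel)"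
proof -
  let ?r = "(norm z)\<^sup>2"
  have r: "?r > 0" using assms by simp
  define c where "c = (2 * ?r) powr (- \<gamma> / 2 - 1) * exp (- pi)"
  have "ennreal (c * ?r) = (\<integral>\<^sup>+s. ennreal c * indicator {?r..2 * ?r} s \<partial>lborel)"
    using r by (simp add: nn_integral_cmult_indicator c_def ennreal_mult')
  also have "\<dots> \<le> (\<integral>\<^sup>+s. ennreal (indicator S s * s powr (- \<gamma> / 2 - 1)) * ennreal (gauss s z) \<partial>lborel)"
  proof (rule nn_integral_mono)
    fix s
    show "ennreal c * indicator {?r..2 * ?r} s \<le> ennreal (indicator S s * s powr (- \<gamma> / 2 - 1)) * ennreal (gauss s z)"
    proof (cases "s \<in> {?r..2 * ?r}")
      case True
      then have s: "s > 0" "?r \<le> s" "s \<le> 2 * ?r" "s \<in> S" using r S less_le_trans[OF r, of s] by auto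
      have "(2 * ?r) powr (- \<gamma> / 2 - 1) \<le> s powr (- \<gamma> / 2 - 1)"
        using s assms by (intro powr_mono2') auto
      moreover have "exp (- pi) \<le> gauss s z"
        using s by (simp add: gauss_def divide_simps)
      ultimately have "c \<le> s powr (- \<gamma> / 2 - 1) * gauss s z"
        unfolding c_def by (intro mult_mono) auto
      then show ?thesis using True s by (simp add: ennreal_leI flip: ennreal_mult)
    qed simp
  qed
  finally have le: "ennreal (c * ?r) \<le> (\<integral>\<^sup>+s. ennreal (indicator S s * s powr (- \<gamma> / 2 - 1)) * ennreal (gauss s z) \<partial>lborel)" .
  have "norm z powr (- \<gamma>) = ?r powr (- \<gamma> / 2)"
  proof -
    have "?r = norm z powr 2" using assms by simp
    then show ?thesis by (simp only: powr_powr) simp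
  qed
  also have "\<dots> = exp pi * 2 powr (\<gamma> / 2 + 1) * (c * ?r)"
  proof -
    have "?r powr (- \<gamma> / 2 - 1) * ?r = ?r powr (- \<gamma> / 2)"
      using r powr_add[of ?r "- \<gamma> / 2 - 1" 1] by simp
    moreover have "(2::real) powr (\<gamma> / 2 + 1) * 2 powr (- \<gamma> / 2 - 1) = 1"
      by (simp flip: powr_add)
    moreover have "exp pi * exp (- pi) = (1::real)" by (simp flip: exp_add)
    moreover have "exp pi * 2 powr (\<gamma> / 2 + 1) * (c * ?r) = (2 powr (\<gamma> / 2 + 1) * 2 powr (- \<gamma> / 2 - 1)) * (exp pi * exp (- pi)) * (?r powr (- \<gamma> / 2 - 1) * ?r)"
      using r by (simp add: c_def powr_mult)
    ultimately show ?thesis by simp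
  qed
  finally have "ennreal (norm z powr (- \<gamma>)) = ennreal (exp pi * 2 powr (\<gamma> / 2 + 1)) * ennreal (c * ?r)"
    using r by (simp add: ennreal_mult' c_def)
  then show ?thesis using mult_left_mono[OF le] by simp
qed

text \<open>This takes the place of polar coordinates: integrating the mixture over \<open>z\<close>
  first leaves a one-dimensional integral over \<open>S\<close>, which contains all parameters that
  points of \<open>A\<close> use.\<close>

lemma nn_integral_norm_powr_le:
  fixes \<gamma> :: real and A :: "'a::euclidean_space set"
  assumes "\<gamma> \<ge> 0" and A: "\<And>z. z \<in> A \<Longrightarrow> z \<noteq> 0 \<Longrightarrow> {(norm z)\<^sup>2..2 * (norm z)\<^sup>2} \<subseteq> S"
    and [measurable]: "S \<in> sets borel" "A \<in> sets borel"
  shows "(\<integral>\<^sup>+z. ennreal (indicator A z * norm z powr (- \<gamma>)) \<partial>lborel)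
    \<le> ennreal (exp pi * 2 powr (\<gamma> / 2 + 1)) * (\<integral>\<^sup>+s. ennreal (indicator (S \<inter> {0<..}) s * s powr ((DIM('a) - \<gamma>) / 2 - 1)) \<partial>lborel)"
proof -
  let ?C = "ennreal (exp pi * 2 powr (\<gamma> / 2 + 1))"
  let ?S = "S \<inter> {0<..}"
  have "(\<integral>\<^sup>+z. ennreal (indicator A z * norm z powr (- \<gamma>)) \<partial>lborel)
    \<le> (\<integral>\<^sup>+z. ?C * (\<integral>\<^sup>+s. ennreal (indicator ?S s * s powr (- \<gamma> / 2 - 1)) * ennreal (gauss s (z::'a)) \<partial>lborel) \<partial>lborel)"
  proof (rule nn_integral_mono)
    fix z :: 'a
    show "ennreal (indicator A z * norm z powr (- \<gamma>)) \<le> ?C * (\<integral>\<^sup>+s. ennreal (indicator ?S s * s powr (- \<gamma> / 2 - 1)) * ennreal (gauss s z) \<partial>lborel)"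
    proof (cases "z \<in> A \<and> z \<noteq> 0")
      case True
      have "0 < (norm z)\<^sup>2" using True by simp
      then have "{(norm z)\<^sup>2..2 * (norm z)\<^sup>2} \<subseteq> ?S" using A[of z] True less_le_trans[OF \<open>0 < (norm z)\<^sup>2\<close>] by auto
      then show ?thesis
        using norm_powr_le_gauss_integral[of z \<gamma> ?S] True assms by simp
    qed auto
  qed
  also have "\<dots> = ?C * (\<integral>\<^sup>+z. \<integral>\<^sup>+s. ennreal (indicator ?S s * s powr (- \<gamma> / 2 - 1)) * ennreal (gauss s (z::'a)) \<partial>lborel \<partial>lborel)"
    by (simp add: nn_integral_cmult)
  also have "(\<integral>\<^sup>+z. \<integral>\<^sup>+s. ennreal (indicator ?S s * s powr (- \<gamma> / 2 - 1)) * ennreal (gauss s (z::'a)) \<partial>lborel \<partial>lborel)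
     = (\<integral>\<^sup>+s. \<integral>\<^sup>+z. ennreal (indicator ?S s * s powr (- \<gamma> / 2 - 1)) * ennreal (gauss s (z::'a)) \<partial>lborel \<partial>lborel)"
    by (rule lborel_pair.Fubini') simp
  also have "\<dots> = (\<integral>\<^sup>+s. ennreal (indicator ?S s * s powr ((DIM('a) - \<gamma>) / 2 - 1)) \<partial>lborel)"
  proof (rule nn_integral_cong)
    fix s :: real
    show "(\<integral>\<^sup>+z. ennreal (indicator ?S s * s powr (- \<gamma> / 2 - 1)) * ennreal (gauss s (z::'a)) \<partial>lborel) = ennreal (indicator ?S s * s powr ((DIM('a) - \<gamma>) / 2 - 1))"
    proof (cases "s \<in> ?S")
      case True
      have "s powr (- \<gamma> / 2 - 1) * s powr (DIM('a) / 2) = s powr ((DIM('a) - \<gamma>) / 2 - 1)"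
        by (simp only: powr_add[symmetric], rule arg_cong[where f="(powr) s"]) (simp add: field_simps)
      then show ?thesis using True by (simp add: nn_integral_cmult nn_integral_gauss) (simp flip: ennreal_mult)
    qed auto
  qed
  finally show ?thesis .
qed

lemma nn_integral_norm_powr_inside:
  assumes "\<gamma> \<ge> 0" "\<gamma> < real DIM('a)"
  shows "(\<integral>\<^sup>+z. ennreal (indicator (cball 0 1) z * norm z powr (- \<gamma>)) \<partial>(lborel :: 'a::euclidean_space measure)) < \<infinity>"
proof -
  have "((\<lambda>s. s powr ((DIM('a) - \<gamma>) / 2 - 1)) has_integral (2 powr ((DIM('a) - \<gamma>) / 2 - 1 + 1) / ((DIM('a) - \<gamma>) / 2 - 1 + 1))) {0..2}"
    using assms by (intro has_integral_powr_from_0) auto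
  from nn_integral_has_integral_lebesgue[OF _ this]
  have fin: "(\<integral>\<^sup>+s. ennreal (indicator {0..2} s * s powr ((DIM('a) - \<gamma>) / 2 - 1)) \<partial>lborel) < \<infinity>" by simp
  have "(\<integral>\<^sup>+z. ennreal (indicator (cball 0 1) z * norm z powr (- \<gamma>)) \<partial>(lborel :: 'a measure))
    \<le> ennreal (exp pi * 2 powr (\<gamma> / 2 + 1)) * (\<integral>\<^sup>+s. ennreal (indicator ({0..2} \<inter> {0<..}) s * s powr ((DIM('a) - \<gamma>) / 2 - 1)) \<partial>lborel)"
    by (rule nn_integral_norm_powr_le) (use assms in \<open>auto simp: power_le_one intro: order_trans zero_le_power2\<close>)
  also have "\<dots> \<le> ennreal (exp pi * 2 powr (\<gamma> / 2 + 1)) * (\<integral>\<^sup>+s. ennreal (indicator {0..2} s * s powr ((DIM('a) - \<gamma>) / 2 - 1)) \<partial>lborel)"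
    by (intro mult_left_mono nn_integral_mono) (auto simp: indicator_def)
  also have "\<dots> < \<infinity>" using fin by (simp add: ennreal_mult_less_top)
  finally show ?thesis .
qed

lemma nn_integral_norm_powr_outside:
  assumes "\<gamma> > real DIM('a)"
  shows "(\<integral>\<^sup>+z. ennreal (indicator (- ball 0 1) z * norm z powr (- \<gamma>)) \<partial>(lborel :: 'a::euclidean_space measure)) < \<infinity>"
proof -
  have "((\<lambda>s. s powr ((DIM('a) - \<gamma>) / 2 - 1)) has_integral - (1 powr ((DIM('a) - \<gamma>) / 2 - 1 + 1)) / ((DIM('a) - \<gamma>) / 2 - 1 + 1)) {1..}"
    using assms by (intro has_integral_powr_to_inf) auto
  from nn_integral_has_integral_lebesgue[OF _ this]
  have fin: "(\<integral>\<^sup>+s. ennreal (indicator {1..} s * s powr ((DIM('a) - \<gamma>) / 2 - 1)) \<partial>lborel) < \<infinity>" by simp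
  have "(\<integral>\<^sup>+z. ennreal (indicator (- ball 0 1) z * norm z powr (- \<gamma>)) \<partial>(lborel :: 'a measure))
    \<le> ennreal (exp pi * 2 powr (\<gamma> / 2 + 1)) * (\<integral>\<^sup>+s. ennreal (indicator ({1..} \<inter> {0<..}) s * s powr ((DIM('a) - \<gamma>) / 2 - 1)) \<partial>lborel)"
  proof (rule nn_integral_norm_powr_le)
    fix z :: 'a assume "z \<in> - ball 0 1"
    then have "1\<^sup>2 \<le> (norm z)\<^sup>2" by (intro power_mono) auto
    then show "{(norm z)\<^sup>2..2 * (norm z)\<^sup>2} \<subseteq> {1..}" by auto
  qed (use assms in auto)
  also have "{1..} \<inter> {0<..} = {1::real..}" by auto
  also have "ennreal (exp pi * 2 powr (\<gamma> / 2 + 1)) * (\<integral>\<^sup>+s. ennreal (indicator {1..} s * s powr ((DIM('a) - \<gamma>) / 2 - 1)) \<partial>lborel) < \<infinity>" using fin by (simp add: ennreal_mult_less_top)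
  finally show ?thesis .
qed

text \<open>One distributes the exponents so that the smaller of \<open>norm (x - y)\<close> and \<open>norm y\<close> carries the
  whole singularity, while the larger one, which is at least \<open>norm x / 2\<close>, carries the power \<open>b'\<close>.\<close>

lemma riesz_potential_le:
  fixes k :: "'a::euclidean_space \<Rightarrow> ennreal" and \<alpha> b b' C :: real
  assumes [measurable]: "k \<in> borel_measurable borel"
    and k: "\<And>z. z \<noteq> 0 \<Longrightarrow> k z \<le> ennreal (C * norm z powr (\<alpha> - DIM('a)))" and "C \<ge> 0"
    and "0 \<le> b'" "b' \<le> b" "b - \<alpha> < b'" "b' \<le> DIM('a) - \<alpha>"
  obtains C' where "C' \<ge> 0" "\<And>x. x \<noteq> 0 \<Longrightarrow>
    (\<integral>\<^sup>+y. k (x - y) * ennreal (indicator (cball 0 1) y * norm y powr (- b)) \<partial>lborel) \<le> ennreal (C' * norm x powr (- b'))"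
proof -
  have [measurable]: "cball (0::'a) 1 \<in> sets borel" by simp
  \<comment> \<open>\<open>\<gamma>\<close> is the total singularity left once the power
    \<open>b'\<close> has been taken out; \<open>b - \<alpha> < b'\<close> says that
    \<open>\<gamma> < n\<close>, which is local integrability.\<close>
  define \<gamma> where "\<gamma> = DIM('a) - \<alpha> + b - b'"
  let ?N = "\<lambda>z::'a. ennreal (indicator (cball 0 1) z * norm z powr (- \<gamma>))"
  define M where "M = (\<integral>\<^sup>+z. ?N z \<partial>lborel)"
  have M: "M < \<infinity>" unfolding M_def by (rule nn_integral_norm_powr_inside) (use assms in \<open>auto simp: \<gamma>_def\<close>)
  have "(\<integral>\<^sup>+y. k (x - y) * ennreal (indicator (cball 0 1) y * norm y powr (- b)) \<partial>lborel)
     \<le> ennreal ((C * 2 powr b' * 2 * enn2real M) * norm x powr (- b'))" if x: "x \<noteq> 0" for x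
  proof -
    let ?c = "C * (norm x / 2) powr (- b')"
    have pt: "k (x - y) * ennreal (indicator (cball 0 1) y * norm y powr (- b)) \<le> ennreal ?c * (?N (x - y) + ?N y)"
      if y: "y \<noteq> 0" "y \<noteq> x" for y
    proof (cases "norm y \<le> 1")
      case True
      let ?d = "norm (x - y)" and ?e = "norm y"
      have pos: "?d > 0" "?e > 0" "norm x > 0" using x y by auto
      have tri: "norm x \<le> ?d + ?e" using norm_triangle_ineq[of "x - y" y] by simp
      have "C * (?d powr (\<alpha> - DIM('a)) * ?e powr (- b)) \<le> ?c * (indicator (cball 0 1) (x - y) * ?d powr (- \<gamma>) + ?e powr (- \<gamma>))"
      proof (cases "?d \<le> ?e")
        case le: True
        have "?e powr (- b) = ?e powr (- b') * ?e powr (- (b - b'))" by (simp flip: powr_add)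
        also have "\<dots> \<le> (norm x / 2) powr (- b') * ?d powr (- (b - b'))"
          using assms pos le tri by (intro mult_mono powr_mono2') auto
        finally have "?d powr (\<alpha> - DIM('a)) * ?e powr (- b) \<le> (norm x / 2) powr (- b') * (?d powr (\<alpha> - DIM('a)) * ?d powr (- (b - b')))"
          by (simp only: mult_ac) (drule mult_left_mono[where c="?d powr (\<alpha> - DIM('a))"], simp, simp only: mult_ac)
        also have "?d powr (\<alpha> - DIM('a)) * ?d powr (- (b - b')) = ?d powr (- \<gamma>)"
          by (simp add: \<gamma>_def algebra_simps flip: powr_add)
        finally have *: "?d powr (\<alpha> - DIM('a)) * ?e powr (- b) \<le> (norm x / 2) powr (- b') * ?d powr (- \<gamma>)" .
        also have "\<dots> \<le> (norm x / 2) powr (- b') * (indicator (cball 0 1) (x - y) * ?d powr (- \<gamma>) + ?e powr (- \<gamma>))"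
          using le True by (intro mult_left_mono) (auto simp: indicator_def norm_minus_commute)
        finally show ?thesis
          using mult_left_mono[OF _ \<open>C \<ge> 0\<close>] by (simp add: mult.assoc)
      next
        case gt: False
        have "?d powr (\<alpha> - DIM('a)) = ?d powr (- b') * ?d powr (- (DIM('a) - \<alpha> - b'))" by (simp flip: powr_add)
        also have "\<dots> \<le> (norm x / 2) powr (- b') * ?e powr (- (DIM('a) - \<alpha> - b'))"
          using assms pos gt tri by (intro mult_mono powr_mono2') auto
        finally have "?d powr (\<alpha> - DIM('a)) * ?e powr (- b) \<le> (norm x / 2) powr (- b') * (?e powr (- (DIM('a) - \<alpha> - b')) * ?e powr (- b))"
          by (simp only: mult_ac) (drule mult_left_mono[where c="?e powr (- b)"], simp, simp only: mult_ac)
        also have "?e powr (- (DIM('a) - \<alpha> - b')) * ?e powr (- b) = ?e powr (- \<gamma>)"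
          by (simp add: \<gamma>_def algebra_simps flip: powr_add)
        finally have *: "?d powr (\<alpha> - DIM('a)) * ?e powr (- b) \<le> (norm x / 2) powr (- b') * ?e powr (- \<gamma>)" .
        also have "\<dots> \<le> (norm x / 2) powr (- b') * (indicator (cball 0 1) (x - y) * ?d powr (- \<gamma>) + ?e powr (- \<gamma>))"
          by (intro mult_left_mono) (auto simp: indicator_def)
        finally show ?thesis
          using mult_left_mono[OF _ \<open>C \<ge> 0\<close>] by (simp add: mult.assoc)
      qed
      then have "ennreal (C * ?d powr (\<alpha> - DIM('a))) * ennreal (?e powr (- b)) \<le> ennreal (?c * (indicator (cball 0 1) (x - y) * ?d powr (- \<gamma>) + ?e powr (- \<gamma>)))"
        using \<open>C \<ge> 0\<close> by (simp add: ennreal_leI mult.assoc flip: ennreal_mult)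
      also have "ennreal (?c * (indicator (cball 0 1) (x - y) * ?d powr (- \<gamma>) + ?e powr (- \<gamma>))) = ennreal ?c * (?N (x - y) + ?N y)"
        using True \<open>C \<ge> 0\<close> by (subst ennreal_mult) (auto simp: ennreal_plus)
      finally have *: "ennreal (C * ?d powr (\<alpha> - DIM('a))) * ennreal (?e powr (- b)) \<le> ennreal ?c * (?N (x - y) + ?N y)" .
      have "k (x - y) * ennreal (?e powr (- b)) \<le> ennreal (C * ?d powr (\<alpha> - DIM('a))) * ennreal (?e powr (- b))"
        using y by (intro mult_right_mono k) auto
      also note *
      finally show ?thesis using True by simp
    qed auto
    have "(\<integral>\<^sup>+y. k (x - y) * ennreal (indicator (cball 0 1) y * norm y powr (- b)) \<partial>lborel)
       \<le> (\<integral>\<^sup>+y. ennreal ?c * (?N (x - y) + ?N y) \<partial>lborel)"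
      using AE_lborel_singleton[of 0] AE_lborel_singleton[of x]
      by (intro nn_integral_mono_AE, eventually_elim) (rule pt)
    also have "\<dots> = ennreal ?c * (\<integral>\<^sup>+y. ?N (x - y) + ?N y \<partial>lborel)"
      by (rule nn_integral_cmult) measurable
    also have "(\<integral>\<^sup>+y. ?N (x - y) + ?N y \<partial>lborel) = (\<integral>\<^sup>+y. ?N (x - y) \<partial>lborel) + (\<integral>\<^sup>+y. ?N y \<partial>lborel)"
      by (rule nn_integral_add) measurable
    also have "(\<integral>\<^sup>+y. ?N (x - y) \<partial>lborel) = (\<integral>\<^sup>+y. ?N y \<partial>lborel)"
      by (rule nn_integral_lborel_reflect) measurable
    also have "(\<integral>\<^sup>+y. ?N y \<partial>lborel) = M" by (simp only: M_def)
    also have "M = ennreal (enn2real M)" using M by simp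
    also have "ennreal ?c * (ennreal (enn2real M) + ennreal (enn2real M)) = ennreal ((C * 2 powr b' * 2 * enn2real M) * norm x powr (- b'))"
      using \<open>C \<ge> 0\<close> x by (simp add: powr_divide powr_minus field_simps flip: ennreal_plus ennreal_mult)
    finally show ?thesis .
  qed
  then show thesis using that[of "C * 2 powr b' * 2 * enn2real M"] \<open>C \<ge> 0\<close> by simp
qed

section \<open>Criteria for a finite quadratic form\<close>

text \<open>The mixed terms use \<open>F2 \<le> 1\<close> and the last one
  \<open>F2 x * F2 y \<le> (F2 x)^2 + (F2 y)^2\<close>. After that each term depends on one of the
  two points only through the kernel, which can be integrated out.\<close>

lemma bform_add_le:
  fixes K F1 F2 :: "'a::euclidean_space \<Rightarrow> ennreal"
  assumes [measurable]: "K \<in> borel_measurable borel" "F1 \<in> borel_measurable borel" "F2 \<in> borel_measurable borel"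
    and F2: "\<And>x. F2 x \<le> 1"
  shows "bform K (\<lambda>x. F1 x + F2 x) (\<lambda>x. F1 x + F2 x) \<le> bform K F1 F1
     + (2 * (\<integral>\<^sup>+x. F1 x \<partial>lborel) + 2 * (\<integral>\<^sup>+x. F2 x * F2 x \<partial>lborel)) * (\<integral>\<^sup>+x. K x \<partial>lborel)"
proof -
  let ?K = "\<integral>\<^sup>+x. K x \<partial>lborel"
  have L: "(\<integral>\<^sup>+x. \<integral>\<^sup>+y. F x * K (x - y) \<partial>lborel \<partial>lborel) = (\<integral>\<^sup>+x. F x \<partial>lborel) * ?K"
    if [measurable]: "F \<in> borel_measurable borel" for F
    by (simp add: nn_integral_cmult nn_integral_lborel_reflect nn_integral_multc)
  have R: "(\<integral>\<^sup>+x. \<integral>\<^sup>+y. F y * K (x - y) \<partial>lborel \<partial>lborel) = (\<integral>\<^sup>+x. F x \<partial>lborel) * ?K"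
    if [measurable]: "F \<in> borel_measurable borel" for F
  proof -
    have "(\<integral>\<^sup>+x. \<integral>\<^sup>+y. F y * K (x - y) \<partial>lborel \<partial>lborel) = (\<integral>\<^sup>+y. \<integral>\<^sup>+x. F y * K (x - y) \<partial>lborel \<partial>lborel)"
      by (rule lborel_pair.Fubini') simp
    then show ?thesis by (simp add: nn_integral_cmult nn_integral_lborel_shift nn_integral_multc)
  qed
  have "(F1 x + F2 x) * k * (F1 y + F2 y) \<le> F1 x * k * F1 y + (F1 x * k + F1 y * k + (F2 x * F2 x * k + F2 y * F2 y * k))" for x y k
  proof -
    have "F2 x * F2 y \<le> F2 x * F2 y + F2 x * F2 y" by simp
    also have "\<dots> \<le> F2 x * F2 x + F2 y * F2 y" by (rule two_mult_le_squares)
    finally have 1: "F2 x * F2 y * k \<le> (F2 x * F2 x + F2 y * F2 y) * k" by (rule mult_right_mono) simp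
    have 2: "F1 x * F2 y * k \<le> F1 x * 1 * k" "F2 x * F1 y * k \<le> 1 * F1 y * k"
      by (intro mult_right_mono mult_left_mono F2; simp)+
    have "(F1 x + F2 x) * k * (F1 y + F2 y) = F1 x * k * F1 y + (F1 x * F2 y * k + F2 x * F1 y * k + F2 x * F2 y * k)"
      by (simp only: distrib_left distrib_right ac_simps)
    also have "\<dots> \<le> F1 x * k * F1 y + (F1 x * 1 * k + 1 * F1 y * k + (F2 x * F2 x + F2 y * F2 y) * k)"
      by (intro add_mono 1 2 order_refl)
    finally show ?thesis by (simp only: distrib_right mult_1 mult_1_right)
  qed
  then have "bform K (\<lambda>x. F1 x + F2 x) (\<lambda>x. F1 x + F2 x) \<le> (\<integral>\<^sup>+x. \<integral>\<^sup>+y. F1 x * K (x - y) * F1 y + (F1 x * K (x - y) + F1 y * K (x - y) +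
      (F2 x * F2 x * K (x - y) + F2 y * F2 y * K (x - y))) \<partial>lborel \<partial>lborel)"
    unfolding bform_def by (intro nn_integral_mono)
  also have "\<dots> = bform K F1 F1 + ((\<integral>\<^sup>+x. \<integral>\<^sup>+y. F1 x * K (x - y) \<partial>lborel \<partial>lborel) + (\<integral>\<^sup>+x. \<integral>\<^sup>+y. F1 y * K (x - y) \<partial>lborel \<partial>lborel) +
      ((\<integral>\<^sup>+x. \<integral>\<^sup>+y. F2 x * F2 x * K (x - y) \<partial>lborel \<partial>lborel) + (\<integral>\<^sup>+x. \<integral>\<^sup>+y. F2 y * F2 y * K (x - y) \<partial>lborel \<partial>lborel)))"
    unfolding bform_def by (simp add: nn_integral_add)
  also have "\<dots> = bform K F1 F1
     + (2 * (\<integral>\<^sup>+x. F1 x \<partial>lborel) + 2 * (\<integral>\<^sup>+x. F2 x * F2 x \<partial>lborel)) * ?K"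
    by (simp add: L R L[where F="\<lambda>x. F2 x * F2 x"] R[where F="\<lambda>x. F2 x * F2 x"] mult_2 distrib_right)
  finally show ?thesis .
qed

text \<open>Cut \<open>f\<close> at height 1. Above it \<open>f \<le> f^p\<close> since
  \<open>p \<ge> 1\<close>, below it \<open>f^2 \<le> f^p\<close> since \<open>p \<le> 2\<close>,
  which is the integrability that \<open>bform_add_le\<close> asks of the two parts.\<close>

lemma bform_finite_Lp:
  fixes K :: "'a::euclidean_space \<Rightarrow> ennreal" and f :: "'a \<Rightarrow> real"
  assumes [measurable]: "K \<in> borel_measurable borel" "f \<in> borel_measurable borel"
    and f0: "\<And>x. 0 \<le> f x" and p: "1 \<le> p" "p \<le> 2" and fp: "(\<integral>\<^sup>+x. ennreal (f x powr p) \<partial>lborel) < \<infinity>"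
    and K: "\<And>z. K z \<le> ennreal M" "(\<integral>\<^sup>+z. K z \<partial>lborel) < \<infinity>"
  shows "bform K (\<lambda>x. ennreal (f x)) (\<lambda>x. ennreal (f x)) < \<infinity>"
proof -
  define F1 where "F1 x = ennreal (indicator {1<..} (f x) * f x)" for x
  define F2 where "F2 x = ennreal (indicator {..1} (f x) * f x)" for x
  have [measurable]: "F1 \<in> borel_measurable borel" "F2 \<in> borel_measurable borel"
    unfolding F1_def[abs_def] F2_def[abs_def] by measurable
  have eq: "(\<lambda>x. ennreal (f x)) = (\<lambda>x. F1 x + F2 x)"
    by (auto simp: F1_def F2_def fun_eq_iff indicator_def)
  have F2: "F2 x \<le> 1" for x using f0 by (auto simp: F2_def indicator_def)
  have I1: "(\<integral>\<^sup>+x. F1 x \<partial>lborel) < \<infinity>"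
  proof (rule le_less_trans[OF nn_integral_mono fp])
    fix x
    show "F1 x \<le> ennreal (f x powr p)"
      using powr_mono[of 1 p "f x"] p by (auto simp: F1_def indicator_def intro!: ennreal_leI)
  qed
  have I2: "(\<integral>\<^sup>+x. F2 x * F2 x \<partial>lborel) < \<infinity>"
  proof (rule le_less_trans[OF nn_integral_mono fp])
    fix x
    show "F2 x * F2 x \<le> ennreal (f x powr p)"
    proof (cases "f x \<le> 1 \<and> f x \<noteq> 0")
      case True
      then have "f x * f x = f x powr 2" using f0[of x] by (simp add: power2_eq_square)
      also have "\<dots> \<le> f x powr p" using True f0[of x] p by (intro powr_mono') auto
      finally show ?thesis using True f0[of x] by (simp add: F2_def ennreal_leI flip: ennreal_mult)
    qed (use f0[of x] in \<open>auto simp: F2_def\<close>)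
  qed
  have "bform K F1 F1 \<le> (\<integral>\<^sup>+x. \<integral>\<^sup>+y. F1 x * ennreal M * F1 y \<partial>lborel \<partial>lborel)"
    unfolding bform_def by (intro nn_integral_mono mult_right_mono mult_left_mono K) auto
  also have "\<dots> = (\<integral>\<^sup>+x. F1 x \<partial>lborel) * ennreal M * (\<integral>\<^sup>+x. F1 x \<partial>lborel)"
    by (simp add: nn_integral_cmult nn_integral_multc)
  also have "\<dots> < \<infinity>" using I1 by (simp add: ennreal_mult_less_top)
  finally have B: "bform K F1 F1 < \<infinity>" .
  have "bform K (\<lambda>x. ennreal (f x)) (\<lambda>x. ennreal (f x)) \<le> bform K F1 F1
     + (2 * (\<integral>\<^sup>+x. F1 x \<partial>lborel) + 2 * (\<integral>\<^sup>+x. F2 x * F2 x \<partial>lborel)) * (\<integral>\<^sup>+x. K x \<partial>lborel)"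
    unfolding eq by (rule bform_add_le) (use F2 in auto)
  also have "\<dots> < \<infinity>" using B I1 I2 K(2) by (simp add: ennreal_mult_less_top)
  finally show ?thesis .
qed

section \<open>Radially decreasing functions\<close>

text \<open>Invariance is derived from translation invariance, as for Haar measures: the double
  integral of \<open>B (T y) * F (x + T y)\<close> is computed in both orders, where
  \<open>B\<close> is the indicator of the unit ball, of finite positive volume and unchanged by
  \<open>T\<close>.\<close>

lemma nn_integral_linear_involution:
  fixes T :: "'a::euclidean_space \<Rightarrow> 'a" and F :: "'a \<Rightarrow> ennreal"
  assumes T: "linear T" "\<And>z. T (T z) = z" "\<And>z. norm (T z) = norm z"
    and [measurable]: "F \<in> borel_measurable borel"
  shows "(\<integral>\<^sup>+z. F (T z) \<partial>lborel) = (\<integral>\<^sup>+z. F z \<partial>lborel)"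
proof -
  have [measurable]: "T \<in> borel_measurable borel"
    using T(1) by (intro borel_measurable_continuous_onI linear_continuous_on linear_conv_bounded_linear[THEN iffD1])
  define B :: "'a \<Rightarrow> ennreal" where "B = indicator (ball 0 1)"
  have [measurable]: "B \<in> borel_measurable borel" unfolding B_def by (intro borel_measurable_indicator) simp
  define M where "M = (\<integral>\<^sup>+z. B z \<partial>lborel)"
  have M: "M \<noteq> 0" "M \<noteq> \<top>"
    by (simp_all add: M_def B_def emeasure_ball less_imp_neq[symmetric] unit_ball_vol_pos)
  have BT: "B (T z) = B z" for z using T(3)[of z] by (simp add: B_def indicator_def)
  have "M * (\<integral>\<^sup>+z. F z \<partial>lborel) = (\<integral>\<^sup>+y. B (T y) * (\<integral>\<^sup>+x. F x \<partial>lborel) \<partial>lborel)"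
    by (simp add: BT nn_integral_multc M_def)
  also have "\<dots> = (\<integral>\<^sup>+y. \<integral>\<^sup>+x. B (T y) * F (x - (- T y)) \<partial>lborel \<partial>lborel)"
    by (intro nn_integral_cong) (simp add: nn_integral_cmult nn_integral_lborel_shift del: diff_minus_eq_add)
  also have "\<dots> = (\<integral>\<^sup>+x. \<integral>\<^sup>+y. B (T y) * F (x - (- T y)) \<partial>lborel \<partial>lborel)"
    by (rule lborel_pair.Fubini') simp
  also have "\<dots> = (\<integral>\<^sup>+x. \<integral>\<^sup>+y. B (T y - x) * F (T y) \<partial>lborel \<partial>lborel)"
  proof (rule nn_integral_cong)
    fix x
    have "(\<integral>\<^sup>+y. B (T y) * F (x - (- T y)) \<partial>lborel) = (\<integral>\<^sup>+y. B (T (y - T x)) * F (x - (- T (y - T x))) \<partial>lborel)"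
      by (rule nn_integral_lborel_shift[symmetric]) simp
    then show "(\<integral>\<^sup>+y. B (T y) * F (x - (- T y)) \<partial>lborel) = (\<integral>\<^sup>+y. B (T y - x) * F (T y) \<partial>lborel)"
      by (simp add: linear_diff[OF T(1)] T(2))
  qed
  also have "\<dots> = (\<integral>\<^sup>+y. \<integral>\<^sup>+x. B (T y - x) * F (T y) \<partial>lborel \<partial>lborel)"
    by (rule lborel_pair.Fubini') simp
  also have "\<dots> = (\<integral>\<^sup>+y. M * F (T y) \<partial>lborel)"
    by (simp add: nn_integral_multc nn_integral_lborel_reflect M_def)
  also have "\<dots> = M * (\<integral>\<^sup>+z. F (T z) \<partial>lborel)"
    by (simp add: nn_integral_cmult)
  finally show ?thesis using M by (simp add: ennreal_mult_cancel_left)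
qed

text \<open>Reflection in the perpendicular bisector of the segment from \<open>x\<close> to
  \<open>y\<close>; it exchanges these two points.\<close>

definition reflect :: "'a::euclidean_space \<Rightarrow> 'a \<Rightarrow> 'a \<Rightarrow> 'a" where
  "reflect x y z = z - (2 * ((z - (1/2) *\<^sub>R (x + y)) \<bullet> (x - y)) / ((x - y) \<bullet> (x - y))) *\<^sub>R (x - y)"

lemma nn_integral_reflect:
  fixes F :: "'a::euclidean_space \<Rightarrow> ennreal"
  assumes xy: "x \<noteq> y" and [measurable]: "F \<in> borel_measurable borel"
  shows "(\<integral>\<^sup>+z. F (reflect x y z) \<partial>lborel) = (\<integral>\<^sup>+z. F z \<partial>lborel)"
proof -
  define d where "d = x - y"
  have d: "d \<bullet> d \<noteq> 0" using xy by (simp add: d_def)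
  define T where "T z = z - (2 * (z \<bullet> d) / (d \<bullet> d)) *\<^sub>R d" for z
  define a where "a = (2 * ((1/2) *\<^sub>R (x + y) \<bullet> d) / (d \<bullet> d)) *\<^sub>R d"
  have lin: "linear T"
    by (rule linearI) (simp_all add: T_def inner_add_left algebra_simps add_divide_distrib)
  have inv: "T (T z) = z" for z
    using d by (simp add: T_def inner_diff_left scaleR_left_diff_distrib[symmetric] algebra_simps)
  have nrm: "norm (T z) = norm z" for z
  proof -
    have "T z \<bullet> T z = z \<bullet> z"
      using d by (simp add: T_def inner_diff_left inner_diff_right inner_commute field_simps)
    then show ?thesis by (simp add: norm_eq_sqrt_inner)
  qed
  have eq: "reflect x y z = T z - (- a)" for z
    unfolding reflect_def d_def[symmetric] T_def a_def by (simp add: inner_diff_left algebra_simps diff_divide_distrib)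
  have "(\<integral>\<^sup>+z. F (reflect x y z) \<partial>lborel) = (\<integral>\<^sup>+z. F (z - (- a)) \<partial>lborel)"
    unfolding eq by (rule nn_integral_linear_involution[OF lin inv nrm]) simp
  then show ?thesis by (subst (asm) nn_integral_lborel_shift) auto
qed

text \<open>The sign of \<open>c\<close> tells on which side of the mirror \<open>z\<close> lies. If
  \<open>norm x \<le> norm y\<close>, the origin is on the side of \<open>x\<close>, so points of
  that side are nearer to the origin than their mirror images.\<close>

lemma
  fixes x y z :: "'a::euclidean_space"
  assumes xy: "x \<noteq> y"
  shows norm_reflect_left: "norm (x - reflect x y z) = norm (y - z)"
    and norm_reflect_right: "norm (y - reflect x y z) = norm (x - z)"
    and reflect_closer: "norm x \<le> norm y \<Longrightarrow> norm (x - z) \<le> norm (y - z) \<Longrightarrow> norm z \<le> norm (reflect x y z)"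
    and reflect_farther: "norm x \<le> norm y \<Longrightarrow> norm (y - z) \<le> norm (x - z) \<Longrightarrow> norm (reflect x y z) \<le> norm z"
proof -
  define d where "d = x - y"
  have d: "d \<bullet> d > 0" using xy by (simp add: d_def)
  define c where "c = ((z - (1/2) *\<^sub>R (x + y)) \<bullet> d) / (d \<bullet> d)"
  have cd: "c * (d \<bullet> d) = (z - (1/2) *\<^sub>R (x + y)) \<bullet> d" using d by (simp add: c_def)
  have r: "reflect x y z = z - (2 * c) *\<^sub>R d" by (simp add: reflect_def c_def d_def)
  have key: "(norm (y - z))\<^sup>2 - (norm (x - z))\<^sup>2 = 2 * (c * (d \<bullet> d))"
    unfolding cd by (simp add: d_def power2_norm_eq_inner inner_diff inner_add inner_commute algebra_simps)
  have sq: "(norm (w - reflect x y z))\<^sup>2 = (norm (w - z))\<^sup>2 + 4 * c * ((w - z) \<bullet> d) + 4 * c * (c * (d \<bullet> d))" for w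
    unfolding r by (simp add: power2_norm_eq_inner inner_diff inner_add inner_commute algebra_simps)
  have h: "(x - z) \<bullet> d + c * (d \<bullet> d) = (d \<bullet> d) / 2" "(y - z) \<bullet> d + c * (d \<bullet> d) = - (d \<bullet> d) / 2"
    unfolding cd by (simp_all add: d_def inner_diff inner_add inner_commute field_simps)
  have lin: "4 * c * P + 4 * c * Q = 4 * c * (P + Q)" for P Q by (rule distrib_left[symmetric])
  have "4 * c * ((x - z) \<bullet> d) + 4 * c * (c * (d \<bullet> d)) = 2 * (c * (d \<bullet> d))"
     "4 * c * ((y - z) \<bullet> d) + 4 * c * (c * (d \<bullet> d)) = - 2 * (c * (d \<bullet> d))"
    unfolding lin h by simp_all
  then have "(norm (x - reflect x y z))\<^sup>2 = (norm (y - z))\<^sup>2" "(norm (y - reflect x y z))\<^sup>2 = (norm (x - z))\<^sup>2"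
    using sq[of x] sq[of y] key by linarith+
  then show "norm (x - reflect x y z) = norm (y - z)" "norm (y - reflect x y z) = norm (x - z)"
    by simp_all
  have nr: "(norm (reflect x y z))\<^sup>2 = (norm z)\<^sup>2 - 2 * (c * ((norm x)\<^sup>2 - (norm y)\<^sup>2))"
  proof -
    have "z \<bullet> d - c * (d \<bullet> d) = ((norm x)\<^sup>2 - (norm y)\<^sup>2) / 2"
      unfolding cd by (simp add: d_def power2_norm_eq_inner inner_diff inner_add inner_commute field_simps)
    then have "4 * c * (z \<bullet> d - c * (d \<bullet> d)) = 2 * (c * ((norm x)\<^sup>2 - (norm y)\<^sup>2))" by simp
    then show ?thesis using sq[of 0] by (simp add: algebra_simps)
  qed
  show "norm z \<le> norm (reflect x y z)" if le: "norm x \<le> norm y" "norm (x - z) \<le> norm (y - z)"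
  proof (rule power2_le_imp_le)
    have "0 \<le> 2 * (c * (d \<bullet> d))" unfolding key[symmetric] using le(2) by (simp add: power_mono)
    then have "0 \<le> c" using d by (simp add: zero_le_mult_iff)
    then have "c * ((norm x)\<^sup>2 - (norm y)\<^sup>2) \<le> 0" using le(1) by (intro mult_nonneg_nonpos) (simp_all add: power_mono)
    then show "(norm z)\<^sup>2 \<le> (norm (reflect x y z))\<^sup>2" unfolding nr by simp
  qed simp
  show "norm (reflect x y z) \<le> norm z" if le: "norm x \<le> norm y" "norm (y - z) \<le> norm (x - z)"
  proof (rule power2_le_imp_le)
    have "2 * (c * (d \<bullet> d)) \<le> 0" unfolding key[symmetric] using le(2) by (simp add: power_mono)
    then have "c \<le> 0" using d by (simp add: mult_le_0_iff)
    then have "0 \<le> c * ((norm x)\<^sup>2 - (norm y)\<^sup>2)" using le(1) by (intro mult_nonpos_nonpos) (simp_all add: power_mono)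
    then show "(norm (reflect x y z))\<^sup>2 \<le> (norm z)\<^sup>2" unfolding nr by simp
  qed simp
qed

text \<open>The two-point rearrangement inequality, with \<open>a = b + c\<close> in place of a
  subtraction.\<close>

lemma ennreal_rearrangement:
  fixes a b A D :: ennreal
  assumes "b \<le> a" "D \<le> A"
  shows "a * D + b * A \<le> a * A + b * D"
proof -
  obtain c where c: "a = b + c" using \<open>b \<le> a\<close> unfolding le_iff_add by blast
  have "a * D + b * A = (b * A + b * D) + c * D" unfolding c by (simp only: distrib_left distrib_right ac_simps)
  also have "\<dots> \<le> (b * A + b * D) + c * A" using \<open>D \<le> A\<close> by (intro add_left_mono mult_left_mono) auto
  also have "\<dots> = a * A + b * D" unfolding c by (simp only: distrib_left distrib_right ac_simps)
  finally show ?thesis .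
qed

text \<open>The origin is exempt because the functions of interest may be infinite there, and the class is
  used for real-valued functions.\<close>

definition radially_decreasing :: "('a::euclidean_space \<Rightarrow> 'b::order) \<Rightarrow> bool" where
  "radially_decreasing f \<longleftrightarrow> (\<forall>x y. x \<noteq> 0 \<longrightarrow> norm x \<le> norm y \<longrightarrow> f y \<le> f x)"

lemma radially_decreasingD: "radially_decreasing f \<Longrightarrow> x \<noteq> 0 \<Longrightarrow> norm x \<le> norm y \<Longrightarrow> f y \<le> f x"
  by (auto simp: radially_decreasing_def)

text \<open>Fold the integrals along the mirror that exchanges \<open>x\<close> and
  \<open>y\<close>. In each pair of mirror points the one on the side of \<open>x\<close> has both
  the larger kernel value towards \<open>x\<close> and the larger value of \<open>f\<close>, so
  two-point rearrangement favours \<open>x\<close>.\<close>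

lemma radially_decreasing_convolution:
  fixes k f :: "'a::euclidean_space \<Rightarrow> ennreal"
  assumes [measurable]: "k \<in> borel_measurable borel" "f \<in> borel_measurable borel"
    and k: "\<And>z w. norm z \<le> norm w \<Longrightarrow> k w \<le> k z" and f: "radially_decreasing f"
    and xy: "norm x \<le> norm y"
  shows "(\<integral>\<^sup>+z. k (y - z) * f z \<partial>lborel) \<le> (\<integral>\<^sup>+z. k (x - z) * f z \<partial>lborel)"
proof (cases "x = y")
  case False
  let ?s = "reflect x y"
  have [measurable]: "?s \<in> borel_measurable borel" unfolding reflect_def[abs_def] by measurable
  have dbl: "(\<integral>\<^sup>+z. f z * k (w - z) + f (?s z) * k (w - ?s z) \<partial>lborel) = 2 * (\<integral>\<^sup>+z. k (w - z) * f z \<partial>lborel)" for w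
  proof -
    have "(\<integral>\<^sup>+z. f z * k (w - z) + f (?s z) * k (w - ?s z) \<partial>lborel)
      = (\<integral>\<^sup>+z. f z * k (w - z) \<partial>lborel) + (\<integral>\<^sup>+z. f (?s z) * k (w - ?s z) \<partial>lborel)"
      by (rule nn_integral_add) auto
    also have "(\<integral>\<^sup>+z. f (?s z) * k (w - ?s z) \<partial>lborel) = (\<integral>\<^sup>+z. f z * k (w - z) \<partial>lborel)"
      by (rule nn_integral_reflect[OF False]) simp
    finally show ?thesis by (simp add: mult_2 mult.commute)
  qed
  have keq: "norm z = norm w \<Longrightarrow> k z = k w" for z w by (intro antisym k) auto
  \<comment> \<open>The reflection is an involution, so a single point is sent to the origin. There
    the monotonicity of \<open>f\<close> gives no information, and the point is discarded as a null
    set.\<close>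
  have ne: "reflect x y z = 0 \<Longrightarrow> z = reflect x y 0" for z
  proof -
    assume z: "reflect x y z = 0"
    have "reflect x y (reflect x y z) = z"
    proof -
      define d where "d = x - y"
      define m where "m = (1/2) *\<^sub>R (x + y)"
      define c where "c w = ((w - m) \<bullet> d) / (d \<bullet> d)" for w
      have d: "d \<bullet> d \<noteq> 0" using False by (simp add: d_def)
      have r: "reflect x y w = w - (2 * c w) *\<^sub>R d" for w
        by (simp add: reflect_def c_def d_def m_def)
      have "(z - (2 * c z) *\<^sub>R d - m) \<bullet> d = (z - m) \<bullet> d - 2 * c z * (d \<bullet> d)"
        by (simp add: inner_diff_left)
      then have "c (z - (2 * c z) *\<^sub>R d) = c z - 2 * c z"
        using d unfolding c_def[of "z - (2 * c z) *\<^sub>R d"] by (simp add: diff_divide_distrib c_def[symmetric])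
      then show ?thesis unfolding r by simp
    qed
    then show "z = reflect x y 0" using z by simp
  qed
  have "AE z in lborel. z \<noteq> 0 \<and> ?s z \<noteq> 0"
    using AE_lborel_singleton[of 0] AE_lborel_singleton[of "?s 0"]
    by eventually_elim (use ne in auto)
  then have "AE z in lborel. f z * k (y - z) + f (?s z) * k (y - ?s z) \<le> f z * k (x - z) + f (?s z) * k (x - ?s z)"
  proof eventually_elim
    case (elim z)
    have k1: "k (y - ?s z) = k (x - z)" "k (x - ?s z) = k (y - z)"
      using norm_reflect_left[OF False, of z] norm_reflect_right[OF False, of z] by (auto intro: keq)
    show ?case
    proof (cases "norm (x - z) \<le> norm (y - z)")
      case True
      then have "f (?s z) \<le> f z" "k (y - z) \<le> k (x - z)"
        using elim reflect_closer[OF False xy] by (auto intro: radially_decreasingD[OF f] k)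
      then show ?thesis unfolding k1 by (rule ennreal_rearrangement)
    next
      case gt: False
      then have "f z \<le> f (?s z)" "k (x - z) \<le> k (y - z)"
        using elim reflect_farther[OF False xy] by (auto intro: radially_decreasingD[OF f] k)
      from ennreal_rearrangement[OF this] show ?thesis unfolding k1 by (simp add: add.commute)
    qed
  qed
  from nn_integral_mono_AE[OF this] have "2 * (\<integral>\<^sup>+z. k (y - z) * f z \<partial>lborel) \<le> 2 * (\<integral>\<^sup>+z. k (x - z) * f z \<partial>lborel)"
    unfolding dbl .
  then show ?thesis by (simp add: ennreal_mult_le_mult_iff)
qed simp

text \<open>A diagonal sequence of the radial profiles converges at countably many dense arguments,
  hence at every continuity point of a monotone limit. The exceptional radii are countable, and
  spheres are null sets.\<close>

lemma radially_decreasing_helly: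
  fixes f :: "nat \<Rightarrow> 'a::euclidean_space \<Rightarrow> real"
  assumes f: "\<And>k. radially_decreasing (f k)" and f0: "\<And>k x. 0 \<le> f k x" and bd: "\<And>k x. x \<noteq> 0 \<Longrightarrow> f k x \<le> D x"
  obtains r F where "strict_mono r" "\<And>x. 0 \<le> F x" "radially_decreasing F" "F \<in> borel_measurable borel"
    "AE x in lborel. (\<lambda>k. f (r k) x) \<longlonglongrightarrow> F x"
proof -
  obtain e :: 'a where e: "norm e = 1" using vector_choose_size[of 1] by auto
  \<comment> \<open>The logarithm of the radius runs over the whole line, so the exempt origin
    disappears from the one-dimensional problem.\<close>
  define \<phi> where "\<phi> k t = f k (exp t *\<^sub>R e)" for k t
  have \<phi>: "f k x = \<phi> k (ln (norm x))" if "x \<noteq> 0" for k x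
    using that e unfolding \<phi>_def by (intro antisym radially_decreasingD[OF f]) auto
  have \<phi>_mono: "s \<le> t \<Longrightarrow> \<phi> k t \<le> \<phi> k s" for k s t
    using e unfolding \<phi>_def by (intro radially_decreasingD[OF f]) auto
  have \<phi>_0: "0 \<le> \<phi> k t" for k t by (simp add: \<phi>_def f0)
  define D' where "D' t = D (exp t *\<^sub>R e)" for t
  have \<phi>_D: "\<phi> k t \<le> D' t" for k t
    unfolding \<phi>_def D'_def using e by (intro bd) auto
  define q :: "nat \<Rightarrow> real" where "q n = of_rat (nat_to_rat_surj n)" for n
  have q: "\<exists>n. a < q n \<and> q n < b" if "a < b" for a b
  proof -
    obtain z where "a < of_rat z" "of_rat z < b" using of_rat_dense[OF \<open>a < b\<close>] by blast
    then show ?thesis unfolding q_def using surj_nat_to_rat_surj by (metis surjD)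
  qed
  interpret subseqs "\<lambda>n s. convergent (\<lambda>k. \<phi> (s k) (q n))"
  proof
    fix n and s :: "nat \<Rightarrow> nat" assume "strict_mono s"
    have "\<forall>k. \<phi> (s k) (q n) \<in> {0..D' (q n)}" by (auto simp: \<phi>_0 \<phi>_D)
    then obtain l r where "strict_mono r" "((\<lambda>k. \<phi> (s k) (q n)) \<circ> r) \<longlonglongrightarrow> l"
      using compact_Icc[of 0 "D' (q n)", unfolded compact_def, rule_format, of "\<lambda>k. \<phi> (s k) (q n)"] by blast
    then show "\<exists>r. strict_mono r \<and> convergent (\<lambda>k. \<phi> ((s \<circ> r) k) (q n))"
      by (auto simp: convergent_def comp_def)
  qed
  have conv: "convergent (\<lambda>k. \<phi> (diagseq k) (q n))" for n
  proof -
    have "convergent (\<lambda>k. \<phi> ((diagseq \<circ> (+) (Suc n)) k) (q n))"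
    proof (rule diagseq_holds)
      fix r s :: "nat \<Rightarrow> nat" and m assume "strict_mono r" "convergent (\<lambda>k. \<phi> (s k) (q m))"
      then show "convergent (\<lambda>k. \<phi> ((s \<circ> r) k) (q m))"
        using convergent_subseq_convergent[of "\<lambda>k. \<phi> (s k) (q m)" r] by (simp add: comp_def)
    qed
    then show ?thesis
      using convergent_ignore_initial_segment[of "\<lambda>k. \<phi> (diagseq k) (q n)" "Suc n"] by (simp add: comp_def add.commute)
  qed
  define L where "L n = lim (\<lambda>k. \<phi> (diagseq k) (q n))" for n
  have L: "(\<lambda>k. \<phi> (diagseq k) (q n)) \<longlonglongrightarrow> L n" for n
    using conv[of n] by (simp add: L_def convergent_LIMSEQ_iff)
  have L_mono: "q m \<le> q n \<Longrightarrow> L n \<le> L m" for m n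
    by (rule LIMSEQ_le[OF L L]) (auto intro: \<phi>_mono)
  have L0: "0 \<le> L n" for n
    by (rule LIMSEQ_le_const[OF L]) (auto intro: \<phi>_0)
  \<comment> \<open>For decreasing profiles the supremum over the rationals to the right is a
    right-hand limit of the rational limits \<open>L\<close>; it is defined and monotone at every
    real argument.\<close>
  define \<psi> where "\<psi> t = (SUP n\<in>{n. t < q n}. L n)" for t
  have ne: "{n. t < q n} \<noteq> {}" for t using q[of t "t + 1"] by auto
  have bdd: "bdd_above (L ` {n. t < q n})" for t
  proof -
    obtain m where "t - 1 < q m" "q m < t" using q[of "t - 1" t] by auto
    then show ?thesis by (intro bdd_aboveI[of _ "L m"]) (auto intro: L_mono)
  qed
  have L_le: "t < q n \<Longrightarrow> L n \<le> \<psi> t" for t n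
    unfolding \<psi>_def by (rule cSUP_upper) (auto intro: bdd)
  have \<psi>_mono: "s \<le> t \<Longrightarrow> \<psi> t \<le> \<psi> s" for s t
    unfolding \<psi>_def by (rule cSUP_subset_mono) (use ne bdd in auto)
  have \<psi>_0: "0 \<le> \<psi> t" for t
  proof -
    obtain n where "t < q n" using ne[of t] by auto
    then show ?thesis using L_le[of t n] L0[of n] by simp
  qed
  have lim: "(\<lambda>k. \<phi> (diagseq k) t) \<longlonglongrightarrow> \<psi> t" if c: "isCont \<psi> t" for t
  proof (rule order_tendstoI)
    fix a assume "a < \<psi> t"
    then obtain n where n: "t < q n" "a < L n"
      unfolding \<psi>_def less_cSUP_iff[OF ne bdd] by auto
    have "eventually (\<lambda>k. a < \<phi> (diagseq k) (q n)) sequentially"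
      using L n(2) by (rule order_tendstoD)
    then show "eventually (\<lambda>k. a < \<phi> (diagseq k) t) sequentially"
    proof eventually_elim
      case (elim k)
      then show ?case using \<phi>_mono[of t "q n" "diagseq k"] n(1) by simp
    qed
  next
    fix a assume "\<psi> t < a"
    \<comment> \<open>The upper bound compares with a rational to the left of \<open>t\<close>, so
      it is continuity from the left that closes the gap.\<close>
    moreover have "(\<psi> \<longlongrightarrow> \<psi> t) (at_left t)"
      using c by (simp add: isCont_def filterlim_at_split)
    ultimately have "eventually (\<lambda>s. \<psi> s < a) (at_left t)" by (auto dest: order_tendstoD)
    then obtain b where "b < t" "\<And>s. b < s \<Longrightarrow> s < t \<Longrightarrow> \<psi> s < a"
      unfolding eventually_at_left_field by blast
    moreover obtain s where "b < s" "s < t" using dense[OF \<open>b < t\<close>] by auto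
    ultimately have s: "s < t" "\<psi> s < a" by auto
    obtain n where n: "s < q n" "q n < t" using q[OF s(1)] by auto
    have "L n < a" using L_le[OF n(1)] s(2) by simp
    then have "eventually (\<lambda>k. \<phi> (diagseq k) (q n) < a) sequentially"
      using order_tendstoD(2)[OF L] by blast
    then show "eventually (\<lambda>k. \<phi> (diagseq k) t < a) sequentially"
    proof eventually_elim
      case (elim k)
      then show ?case using \<phi>_mono[of "q n" t "diagseq k"] n(2) by simp
    qed
  qed
  \<comment> \<open>The value at the origin affects neither \<open>radially_decreasing\<close> nor
    any integral; 0 is an arbitrary choice that keeps \<open>F\<close> nonnegative.\<close>
  define F where "F x = (if x = 0 then 0 else \<psi> (ln (norm x)))" for x :: 'a
  have "mono (\<lambda>t. - \<psi> t)" using \<psi>_mono by (auto simp: mono_def)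
  then have m: "(\<lambda>t. - \<psi> t) \<in> borel_measurable borel" and "countable {a. \<not> isCont (\<lambda>t. - \<psi> t) a}"
    by (rule Borel_Space.borel_measurable_mono, rule mono_ctble_discont)
  moreover have "isCont (\<lambda>t. - \<psi> t) a \<Longrightarrow> isCont \<psi> a" for a
    using continuous_minus[of "at a" "\<lambda>t. - \<psi> t"] by simp
  ultimately have cnt: "countable {a. \<not> isCont \<psi> a}"
    by (auto elim: countable_subset[rotated])
  have [measurable]: "\<psi> \<in> borel_measurable borel" using borel_measurable_uminus[OF m] by simp
  show thesis
  proof (rule that[of diagseq F])
    show "strict_mono diagseq" by (rule subseq_diagseq)
    show "0 \<le> F x" for x by (simp add: F_def \<psi>_0)
    show "radially_decreasing F"
      unfolding radially_decreasing_def F_def by (auto intro: \<psi>_mono)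
    show "F \<in> borel_measurable borel" unfolding F_def[abs_def] by measurable
    have "(\<Union>a\<in>{a. \<not> isCont \<psi> a}. sphere 0 (exp a)) \<in> null_sets (lborel :: 'a measure)"
    proof (rule null_sets_UN'[OF cnt])
      fix a
      show "sphere 0 (exp a) \<in> null_sets (lborel :: 'a measure)"
        using negligible_sphere[of "0::'a" "exp a"] by (simp add: negligible_iff_null_sets null_sets_completion_iff)
    qed
    then have "AE x in (lborel :: 'a measure). x \<notin> (\<Union>a\<in>{a. \<not> isCont \<psi> a}. sphere 0 (exp a))"
      by (rule AE_not_in)
    with AE_lborel_singleton[of "0::'a"]
    show "AE x in lborel. (\<lambda>k. f (diagseq k) x) \<longlonglongrightarrow> F x"
    proof eventually_elim
      case (elim x)
      then have "isCont \<psi> (ln (norm x))"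
        by (auto simp: dist_norm)
      then show ?case using elim lim by (simp add: F_def \<phi>)
    qed
  qed
qed

section \<open>Existence of a bounded solution\<close>

text \<open>On the ball of radius \<open>norm x\<close> the function is at least \<open>f x\<close>
  off the origin, so \<open>f x powr r\<close> times the volume of that ball is at most
  \<open>M\<close>.\<close>

lemma radially_decreasing_power_bound:
  fixes f :: "'a::euclidean_space \<Rightarrow> real"
  assumes f: "radially_decreasing f" "\<And>x. 0 \<le> f x" and [measurable]: "f \<in> borel_measurable borel"
    and r: "r > 0" and M: "(\<integral>\<^sup>+x. ennreal (f x powr r) \<partial>lborel) \<le> ennreal M" "M \<ge> 0" and x: "x \<noteq> 0"
  shows "f x \<le> (M / unit_ball_vol DIM('a)) powr (1 / r) * norm x powr (- (DIM('a) / r))"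
proof -
  let ?w = "unit_ball_vol DIM('a)"
  have w: "?w > 0" by (rule unit_ball_vol_pos) simp
  have "ennreal (f x powr r * (?w * norm x ^ DIM('a))) = (\<integral>\<^sup>+y. ennreal (f x powr r) * indicator (cball 0 (norm x)) (y::'a) \<partial>lborel)"
    using w by (simp add: nn_integral_cmult_indicator emeasure_cball ennreal_mult')
  also have "\<dots> \<le> (\<integral>\<^sup>+y. ennreal (f y powr r) \<partial>lborel)"
  proof (rule nn_integral_mono_AE)
    show "AE y in lborel. ennreal (f x powr r) * indicator (cball 0 (norm x)) (y::'a) \<le> ennreal (f y powr r)"
      using AE_lborel_singleton[of 0]
    proof eventually_elim
      case (elim y)
      show ?case
      proof (cases "y \<in> cball 0 (norm x)")
        case True
        then have "f x \<le> f y" using elim by (intro radially_decreasingD[OF f(1)]) auto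
        then show ?thesis using True f r by (auto intro!: ennreal_leI powr_mono2)
      qed simp
    qed
  qed
  also have "\<dots> \<le> ennreal M" by (rule M)
  finally have "f x powr r * (?w * norm x ^ DIM('a)) \<le> M" using M by simp
  then have "f x powr r \<le> M / ?w * norm x powr (- DIM('a))"
    using w x by (simp add: powr_minus powr_realpow field_simps)
  then have "(f x powr r) powr (1 / r) \<le> (M / ?w * norm x powr (- DIM('a))) powr (1 / r)"
    using r by (intro powr_mono2) auto
  also have "\<dots> = (M / ?w) powr (1 / r) * norm x powr (- (DIM('a) / r))"
    by (subst powr_mult) (simp add: powr_powr)
  finally show ?thesis using r f by (simp add: powr_powr)
qed

lemma radially_decreasing_indicator_ball:
  "c \<ge> 0 \<Longrightarrow> radially_decreasing (\<lambda>x. c * indicator (ball 0 r) x :: real)"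
  "c \<ge> 0 \<Longrightarrow> radially_decreasing (\<lambda>x. c * indicator (cball 0 r) x :: real)"
  by (auto simp: radially_decreasing_def indicator_def)

lemma bform_eq_iterated:
  assumes [measurable]: "k \<in> borel_measurable borel" "h \<in> borel_measurable borel"
  shows "bform k f h = (\<integral>\<^sup>+x. f x * (\<integral>\<^sup>+y. k (x - y) * h y \<partial>lborel) \<partial>lborel)"
  by (simp add: bform_def nn_integral_cmult mult.assoc)

lemma bform_cmult:
  fixes c :: ennreal
  assumes [measurable]: "k \<in> borel_measurable borel" "f \<in> borel_measurable borel" "h \<in> borel_measurable borel"
  shows "bform k (\<lambda>x. c * f x) (\<lambda>x. c * h x) = c * c * bform k f h"
proof -
  have "bform k (\<lambda>x. c * f x) (\<lambda>x. c * h x) = (\<integral>\<^sup>+x. \<integral>\<^sup>+y. c * c * (f x * k (x - y) * h y) \<partial>lborel \<partial>lborel)"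
    by (simp add: bform_def mult_ac)
  then show ?thesis by (simp add: nn_integral_cmult bform_def)
qed

text \<open>Squaring gains strictness, since \<open>(1 + x / 2)^2\<close> exceeds
  \<open>1 + x\<close> by \<open>(x / 2)^2\<close>. This is what decides the equality case of
  Young's inequality.\<close>

lemma exp_gt_add_one:
  fixes x :: real
  assumes "x \<noteq> 0"
  shows "1 + x < exp x"
proof (cases "x < - 2")
  case False
  have "1 + x < (1 + x / 2)\<^sup>2" using zero_less_power2[of "x / 2"] assms by (simp add: power2_eq_square algebra_simps)
  also have "\<dots> \<le> (exp (x / 2))\<^sup>2" using False by (intro power_mono exp_ge_add_one_self) auto
  also have "\<dots> = exp x" by (simp flip: exp_double)
  finally show ?thesis .
qed (use exp_gt_zero[of x] in linarith)

text \<open>The exponents \<open>(q + 1) / q\<close> and \<open>q + 1\<close> are conjugate. In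
  terms of \<open>t\<close>, the logarithm of the ratio of the two powers, the claim is strict
  convexity of \<open>exp\<close> between 0 and \<open>t\<close>, with equality only for
  \<open>t = 0\<close>.\<close>

lemma Young_strict:
  fixes a b q :: real
  assumes q: "q > 1" and "0 \<le> a" "0 \<le> b"
  shows "a * b \<le> a powr ((q + 1) / q) * (q / (q + 1)) + b powr (q + 1) / (q + 1)"
    and "a * b = a powr ((q + 1) / q) * (q / (q + 1)) + b powr (q + 1) / (q + 1) \<Longrightarrow> a = b powr q"
proof -
  define \<theta> where "\<theta> = q / (q + 1)"
  have \<theta>: "0 < \<theta>" "\<theta> < 1" "1 - \<theta> = 1 / (q + 1)" using q by (auto simp: \<theta>_def field_simps)
  have "a * b \<le> a powr ((q + 1) / q) * \<theta> + b powr (q + 1) / (q + 1) \<and>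
    (a * b = a powr ((q + 1) / q) * \<theta> + b powr (q + 1) / (q + 1) \<longrightarrow> a = b powr q)"
  proof (cases "a = 0 \<or> b = 0")
    case True
    then show ?thesis using \<theta> q by (auto simp: add_nonneg_eq_0_iff)
  next
    case False
    then have ab: "a > 0" "b > 0" using assms by auto
    define Y where "Y = b powr (q + 1)"
    define t where "t = (q + 1) / q * ln a - (q + 1) * ln b"
    have "\<theta> * ((q + 1) / q) = 1" "\<theta> * (q + 1) = q" using q by (auto simp: \<theta>_def)
    then have \<theta>t: "\<theta> * t = ln a - q * ln b"
      unfolding t_def right_diff_distrib mult.assoc[symmetric] by simp
    have Y: "Y > 0" using ab by (simp add: Y_def)
    have X: "a powr ((q + 1) / q) = Y * exp t"
      using ab by (simp add: Y_def t_def powr_def flip: exp_add)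
    have "a * b = exp (ln a + ln b)" using ab by (simp add: exp_add)
    also have "ln a + ln b = (q + 1) * ln b + \<theta> * t"
      by (simp add: \<theta>t algebra_simps)
    also have "exp \<dots> = Y * exp (\<theta> * t)" using ab by (simp add: exp_add Y_def powr_def)
    finally have AB: "a * b = Y * exp (\<theta> * t)" .
    have 1: "exp t = exp (\<theta> * t) * exp ((1 - \<theta>) * t)" by (simp add: algebra_simps flip: exp_add)
    have 2: "1 = exp (\<theta> * t) * exp (- (\<theta> * t))" by (simp flip: exp_add)
    \<comment> \<open>With \<open>exp (\<theta> * t)\<close> taken out, the two remaining exponents
      have weighted mean 0, so the tangent bounds \<open>1 + x \<le> exp x\<close> for them add up
      to 1.\<close>
    have "\<theta> * exp t + (1 - \<theta>) = exp (\<theta> * t) * (\<theta> * exp ((1 - \<theta>) * t) + (1 - \<theta>) * exp (- (\<theta> * t)))"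
      using 2 unfolding 1 distrib_left mult.left_commute[of "exp (\<theta> * t)"] by simp
    moreover have "1 \<le> \<theta> * exp ((1 - \<theta>) * t) + (1 - \<theta>) * exp (- (\<theta> * t))"
      and "t \<noteq> 0 \<Longrightarrow> 1 < \<theta> * exp ((1 - \<theta>) * t) + (1 - \<theta>) * exp (- (\<theta> * t))"
    proof -
      have eq: "\<theta> * (1 + (1 - \<theta>) * t) + (1 - \<theta>) * (1 + - (\<theta> * t)) = 1" by (simp add: algebra_simps)
      have "\<theta> * (1 + (1 - \<theta>) * t) \<le> \<theta> * exp ((1 - \<theta>) * t)" "(1 - \<theta>) * (1 + - (\<theta> * t)) \<le> (1 - \<theta>) * exp (- (\<theta> * t))"
        using \<theta>(1,2) by (intro mult_left_mono exp_ge_add_one_self; simp)+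
      then show "1 \<le> \<theta> * exp ((1 - \<theta>) * t) + (1 - \<theta>) * exp (- (\<theta> * t))" using eq by linarith
      assume "t \<noteq> 0"
      then have "- (\<theta> * t) \<noteq> 0" using \<theta> by simp
      then have "1 + - (\<theta> * t) < exp (- (\<theta> * t))"
        by (rule exp_gt_add_one)
      then have "(1 - \<theta>) * (1 + - (\<theta> * t)) < (1 - \<theta>) * exp (- (\<theta> * t))"
        using \<theta>(1,2) by (intro mult_strict_left_mono) auto
      then show "1 < \<theta> * exp ((1 - \<theta>) * t) + (1 - \<theta>) * exp (- (\<theta> * t))"
        using eq \<open>\<theta> * (1 + (1 - \<theta>) * t) \<le> \<theta> * exp ((1 - \<theta>) * t)\<close> by linarith
    qed
    ultimately have le: "exp (\<theta> * t) \<le> \<theta> * exp t + (1 - \<theta>)" and lt: "t \<noteq> 0 \<Longrightarrow> exp (\<theta> * t) < \<theta> * exp t + (1 - \<theta>)"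
      by simp_all
    have R: "a powr ((q + 1) / q) * \<theta> + b powr (q + 1) / (q + 1) = Y * (\<theta> * exp t + (1 - \<theta>))"
      unfolding X Y_def[symmetric] \<theta>(3) by (simp add: algebra_simps)
    have "t = 0 \<Longrightarrow> a = b powr q"
    proof -
      assume "t = 0"
      then have "ln a = q * ln b" using \<theta>t by simp
      then show "a = b powr q" using ab by (simp add: powr_def) (metis exp_ln)
    qed
    then show ?thesis unfolding AB R using Y le lt by (cases "t = 0") auto
  qed
  then show "a * b \<le> a powr ((q + 1) / q) * (q / (q + 1)) + b powr (q + 1) / (q + 1)"
    and "a * b = a powr ((q + 1) / q) * (q / (q + 1)) + b powr (q + 1) / (q + 1) \<Longrightarrow> a = b powr q"
    by (auto simp: \<theta>_def)
qed

section \<open>The variational problem\<close>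

text \<open>The assumptions collect the consequences of the Gaussian mixture on which existence
  rests. \<open>k_riesz\<close> controls the singularity at the origin, \<open>k_integral\<close>
  the behaviour at infinity, and \<open>k_psd\<close> is positive semidefiniteness without
  subtraction.\<close>

locale riesz_kernel =
  fixes k :: "'a::euclidean_space \<Rightarrow> ennreal" and \<alpha> q :: real
  assumes k_measurable [measurable]: "k \<in> borel_measurable borel"
    and k_antimono: "norm z \<le> norm w \<Longrightarrow> k w \<le> k z"
    and k_pos: "0 < k z"
    and k_integral: "(\<integral>\<^sup>+z. k z \<partial>lborel) < \<infinity>"
    and k_riesz: "\<exists>C\<ge>0. \<forall>z. z \<noteq> 0 \<longrightarrow> k z \<le> ennreal (C * norm z powr (\<alpha> - DIM('a)))"
    and k_psd: "f \<in> borel_measurable borel \<Longrightarrow> h \<in> borel_measurable borel \<Longrightarrow>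
        bform k f h + bform k f h \<le> bform k f f + bform k h h"
    and \<alpha>: "0 < \<alpha>" "\<alpha> < DIM('a)"
    and q: "1 < q" "q < (DIM('a) + \<alpha>) / (DIM('a) - \<alpha>)"
begin

lemma k_minus: "k (x - y) = k (y - x)"
  by (intro antisym k_antimono) (simp_all add: norm_minus_commute)

abbreviation "p \<equiv> (q + 1) / q"

text \<open>The number \<open>n q / (q + 1)\<close> is the rate \<open>n / p\<close> of the
  majorant. Its three bounds mean square integrability at infinity, integrability at the origin, and
  subcriticality.\<close>

lemma exponents: "1 < p" "p < 2" "real DIM('a) / p = (real DIM('a) * q / (q + 1))" "real DIM('a) < 2 * (real DIM('a) * q / (q + 1))" "(real DIM('a) * q / (q + 1)) < real DIM('a)" "2 * (real DIM('a) * q / (q + 1)) < real DIM('a) + \<alpha>"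
proof -
  show "1 < p" "p < 2" "real DIM('a) / p = (real DIM('a) * q / (q + 1))" using q by (simp_all add: field_simps)
  have nn: "real DIM('a) > 0" by simp
  show "real DIM('a) < 2 * (real DIM('a) * q / (q + 1))" "(real DIM('a) * q / (q + 1)) < real DIM('a)" using q nn by (simp_all add: field_simps)
  have "q * (real DIM('a) - \<alpha>) < real DIM('a) + \<alpha>" using q \<alpha> by (simp add: field_simps)
  then show "2 * (real DIM('a) * q / (q + 1)) < real DIM('a) + \<alpha>" using q nn by (simp add: field_simps)
qed

definition energy :: "('a \<Rightarrow> real) \<Rightarrow> ennreal" where
  "energy f = bform k (\<lambda>x. ennreal (f x)) (\<lambda>x. ennreal (f x))"

definition admissible :: "('a \<Rightarrow> real) set" where
  "admissible = {f. radially_decreasing f \<and> (\<forall>x. 0 \<le> f x) \<and> f \<in> borel_measurable borel \<and>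
     (\<integral>\<^sup>+x. ennreal (f x powr p) \<partial>lborel) \<le> 1}"

text \<open>The common bound given by \<open>radially_decreasing_power_bound\<close> for the unit
  ball of \<open>L^p\<close>. The majorant itself is not in \<open>L^p\<close>: its
  \<open>p\<close>-th power is a multiple of \<open>|x|^(- n)\<close>, which diverges at both
  ends.\<close>

definition majorant :: "'a \<Rightarrow> real" where
  "majorant x = (1 / unit_ball_vol (real DIM('a))) powr (1 / p) * norm x powr (- (real DIM('a) * q / (q + 1)))"

lemma measurable_majorant [measurable]: "majorant \<in> borel_measurable borel"
  unfolding majorant_def[abs_def] by measurable

lemma ball_vol_nonzero: "unit_ball_vol (real DIM('a)) \<noteq> 0"
  using unit_ball_vol_pos[of "real DIM('a)"] by linarith

lemma majorant_pos: "x \<noteq> 0 \<Longrightarrow> 0 < majorant x"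
  using ball_vol_nonzero by (simp add: majorant_def)

lemma admissible_le_majorant: "f \<in> admissible \<Longrightarrow> x \<noteq> 0 \<Longrightarrow> f x \<le> majorant x"
  using radially_decreasing_power_bound[of f p 1 x] q exponents(3)
  by (simp add: admissible_def majorant_def)

text \<open>Split at the unit sphere: the outer part is bounded and square integrable, the inner
  part is integrable and its potential is controlled by \<open>riesz_potential_le\<close>. Then
  \<open>bform_add_le\<close> combines them.\<close>

lemma energy_majorant: "energy majorant < \<infinity>"
proof -
  define d where "d = real DIM('a) * q / (q + 1)"
  have d0: "d > 0" using q by (simp add: d_def)
  note ex = exponents(1,2,4-6)[folded d_def]
  obtain C where C: "C \<ge> 0" "\<And>z. z \<noteq> 0 \<Longrightarrow> k z \<le> ennreal (C * norm z powr (\<alpha> - real DIM('a)))"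
    using k_riesz by auto
  \<comment> \<open>With this choice both decisive requirements, \<open>d - \<alpha> < b'\<close>
    for the potential and \<open>d + b' < n\<close> for the integral that remains, turn into
    \<open>2 * d < n + \<alpha>\<close>, that is, subcriticality.\<close>
  define b' where "b' = (real DIM('a) - \<alpha>) / 2"
  have b': "0 \<le> b'" "b' \<le> d" "d - \<alpha> < b'" "b' \<le> real DIM('a) - \<alpha>" "d + b' < real DIM('a)"
    using ex d0 \<alpha> by (auto simp: b'_def field_simps)
  define F1 where "F1 x = ennreal (indicator (cball 0 1) x * norm x powr (- d))" for x :: 'a
  define F2 where "F2 x = ennreal (indicator (- cball 0 1) x * norm x powr (- d))" for x :: 'a
  have [measurable]: "cball (0::'a) 1 \<in> sets borel" by simp
  have m[measurable]: "F1 \<in> borel_measurable borel" "F2 \<in> borel_measurable borel"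
    unfolding F1_def[abs_def] F2_def[abs_def] by measurable
  have I1: "(\<integral>\<^sup>+x. F1 x \<partial>lborel) < \<infinity>"
    unfolding F1_def using ex d0 by (intro nn_integral_norm_powr_inside) auto
  have F2: "F2 x \<le> 1" for x
    using powr_mono2'[of "- d" 1 "norm x"] ex d0 by (auto simp: F2_def indicator_def)
  have "(\<integral>\<^sup>+x. F2 x * F2 x \<partial>lborel) \<le> (\<integral>\<^sup>+x. ennreal (indicator (- ball 0 1) x * norm x powr (- (2 * d))) \<partial>(lborel :: 'a measure))"
  proof (intro nn_integral_mono)
    fix x :: 'a
    have "norm x powr (- (2 * d)) = norm x powr (- d) * norm x powr (- d)" by (simp flip: powr_add)
    then show "F2 x * F2 x \<le> ennreal (indicator (- ball 0 1) x * norm x powr (- (2 * d)))"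
      by (auto simp: F2_def indicator_def simp flip: ennreal_mult)
  qed
  also have "\<dots> < \<infinity>" using ex d0 by (intro nn_integral_norm_powr_outside) auto
  finally have I2: "(\<integral>\<^sup>+x. F2 x * F2 x \<partial>lborel) < \<infinity>" .
  obtain C' where "C' \<ge> 0" and pot: "\<And>x. x \<noteq> 0 \<Longrightarrow>
      (\<integral>\<^sup>+y. k (x - y) * ennreal (indicator (cball 0 1) y * norm y powr (- d)) \<partial>lborel) \<le> ennreal (C' * norm x powr (- b'))"
    by (rule riesz_potential_le[OF k_measurable C(2,1) b'(1-4)]) (assumption, rule that)
  note C' = \<open>C' \<ge> 0\<close> pot[folded F1_def]
  have "bform k F1 F1 = (\<integral>\<^sup>+x. F1 x * (\<integral>\<^sup>+y. k (x - y) * F1 y \<partial>lborel) \<partial>lborel)"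
    by (rule bform_eq_iterated) auto
  also have "\<dots> \<le> (\<integral>\<^sup>+x. ennreal C' * ennreal (indicator (cball 0 1) x * norm x powr (- (d + b'))) \<partial>(lborel :: 'a measure))"
  proof (rule nn_integral_mono_AE)
    show "AE x in lborel. F1 x * (\<integral>\<^sup>+y. k (x - y) * F1 y \<partial>lborel) \<le> ennreal C' * ennreal (indicator (cball 0 1) x * norm x powr (- (d + b')))"
      using AE_lborel_singleton[of 0]
    proof eventually_elim
      case (elim x)
      have "F1 x * (\<integral>\<^sup>+y. k (x - y) * F1 y \<partial>lborel) \<le> F1 x * ennreal (C' * norm x powr (- b'))"
        by (intro mult_left_mono C' elim) auto
      also have "\<dots> = ennreal (indicator (cball 0 1) x * norm x powr (- d) * (C' * norm x powr (- b')))"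
        using C' unfolding F1_def by (intro ennreal_mult[symmetric]) auto
      also have "indicator (cball 0 1) x * norm x powr (- d) * (C' * norm x powr (- b'))
        = C' * (indicator (cball 0 1) x * norm x powr (- (d + b')))"
      proof -
        have "norm x powr (- (d + b')) = norm x powr (- d) * norm x powr (- b')" by (simp flip: powr_add)
        then show ?thesis by simp
      qed
      also have "ennreal \<dots> = ennreal C' * ennreal (indicator (cball 0 1) x * norm x powr (- (d + b')))"
        using C' by (intro ennreal_mult) auto
      finally show ?case .
    qed
  qed
  also have "(\<integral>\<^sup>+x. ennreal C' * ennreal (indicator (cball 0 1) x * norm x powr (- (d + b'))) \<partial>(lborel :: 'a measure)) = ennreal C' * (\<integral>\<^sup>+x. ennreal (indicator (cball 0 1) x * norm x powr (- (d + b'))) \<partial>(lborel :: 'a measure))"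
    by (rule nn_integral_cmult) measurable
  also have "\<dots> < \<infinity>"
    using nn_integral_norm_powr_inside[of "d + b'", where 'a='a] b' ex d0 by (simp add: ennreal_mult_less_top)
  finally have B: "bform k F1 F1 < \<infinity>" .
  let ?A = "ennreal ((1 / unit_ball_vol (real DIM('a))) powr (1 / p))"
  have "(\<lambda>x. ennreal (majorant x)) = (\<lambda>x. ?A * (F1 x + F2 x))"
    by (auto simp: fun_eq_iff majorant_def d_def[symmetric] F1_def F2_def indicator_def ennreal_mult')
  then have "energy majorant = ?A * ?A * bform k (\<lambda>x. F1 x + F2 x) (\<lambda>x. F1 x + F2 x)"
    unfolding energy_def by (simp add: bform_cmult)
  also have "\<dots> \<le> ?A * ?A * (bform k F1 F1 + (2 * (\<integral>\<^sup>+x. F1 x \<partial>lborel) + 2 * (\<integral>\<^sup>+x. F2 x * F2 x \<partial>lborel)) * (\<integral>\<^sup>+x. k x \<partial>lborel))"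
    by (intro mult_left_mono bform_add_le m k_measurable F2) auto
  also have "\<dots> < \<infinity>" using B I1 I2 k_integral by (simp add: ennreal_mult_less_top)
  finally show ?thesis .
qed

lemma energy_mono: "(AE x in lborel. f x \<le> h x) \<Longrightarrow> energy f \<le> energy h"
  unfolding energy_def bform_def
proof (rule nn_integral_mono_AE)
  assume le: "AE x in lborel. f x \<le> h x"
  then show "AE x in lborel. (\<integral>\<^sup>+y. ennreal (f x) * k (x - y) * ennreal (f y) \<partial>lborel) \<le> (\<integral>\<^sup>+y. ennreal (h x) * k (x - y) * ennreal (h y) \<partial>lborel)"
  proof eventually_elim
    case (elim x)
    have "AE y in lborel. ennreal (f x) * k (x - y) * ennreal (f y) \<le> ennreal (h x) * k (x - y) * ennreal (h y)"
      using le by eventually_elim (use elim in \<open>auto intro!: mult_mono ennreal_leI\<close>)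
    then show ?case by (rule nn_integral_mono_AE)
  qed
qed

lemma admissibleD:
  assumes "f \<in> admissible"
  shows "radially_decreasing f" "0 \<le> f x" "f \<in> borel_measurable borel" "(\<integral>\<^sup>+x. ennreal (f x powr p) \<partial>lborel) \<le> 1"
  using assms by (auto simp: admissible_def)

lemma energy_le_majorant: "f \<in> admissible \<Longrightarrow> energy f \<le> energy majorant"
  using AE_lborel_singleton[of 0] by (intro energy_mono, eventually_elim) (rule admissible_le_majorant)

definition best :: ennreal where "best = (SUP f\<in>admissible. energy f)"

lemma best_finite: "best < \<infinity>"
  unfolding best_def by (rule le_less_trans[OF SUP_least energy_majorant]) (rule energy_le_majorant)

text \<open>The normalised indicator of the unit ball is a competitor. Differences of points of the
  ball have norm at most 2, where the decreasing kernel is at least \<open>k e\<close>.\<close>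

lemma best_pos: "0 < best" and admissible_nonempty: "admissible \<noteq> {}"
proof -
  let ?w = "unit_ball_vol (real DIM('a))"
  have w: "?w > 0" by (rule unit_ball_vol_pos) simp
  define c where "c = (1 / ?w) powr (1 / p)"
  define f where "f x = c * indicator (ball 0 1) x" for x :: 'a
  have c: "c > 0" "c powr p = 1 / ?w" using w q ball_vol_nonzero by (simp_all add: c_def powr_powr)
  have [measurable]: "ball (0::'a) 1 \<in> sets borel" by simp
  have fm: "f \<in> borel_measurable borel" unfolding f_def[abs_def] by measurable
  have "(\<integral>\<^sup>+x. ennreal (f x powr p) \<partial>lborel) = (\<integral>\<^sup>+x. ennreal (1 / ?w) * indicator (ball (0::'a) 1) x \<partial>lborel)"
    using q by (intro nn_integral_cong) (auto simp: f_def indicator_def c)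
  also have "\<dots> = 1" using w ball_vol_nonzero by (simp add: nn_integral_cmult_indicator emeasure_ball flip: ennreal_mult)
  finally have "f \<in> admissible"
    using c fm radially_decreasing_indicator_ball(1)[of c 1] by (simp add: admissible_def f_def[abs_def])
  then show "admissible \<noteq> {}" by auto
  obtain e :: 'a where e: "norm e = 2" using vector_choose_size[of 2] by auto
  let ?B = "indicator (ball (0::'a) 1) :: 'a \<Rightarrow> ennreal"
  have "0 < ennreal c * (k e * (ennreal c * ennreal ?w)) * ennreal ?w"
    using c w k_pos[of e] by (simp add: ennreal_zero_less_mult_iff)
  also have "\<dots> = (\<integral>\<^sup>+x. \<integral>\<^sup>+y. (ennreal c * ?B x) * k e * (ennreal c * ?B y) \<partial>lborel \<partial>lborel)"
    using w by (simp add: nn_integral_cmult nn_integral_multc emeasure_ball mult_ac)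
  also have "\<dots> \<le> energy f"
    unfolding energy_def bform_def
  proof (intro nn_integral_mono)
    fix x y
    show "(ennreal c * ?B x) * k e * (ennreal c * ?B y) \<le> ennreal (f x) * k (x - y) * ennreal (f y)"
    proof (cases "norm x < 1 \<and> norm y < 1")
      case True
      then have "norm (x - y) \<le> norm e" using norm_triangle_ineq4[of x y] e by simp
      then show ?thesis using True by (auto simp: f_def intro!: mult_mono k_antimono)
    qed (auto simp: indicator_def)
  qed
  also have "\<dots> \<le> best" unfolding best_def by (rule SUP_upper) fact
  finally show "0 < best" .
qed

text \<open>Dominated convergence is applied twice, with the majorant inside the potential and with
  its energy density outside.\<close>

lemma energy_convergence:
  assumes f: "\<And>j. f j \<in> admissible" and F: "\<And>x. 0 \<le> F x" "F \<in> borel_measurable borel"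
    and lim: "AE x in lborel. (\<lambda>j. f j x) \<longlonglongrightarrow> F x"
  shows "(\<lambda>j. energy (f j)) \<longlonglongrightarrow> energy F"
proof -
  have [measurable]: "f j \<in> borel_measurable borel" "F \<in> borel_measurable borel" for j
    using admissibleD(3)[OF f] F by auto
  let ?G = "\<lambda>h x. \<integral>\<^sup>+y. k (x - y) * ennreal (h y) \<partial>lborel"
  have le: "AE x in lborel. \<forall>j. f j x \<le> majorant x"
    using AE_lborel_singleton[of 0] by eventually_elim (use admissible_le_majorant[OF f] in auto)
  have Fle: "AE x in lborel. F x \<le> majorant x"
    using le lim by eventually_elim (auto intro: LIMSEQ_le_const2)
  have en: "energy h = (\<integral>\<^sup>+x. ennreal (h x) * ?G h x \<partial>lborel)" if [measurable]: "h \<in> borel_measurable borel" for h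
    unfolding energy_def by (rule bform_eq_iterated) auto
  have "AE x in lborel. ennreal (majorant x) * ?G majorant x \<noteq> \<infinity>"
    using energy_majorant unfolding en[OF measurable_majorant] by (intro nn_integral_PInf_AE) auto
  \<comment> \<open>The majorant is positive off the origin and has finite energy, so its potential
    is finite almost everywhere; only at such points is the inner limit dominated.\<close>
  with AE_lborel_singleton[of 0] have Gfin: "AE x in lborel. ?G majorant x < \<top>"
  proof eventually_elim
    case (elim x)
    then show ?case using majorant_pos[of x] by (simp add: ennreal_mult_eq_top_iff less_top)
  qed
  have Glim: "(\<lambda>j. ?G (f j) x) \<longlonglongrightarrow> ?G F x" if "?G majorant x < \<top>" for x
  proof (rule nn_integral_dominated_convergence[where w="\<lambda>y. k (x - y) * ennreal (majorant y)"])
    show "AE y in lborel. k (x - y) * ennreal (f j y) \<le> k (x - y) * ennreal (majorant y)" for j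
      using le by eventually_elim (auto intro!: mult_left_mono ennreal_leI)
    have "AE y in lborel. k (x - y) * ennreal (majorant y) \<noteq> \<infinity>"
      using that by (intro nn_integral_PInf_AE) auto
    with lim AE_lborel_singleton[of 0]
    show "AE y in lborel. (\<lambda>j. k (x - y) * ennreal (f j y)) \<longlonglongrightarrow> k (x - y) * ennreal (F y)"
    proof eventually_elim
      case (elim y)
      then have "k (x - y) \<noteq> \<top>" using majorant_pos[of y] by (auto simp: ennreal_mult_eq_top_iff)
      then show ?case using elim by (intro tendsto_mult_ennreal tendsto_const tendsto_ennrealI) auto
    qed
  qed (use that in auto)
  have Gle: "?G h x \<le> ?G majorant x" if "AE y in lborel. h y \<le> majorant y" for h x
  proof (rule nn_integral_mono_AE)
    show "AE y in lborel. k (x - y) * ennreal (h y) \<le> k (x - y) * ennreal (majorant y)"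
      using that by eventually_elim (auto intro!: mult_left_mono ennreal_leI)
  qed
  show ?thesis
    unfolding en[OF \<open>F \<in> borel_measurable borel\<close>] en[OF \<open>\<And>j. f j \<in> borel_measurable borel\<close>]
  proof (rule nn_integral_dominated_convergence[where w="\<lambda>x. ennreal (majorant x) * ?G majorant x"])
    show "AE x in lborel. ennreal (f j x) * ?G (f j) x \<le> ennreal (majorant x) * ?G majorant x" for j
    proof -
      have AEj: "AE y in lborel. f j y \<le> majorant y" using le by eventually_elim auto
      then show ?thesis
        by eventually_elim (auto intro!: mult_mono ennreal_leI Gle[OF AEj])
    qed
    show "(\<integral>\<^sup>+x. ennreal (majorant x) * ?G majorant x \<partial>lborel) < \<infinity>"
      using energy_majorant unfolding en[OF measurable_majorant] .
    show "AE x in lborel. (\<lambda>j. ennreal (f j x) * ?G (f j) x) \<longlonglongrightarrow> ennreal (F x) * ?G F x"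
      using lim Gfin
    proof eventually_elim
      case (elim x)
      have "?G F x \<noteq> \<top>" using le_less_trans[OF Gle[OF Fle] elim(2)] by simp
      then show ?case using elim Glim by (intro tendsto_mult_ennreal tendsto_ennrealI) auto
    qed
  qed auto
qed

text \<open>The energy passes to the limit exactly, whereas the norm is only lower semicontinuous,
  by Fatou's lemma. This suffices because \<open>admissible\<close> asks for a norm of at most
  1.\<close>

lemma maximizer_exists: "\<exists>F\<in>admissible. energy F = best"
proof -
  obtain g :: "nat \<Rightarrow> ennreal" where g: "incseq g" "range g \<subseteq> energy ` admissible" "best = (SUP i. g i)"
    using ennreal_Sup_countable_SUP[of "energy ` admissible"] admissible_nonempty unfolding best_def by auto
  have "\<exists>f\<in>admissible. energy f = g i" for i
  proof -
    have "g i \<in> energy ` admissible" using g(2) by auto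
    then show ?thesis by (metis imageE)
  qed
  then obtain f where f: "\<And>i. f i \<in> admissible" "\<And>i. energy (f i) = g i" by metis
  obtain r F where r: "strict_mono r" and F0: "\<And>x. 0 \<le> F x" and Frd: "radially_decreasing F"
    and Fm: "F \<in> borel_measurable borel" and lim: "AE x in lborel. (\<lambda>j. f (r j) x) \<longlonglongrightarrow> F x"
    by (rule radially_decreasing_helly[of f majorant, OF admissibleD(1,2)[OF f(1)] admissible_le_majorant[OF f(1)]]) (assumption, rule that)
  have [measurable]: "f i \<in> borel_measurable borel" for i using admissibleD(3)[OF f(1)] .
  have "(\<lambda>j. energy (f (r j))) \<longlonglongrightarrow> energy F"
    by (rule energy_convergence[OF f(1) F0 Fm lim])
  moreover have "(\<lambda>j. energy (f (r j))) \<longlonglongrightarrow> best"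
    using LIMSEQ_subseq_LIMSEQ[OF LIMSEQ_SUP[OF g(1)] r] by (simp add: f(2) g(3) comp_def)
  ultimately have "energy F = best" by (rule LIMSEQ_unique)
  moreover have "(\<integral>\<^sup>+x. ennreal (F x powr p) \<partial>lborel) \<le> 1"
  proof -
    have "(\<integral>\<^sup>+x. ennreal (F x powr p) \<partial>lborel) = (\<integral>\<^sup>+x. liminf (\<lambda>j. ennreal (f (r j) x powr p)) \<partial>lborel)"
    proof (rule nn_integral_cong_AE)
      show "AE x in lborel. ennreal (F x powr p) = liminf (\<lambda>j. ennreal (f (r j) x powr p))"
        using lim
      proof eventually_elim
        case (elim x)
        have "(\<lambda>j. ennreal (f (r j) x powr p)) \<longlonglongrightarrow> ennreal (F x powr p)"
          using elim exponents(1) admissibleD(2)[OF f(1)] by (intro tendsto_ennrealI tendsto_powr') auto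
        from lim_imp_Liminf[OF sequentially_bot this] show ?case by simp
      qed
    qed
    also have "\<dots> \<le> liminf (\<lambda>j. \<integral>\<^sup>+x. ennreal (f (r j) x powr p) \<partial>lborel)"
      by (rule nn_integral_liminf) simp
    also have "\<dots> \<le> liminf (\<lambda>j::nat. 1)"
      using admissibleD(4)[OF f(1)] by (intro Liminf_mono always_eventually) auto
    finally show ?thesis by (simp add: Liminf_const)
  qed
  ultimately show ?thesis using F0 Frd Fm by (auto simp: admissible_def)
qed

section \<open>The Euler-Lagrange equation\<close>

lemma bform_eq_dual:
  assumes [measurable]: "f \<in> borel_measurable borel" "h \<in> borel_measurable borel"
  shows "bform k f h = (\<integral>\<^sup>+x. h x * (\<integral>\<^sup>+y. k (x - y) * f y \<partial>lborel) \<partial>lborel)"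
proof -
  have "bform k f h = (\<integral>\<^sup>+y. \<integral>\<^sup>+x. f x * k (x - y) * h y \<partial>lborel \<partial>lborel)"
    unfolding bform_def by (rule lborel_pair.Fubini') simp
  also have "\<dots> = (\<integral>\<^sup>+y. h y * (\<integral>\<^sup>+x. k (y - x) * f x \<partial>lborel) \<partial>lborel)"
    by (intro nn_integral_cong, subst nn_integral_cmult[symmetric]) (auto intro!: nn_integral_cong simp: mult_ac k_minus)
  finally show ?thesis .
qed

text \<open>This takes the place of the first variation: the pairing of \<open>F\<close> with any
  competitor is at most the mean of the two energies.\<close>

lemma bform_maximizer_le:
  assumes F: "F \<in> admissible" "energy F = best" and h: "h \<in> admissible"
  shows "bform k (\<lambda>x. ennreal (F x)) (\<lambda>x. ennreal (h x)) \<le> best"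
proof -
  let ?B = "bform k (\<lambda>x. ennreal (F x)) (\<lambda>x. ennreal (h x))"
  have [measurable]: "F \<in> borel_measurable borel" "h \<in> borel_measurable borel"
    using admissibleD(3) F h by auto
  have "?B + ?B \<le> energy F + energy h" unfolding energy_def by (rule k_psd) auto
  also have "\<dots> \<le> best + best"
    using F h by (intro add_mono) (auto simp: best_def intro: SUP_upper)
  finally show ?thesis by (simp add: mult_2[symmetric] ennreal_mult_le_mult_iff)
qed

text \<open>Testing the maximality of \<open>F\<close> with the normalised powers of truncations of \<open>k * F\<close>, which are
  admissible, bounds \<open>k * F\<close> in the dual space. Then Young's inequality for \<open>F\<close> and \<open>k * F\<close> is an
  equality after integration, hence almost everywhere.\<close>

lemma euler_lagrange:
  obtains v :: "'a \<Rightarrow> real" and V :: "'a \<Rightarrow> ennreal" and c :: real where "c > 0"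
    "radially_decreasing v" "\<And>x. 0 \<le> v x" "v \<in> borel_measurable borel" "\<And>x. x \<noteq> 0 \<Longrightarrow> V x = ennreal (v x)"
    "(\<integral>\<^sup>+x. ennreal (v x powr (q + 1)) \<partial>lborel) < \<infinity>"
    "\<And>x y. norm x \<le> norm y \<Longrightarrow> V y \<le> V x"
    "\<And>x. 0 < V x"
    "\<And>x. V x = ennreal c * (\<integral>\<^sup>+y. k (x - y) * ennreal (v y powr q) \<partial>lborel)"
proof -
  obtain F where F: "F \<in> admissible" "energy F = best" using maximizer_exists by auto
  note Fd = admissibleD[OF F(1)]
  have [measurable]: "F \<in> borel_measurable borel" by (rule Fd)
  define V where "V x = (\<integral>\<^sup>+y. k (x - y) * ennreal (F y) \<partial>lborel)" for x
  have [measurable]: "V \<in> borel_measurable borel" unfolding V_def[abs_def] by measurable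
  have V_mono: "V y \<le> V x" if "norm x \<le> norm y" for x y
    unfolding V_def
    by (rule radially_decreasing_convolution)
       (use that Fd(1) in \<open>auto intro!: k_antimono ennreal_leI simp: radially_decreasing_def\<close>)
  define L where "L = enn2real best"
  have L: "L > 0" "ennreal L = best"
    using best_pos best_finite by (auto simp: L_def enn2real_positive_iff less_top)
  \<comment> \<open>\<open>enn2real\<close> turns an infinite value into 0; once
    \<open>V_fin\<close> is known this can happen only at the origin.\<close>
  define v where "v x = enn2real (V x)" for x
  \<comment> \<open>Truncating both height and support makes the \<open>L^(q + 1)\<close> norm
    finite and keeps the function radially decreasing.\<close>
  define w where "w j x = enn2real (min (V x) (ennreal (real j))) * indicator (cball 0 (real j)) x" for j :: nat and x :: 'a
  have [measurable]: "cball (0::'a) r \<in> sets borel" for r by simp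
  have wm[measurable]: "w j \<in> borel_measurable borel" for j unfolding w_def[abs_def] by measurable
  have w0: "0 \<le> w j x" for j x by (simp add: w_def)
  have w_le: "w j x \<le> real j" for j x
    using enn2real_mono[of "min (V x) (ennreal (real j))" "ennreal (real j)"] by (auto simp: w_def indicator_def)
  have w_le_V: "ennreal (w j x) \<le> V x" for j x
    by (cases "x \<in> cball 0 (real j)") (auto simp: w_def min_def less_top le_less_trans[OF _ ennreal_less_top])
  have w_rd: "radially_decreasing (w j)" for j
    unfolding radially_decreasing_def
  proof (intro allI impI)
    fix x y :: 'a assume "norm x \<le> norm y"
    then have "enn2real (min (V y) (ennreal (real j))) \<le> enn2real (min (V x) (ennreal (real j)))"
      by (intro enn2real_mono min.mono V_mono) (auto simp: min_less_iff_disj)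
    then show "w j y \<le> w j x" using \<open>norm x \<le> norm y\<close> unfolding w_def by (auto simp: indicator_def)
  qed
  define N where "N j = (\<integral>\<^sup>+x. ennreal (w j x powr (q + 1)) \<partial>lborel)" for j
  have N_fin: "N j < \<infinity>" for j
  proof -
    have "N j \<le> (\<integral>\<^sup>+x. ennreal (real j powr (q + 1)) * indicator (cball 0 (real j)) (x::'a) \<partial>lborel)"
      unfolding N_def
    proof (rule nn_integral_mono)
      fix x :: 'a
      show "ennreal (w j x powr (q + 1)) \<le> ennreal (real j powr (q + 1)) * indicator (cball 0 (real j)) x"
      proof (cases "x \<in> cball 0 (real j)")
        case True
        then show ?thesis using q w_le[of j x] w0[of j x] by (auto intro!: ennreal_leI powr_mono2)
      next
        case False
        then have "w j x = 0" by (simp add: w_def)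
        then show ?thesis using False by simp
      qed
    qed
    also have "\<dots> < \<infinity>" by (simp add: nn_integral_cmult_indicator emeasure_cball ennreal_mult_less_top)
    finally show ?thesis .
  qed
  \<comment> \<open>Normalising \<open>w j powr q\<close> in \<open>L^p\<close> gives the competitor
    \<open>h\<close>. Its pairing with \<open>V\<close> is at least
    \<open>\<nu> powr (1 - 1 / p)\<close>, and \<open>1 - 1 / p = 1 / (q + 1)\<close>, so maximality
    bounds \<open>\<nu>\<close> uniformly in \<open>j\<close>.\<close>
  have N_le: "N j \<le> ennreal (L powr (q + 1))" for j
  proof (cases "N j = 0")
    case False
    define \<nu> where "\<nu> = enn2real (N j)"
    have \<nu>: "\<nu> > 0" "ennreal \<nu> = N j" using N_fin[of j] False by (auto simp: \<nu>_def enn2real_positive_iff zero_less_iff_neq_zero)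
    define h where "h x = \<nu> powr (- (1 / p)) * w j x powr q" for x
    have [measurable]: "h \<in> borel_measurable borel" unfolding h_def[abs_def] by measurable
    have hp: "h x powr p = w j x powr (q + 1) / \<nu>" for x
    proof -
      have "- (1 / p) * p = - 1" "q * p = q + 1" using q by auto
      then have "h x powr p = \<nu> powr (- 1) * w j x powr (q + 1)"
        by (simp only: h_def powr_mult powr_powr)
      then show ?thesis using \<nu>(1) by (simp add: powr_minus_divide)
    qed
    have "(\<integral>\<^sup>+x. ennreal (h x powr p) \<partial>lborel) = (\<integral>\<^sup>+x. ennreal (1 / \<nu>) * ennreal (w j x powr (q + 1)) \<partial>lborel)"
      unfolding hp using \<nu> by (intro nn_integral_cong) (simp flip: ennreal_mult)
    also have "\<dots> = ennreal (1 / \<nu>) * N j" by (simp add: nn_integral_cmult N_def)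
    also have "\<dots> = 1" using \<nu>(1) by (simp add: \<nu>(2)[symmetric] flip: ennreal_mult)
    finally have "h \<in> admissible"
      using w_rd[of j] w0[of j] q by (auto simp: admissible_def h_def radially_decreasing_def intro!: mult_left_mono powr_mono2)
    then have "bform k (\<lambda>x. ennreal (F x)) (\<lambda>x. ennreal (h x)) \<le> ennreal L"
      unfolding L by (rule bform_maximizer_le[OF F])
    moreover have "ennreal (\<nu> powr (1 / (q + 1))) \<le> bform k (\<lambda>x. ennreal (F x)) (\<lambda>x. ennreal (h x))"
    proof -
      have "\<nu> powr (- (1 / p)) * \<nu> = \<nu> powr (- (1 / p) + 1)"
        by (simp only: powr_add powr_one[OF less_imp_le[OF \<nu>(1)]])
      also have "- (1 / p) + 1 = 1 / (q + 1)" using q by (simp add: field_simps)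
      finally have "ennreal (\<nu> powr (1 / (q + 1))) = ennreal (\<nu> powr (- (1 / p)) * \<nu>)" by (simp only:)
      also have "\<dots> = ennreal (\<nu> powr (- (1 / p))) * N j"
        unfolding \<nu>(2)[symmetric] using \<nu>(1) by (intro ennreal_mult) auto
      also have "\<dots> = (\<integral>\<^sup>+x. ennreal (\<nu> powr (- (1 / p))) * ennreal (w j x powr (q + 1)) \<partial>lborel)"
        by (simp add: nn_integral_cmult N_def)
      also have "\<dots> \<le> (\<integral>\<^sup>+x. ennreal (h x) * V x \<partial>lborel)"
      proof (rule nn_integral_mono)
        fix x
        have "w j x powr (q + 1) = w j x powr q * w j x" using w0[of j x] by (simp add: powr_add)
        then have "ennreal (\<nu> powr (- (1 / p))) * ennreal (w j x powr (q + 1)) = ennreal (h x) * ennreal (w j x)"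
          using w0[of j x] by (simp add: h_def mult_ac flip: ennreal_mult)
        also have "\<dots> \<le> ennreal (h x) * V x" by (intro mult_left_mono w_le_V) auto
        finally show "ennreal (\<nu> powr (- (1 / p))) * ennreal (w j x powr (q + 1)) \<le> ennreal (h x) * V x" .
      qed
      also have "\<dots> = bform k (\<lambda>x. ennreal (F x)) (\<lambda>x. ennreal (h x))"
        unfolding V_def by (rule bform_eq_dual[symmetric]) auto
      finally show ?thesis .
    qed
    ultimately have "ennreal (\<nu> powr (1 / (q + 1))) \<le> ennreal L" by (rule order_trans[rotated])
    then have "\<nu> powr (1 / (q + 1)) \<le> L" using L(1) by simp
    then have "(\<nu> powr (1 / (q + 1))) powr (q + 1) \<le> L powr (q + 1)" using q by (intro powr_mono2) auto
    then have "\<nu> \<le> L powr (q + 1)" using q \<nu>(1) by (simp add: powr_powr)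
    then show ?thesis unfolding \<nu>(2)[symmetric] by (rule ennreal_leI)
  qed simp
  \<comment> \<open>An infinite value at \<open>x \<noteq> 0\<close> would spread by monotonicity
    over the ball of radius \<open>norm x\<close>. There \<open>w j\<close> equals \<open>j\<close>
    for large \<open>j\<close>, against the uniform bound \<open>N_le\<close>.\<close>
  have V_fin: "V x < \<infinity>" if x: "x \<noteq> 0" for x
  proof (rule ccontr)
    assume "\<not> V x < \<infinity>"
    then have Vx: "V x = \<top>" by (simp add: less_top[symmetric])
    have V_top: "V y = \<top>" if "norm y \<le> norm x" for y using V_mono[OF that] Vx by (simp add: top_unique)
    define \<kappa> where "\<kappa> = unit_ball_vol (real DIM('a)) * norm x ^ DIM('a)"
    have \<kappa>: "\<kappa> > 0" using x unit_ball_vol_pos[of "real DIM('a)"] by (simp add: \<kappa>_def)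
    obtain j :: nat where j: "max (max 1 (norm x)) ((L powr (q + 1) + 1) / \<kappa>) < real j"
      using reals_Archimedean2 by blast
    have "ennreal (real j powr (q + 1) * \<kappa>) = (\<integral>\<^sup>+y. ennreal (real j powr (q + 1)) * indicator (cball 0 (norm x)) (y::'a) \<partial>lborel)"
      by (simp add: nn_integral_cmult_indicator emeasure_cball ennreal_mult' \<kappa>_def)
    also have "\<dots> \<le> N j" unfolding N_def
    proof (rule nn_integral_mono)
      fix y :: 'a
      show "ennreal (real j powr (q + 1)) * indicator (cball 0 (norm x)) y \<le> ennreal (w j y powr (q + 1))"
        using V_top[of y] j by (auto simp: indicator_def w_def)
    qed
    also have "\<dots> \<le> ennreal (L powr (q + 1))" by (rule N_le)
    finally have "real j powr (q + 1) * \<kappa> \<le> L powr (q + 1)" by simp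
    moreover have "real j * \<kappa> \<le> real j powr (q + 1) * \<kappa>"
      using j q powr_mono[of 1 "q + 1" "real j"] \<kappa> by (intro mult_right_mono) auto
    moreover have "L powr (q + 1) + 1 < real j * \<kappa>" using j \<kappa> by (simp add: field_simps)
    ultimately show False by linarith
  qed
  have Vv: "V x = ennreal (v x)" if "x \<noteq> 0" for x using V_fin[OF that] by (simp add: v_def)
  have v0: "0 \<le> v x" for x by (simp add: v_def)
  have [measurable]: "v \<in> borel_measurable borel" unfolding v_def[abs_def] by measurable
  have v_rd: "radially_decreasing v"
    unfolding radially_decreasing_def v_def using V_mono V_fin by (auto intro!: enn2real_mono)
  have v_int: "(\<integral>\<^sup>+x. ennreal (v x powr (q + 1)) \<partial>lborel) \<le> ennreal (L powr (q + 1))"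
  proof -
    have "(\<integral>\<^sup>+x. ennreal (v x powr (q + 1)) \<partial>lborel) \<le> (\<integral>\<^sup>+x. liminf (\<lambda>j. ennreal (w j x powr (q + 1))) \<partial>lborel)"
    proof (rule nn_integral_mono_AE)
      show "AE x in lborel. ennreal (v x powr (q + 1)) \<le> liminf (\<lambda>j. ennreal (w j x powr (q + 1)))"
        using AE_lborel_singleton[of 0]
      proof eventually_elim
        case (elim x)
        obtain J :: nat where J: "max (v x) (norm x) < real J" using reals_Archimedean2 by blast
        have "w j x = v x" if "j \<ge> J" for j
        proof -
          have "v x \<le> real j" "norm x \<le> real j" using J that by auto
          then show ?thesis using v0[of x] by (simp add: w_def Vv[OF elim] min_def ennreal_leI)
        qed
        then have "eventually (\<lambda>j. ennreal (w j x powr (q + 1)) = ennreal (v x powr (q + 1))) sequentially"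
          by (intro eventually_sequentiallyI[of J]) simp
        from lim_imp_Liminf[OF sequentially_bot tendsto_eventually[OF this]] show ?case by simp
      qed
    qed
    also have "\<dots> \<le> liminf N" unfolding N_def by (rule nn_integral_liminf) simp
    also have "\<dots> \<le> liminf (\<lambda>j::nat. ennreal (L powr (q + 1)))"
      by (intro Liminf_mono always_eventually allI N_le)
    finally show ?thesis by (simp add: Liminf_const)
  qed
  \<comment> \<open>\<open>L\<close> is the energy of \<open>F\<close>, so dividing the potential by
    \<open>L\<close> normalises the pairing to exactly 1.\<close>
  have FV: "(\<integral>\<^sup>+x. ennreal (F x * (v x / L)) \<partial>lborel) = 1"
  proof -
    have "ennreal L = (\<integral>\<^sup>+x. ennreal (F x) * V x \<partial>lborel)"
      unfolding L F(2)[symmetric] energy_def V_def by (rule bform_eq_dual) auto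
    also have "\<dots> = (\<integral>\<^sup>+x. ennreal L * ennreal (F x * (v x / L)) \<partial>lborel)"
    proof (rule nn_integral_cong_AE)
      show "AE x in lborel. ennreal (F x) * V x = ennreal L * ennreal (F x * (v x / L))"
        using AE_lborel_singleton[of 0]
        by eventually_elim (use L(1) Fd(2) v0 in \<open>simp add: Vv flip: ennreal_mult\<close>)
    qed
    also have "\<dots> = ennreal L * (\<integral>\<^sup>+x. ennreal (F x * (v x / L)) \<partial>lborel)" by (simp add: nn_integral_cmult)
    finally have "ennreal L * 1 = ennreal L * (\<integral>\<^sup>+x. ennreal (F x * (v x / L)) \<partial>lborel)" by simp
    then show ?thesis using L(1) by (subst (asm) ennreal_mult_cancel_left) auto
  qed
  \<comment> \<open>The upper bound in Young's inequality for \<open>F\<close> and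
    \<open>v / L\<close>. Both norms are at most 1 and the weights \<open>q / (q + 1)\<close> and
    \<open>1 / (q + 1)\<close> add up to 1, so the integral of \<open>Y\<close> cannot exceed the
    pairing.\<close>
  define Y where "Y x = F x powr p * (q / (q + 1)) + (v x / L) powr (q + 1) / (q + 1)" for x
  have Y_ge: "F x * (v x / L) \<le> Y x" for x
    unfolding Y_def using q Fd(2)[of x] v0[of x] L(1) by (intro Young_strict) auto
  have [measurable]: "Y \<in> borel_measurable borel" unfolding Y_def[abs_def] by measurable
  have Y_int: "(\<integral>\<^sup>+x. ennreal (Y x) \<partial>lborel) \<le> 1"
  proof -
    have "(\<integral>\<^sup>+x. ennreal (Y x) \<partial>lborel) = (\<integral>\<^sup>+x. ennreal (q / (q + 1)) * ennreal (F x powr p) + ennreal (1 / (q + 1) / L powr (q + 1)) * ennreal (v x powr (q + 1)) \<partial>lborel)"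
      using q L(1) v0 by (intro nn_integral_cong) (simp add: Y_def powr_divide field_simps flip: ennreal_mult ennreal_plus)
    also have "\<dots> = ennreal (q / (q + 1)) * (\<integral>\<^sup>+x. ennreal (F x powr p) \<partial>lborel) + ennreal (1 / (q + 1) / L powr (q + 1)) * (\<integral>\<^sup>+x. ennreal (v x powr (q + 1)) \<partial>lborel)"
      by (simp add: nn_integral_add nn_integral_cmult)
    also have "\<dots> \<le> ennreal (q / (q + 1)) * 1 + ennreal (1 / (q + 1) / L powr (q + 1)) * ennreal (L powr (q + 1))"
      by (intro add_mono mult_left_mono Fd(4) v_int) auto
    also have "\<dots> = ennreal (q / (q + 1) + 1 / (q + 1) / L powr (q + 1) * L powr (q + 1))"
      using q by (simp flip: ennreal_mult ennreal_plus)
    also have "q / (q + 1) + 1 / (q + 1) / L powr (q + 1) * L powr (q + 1) = 1"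
      using q L(1) by (simp flip: add_divide_distrib)
    finally show ?thesis by simp
  qed
  have "(\<integral>\<^sup>+x. ennreal (Y x - F x * (v x / L)) \<partial>lborel) = 0"
  proof -
    have "1 + (\<integral>\<^sup>+x. ennreal (Y x - F x * (v x / L)) \<partial>lborel) = (\<integral>\<^sup>+x. ennreal (F x * (v x / L)) + ennreal (Y x - F x * (v x / L)) \<partial>lborel)"
      by (subst nn_integral_add) (simp, simp, simp only: FV)
    also have "\<dots> = (\<integral>\<^sup>+x. ennreal (Y x) \<partial>lborel)"
      using Y_ge Fd(2) v0 L(1) by (intro nn_integral_cong) (simp flip: ennreal_plus)
    finally have "1 + (\<integral>\<^sup>+x. ennreal (Y x - F x * (v x / L)) \<partial>lborel) \<le> 1 + 0" using Y_int by simp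
    then show ?thesis by (subst (asm) ennreal_add_left_cancel_le) auto
  qed
  then have "AE x in lborel. ennreal (Y x - F x * (v x / L)) = 0"
    by (subst (asm) nn_integral_0_iff_AE) auto
  then have F_eq: "AE x in lborel. F x = (v x / L) powr q"
  proof eventually_elim
    case (elim x)
    then have "F x * (v x / L) = Y x" using Y_ge[of x] by (simp add: ennreal_eq_0_iff)
    then show ?case unfolding Y_def using q Fd(2)[of x] v0[of x] L(1) by (intro Young_strict(2)) auto
  qed
  define c where "c = L powr (- q)"
  have V_eq: "V x = ennreal c * (\<integral>\<^sup>+y. k (x - y) * ennreal (v y powr q) \<partial>lborel)" for x
  proof -
    have "V x = (\<integral>\<^sup>+y. ennreal c * (k (x - y) * ennreal (v y powr q)) \<partial>lborel)"
      unfolding V_def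
    proof (rule nn_integral_cong_AE)
      show "AE y in lborel. k (x - y) * ennreal (F y) = ennreal c * (k (x - y) * ennreal (v y powr q))"
        using F_eq
      proof eventually_elim
        case (elim y)
        have "F y = c * v y powr q" unfolding elim c_def using v0[of y] L(1) by (simp add: powr_divide powr_minus_divide)
        then show ?case using L(1) by (simp add: c_def ennreal_mult' mult_ac)
      qed
    qed
    then show ?thesis by (simp add: nn_integral_cmult)
  qed
  have V_pos: "0 < V x" for x
  proof (rule ccontr)
    assume "\<not> 0 < V x"
    then have "AE y in lborel. k (x - y) * ennreal (F y) = 0" by (simp add: V_def nn_integral_0_iff_AE)
    then have "AE y in lborel. F y * (v y / L) = 0"
    proof eventually_elim
      case (elim y)
      then have "ennreal (F y) = 0" using k_pos[of "x - y"] by (auto simp: less_le)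
      then show ?case using Fd(2)[of y] by (simp add: ennreal_eq_0_iff)
    qed
    then have "(\<integral>\<^sup>+x. ennreal (F x * (v x / L)) \<partial>lborel) = 0"
      by (subst nn_integral_0_iff_AE) auto
    then show False using FV by simp
  qed
  show thesis
    by (rule that[of c v V])
       (use L v_rd v0 Vv le_less_trans[OF v_int] V_mono V_eq V_pos in \<open>auto simp: c_def\<close>)
qed

section \<open>Boundedness at the origin\<close>

text \<open>The singularity of \<open>v\<close> is confined to the unit ball, where the power bound
  is inserted; outside, \<open>v\<close> is at most \<open>B\<close> and the integrable kernel
  contributes a constant.\<close>

lemma tail_bound:
  assumes [measurable]: "v \<in> borel_measurable borel" and v0: "\<And>x. 0 \<le> (v x :: real)"
    and "a \<ge> 0" "C \<ge> 0" and near: "\<And>x. x \<noteq> 0 \<Longrightarrow> norm x \<le> 1 \<Longrightarrow> v x \<le> C * norm x powr (- a)"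
    and far: "\<And>x. 1 < norm x \<Longrightarrow> v x \<le> B" and "B \<ge> 0"
  shows "(\<integral>\<^sup>+y. k (x - y) * ennreal (v y powr q) \<partial>lborel)
    \<le> ennreal (C powr q) * (\<integral>\<^sup>+y. k (x - y) * ennreal (indicator (cball 0 1) y * norm y powr (- (q * a))) \<partial>lborel)
      + ennreal (B powr q) * (\<integral>\<^sup>+z. k z \<partial>lborel)"
proof -
  have [measurable]: "cball (0::'a) 1 \<in> sets borel" by simp
  have "(\<integral>\<^sup>+y. k (x - y) * ennreal (v y powr q) \<partial>lborel)
     \<le> (\<integral>\<^sup>+y. ennreal (C powr q) * (k (x - y) * ennreal (indicator (cball 0 1) y * norm y powr (- (q * a)))) + ennreal (B powr q) * k (x - y) \<partial>lborel)"
  proof (rule nn_integral_mono_AE)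
    show "AE y in lborel. k (x - y) * ennreal (v y powr q) \<le>
        ennreal (C powr q) * (k (x - y) * ennreal (indicator (cball 0 1) y * norm y powr (- (q * a)))) + ennreal (B powr q) * k (x - y)"
      using AE_lborel_singleton[of 0]
    proof eventually_elim
      case (elim y)
      show ?case
      proof (cases "norm y \<le> 1")
        case True
        have "v y powr q \<le> (C * norm y powr (- a)) powr q"
          using near[OF elim True] v0 q by (intro powr_mono2) auto
        also have "\<dots> = C powr q * norm y powr (- (q * a))"
          by (simp add: powr_mult powr_powr mult.commute)
        finally have "k (x - y) * ennreal (v y powr q) \<le> k (x - y) * (ennreal (C powr q) * ennreal (norm y powr (- (q * a))))"
          by (intro mult_left_mono) (auto simp: ennreal_leI simp flip: ennreal_mult)
        also have "\<dots> = ennreal (C powr q) * (k (x - y) * ennreal (indicator (cball 0 1) y * norm y powr (- (q * a))))"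
          using True by (simp add: mult_ac)
        also have "\<dots> \<le> \<dots> + ennreal (B powr q) * k (x - y)" by (rule add_increasing2) auto
        finally show ?thesis .
      next
        case False
        then have "v y powr q \<le> B powr q" using far[of y] v0 q by (intro powr_mono2) auto
        then have "k (x - y) * ennreal (v y powr q) \<le> ennreal (B powr q) * k (x - y)"
          by (subst mult.commute) (intro mult_right_mono ennreal_leI, auto)
        then show ?thesis by (simp add: add_increasing)
      qed
    qed
  qed
  also have "\<dots> = ennreal (C powr q) * (\<integral>\<^sup>+y. k (x - y) * ennreal (indicator (cball 0 1) y * norm y powr (- (q * a))) \<partial>lborel)
      + ennreal (B powr q) * (\<integral>\<^sup>+y. k (x - y) \<partial>lborel)"
    by (subst nn_integral_add, measurable, subst (1 2) nn_integral_cmult, measurable)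
  also have "(\<integral>\<^sup>+y. k (x - y) \<partial>lborel) = (\<integral>\<^sup>+z. k z \<partial>lborel)"
    by (rule nn_integral_lborel_reflect) simp
  finally show ?thesis .
qed

text \<open>Every application of the equation improves the exponent of the singularity at the origin by a
  fixed amount, since the starting exponent \<open>n / (q + 1)\<close> lies below the fixed point
  \<open>\<alpha> / (q - 1)\<close> of \<open>a \<mapsto> q a - \<alpha>\<close> precisely when \<open>q\<close> is subcritical.\<close>

lemma bootstrap:
  fixes v :: "'a \<Rightarrow> real" and V :: "'a \<Rightarrow> ennreal" and c :: real
  assumes c: "c > 0" and v: "radially_decreasing v" "\<And>x. 0 \<le> v x" "v \<in> borel_measurable borel"
    and Vv: "\<And>x. x \<noteq> 0 \<Longrightarrow> V x = ennreal (v x)"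
    and fin: "(\<integral>\<^sup>+x. ennreal (v x powr (q + 1)) \<partial>lborel) < \<infinity>"
    and eq: "\<And>x. V x = ennreal c * (\<integral>\<^sup>+y. k (x - y) * ennreal (v y powr q) \<partial>lborel)"
  shows "V 0 < \<infinity>"
proof -
  have [measurable]: "v \<in> borel_measurable borel" by fact
  have [measurable]: "cball (0::'a) 1 \<in> sets borel" by simp
  obtain Ck where Ck: "Ck \<ge> 0" "\<And>z. z \<noteq> 0 \<Longrightarrow> k z \<le> ennreal (Ck * norm z powr (\<alpha> - real DIM('a)))"
    using k_riesz by auto
  define n where "n = real DIM('a)"
  have n: "n > 0" "\<alpha> < n" using \<alpha> by (simp_all add: n_def)
  define a0 where "a0 = n / (q + 1)"
  have sub: "(q - 1) * a0 < \<alpha>" "q * a0 < n" "0 < a0"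
  proof -
    have "q * (n - \<alpha>) < n + \<alpha>" using q \<alpha> by (simp add: n_def field_simps)
    then show "(q - 1) * a0 < \<alpha>" using q n by (simp add: a0_def field_simps)
    show "q * a0 < n" "0 < a0" using q n by (simp_all add: a0_def field_simps)
  qed
  \<comment> \<open>The potential estimate needs an exponent strictly above
    \<open>q * a - \<alpha>\<close>, so each step gives away \<open>\<delta>\<close>. The inner
    minimum keeps the new exponent in the range of \<open>riesz_potential_le\<close>; the last term
    leaves the positive net gain \<open>\<eta>\<close>.\<close>
  define \<delta> where "\<delta> = min (min \<alpha> (n - q * a0)) ((\<alpha> - (q - 1) * a0) / 2)"
  have \<delta>: "0 < \<delta>" "\<delta> \<le> \<alpha>" "q * a0 + \<delta> \<le> n" "\<delta> \<le> (\<alpha> - (q - 1) * a0) / 2"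
    using sub \<alpha> unfolding \<delta>_def by (simp_all only: min_less_iff_conj, auto simp: min_def)
  define \<eta> where "\<eta> = \<alpha> - \<delta> - (q - 1) * a0"
  have \<eta>: "\<eta> > 0" using \<delta>(4) sub(1) unfolding \<eta>_def by (simp add: field_simps)
  obtain e :: 'a where e: "norm e = 1" using vector_choose_size[of 1] by auto
  define B where "B = v e"
  have B: "B \<ge> 0" "1 < norm x \<Longrightarrow> v x \<le> B" for x
    using v(2)[of e] e unfolding B_def by (auto intro!: radially_decreasingD[OF v(1)])
  define P where "P a \<longleftrightarrow> (\<exists>C\<ge>0. \<forall>x. x \<noteq> 0 \<longrightarrow> norm x \<le> 1 \<longrightarrow> v x \<le> C * norm x powr (- a))" for a
  have P0: "P a0"
  proof -
    define M where "M = enn2real (\<integral>\<^sup>+x. ennreal (v x powr (q + 1)) \<partial>lborel)"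
    have "(\<integral>\<^sup>+x. ennreal (v x powr (q + 1)) \<partial>lborel) \<le> ennreal M" "M \<ge> 0"
      using fin by (simp_all add: M_def)
    from radially_decreasing_power_bound[OF v _ this] q
    have "x \<noteq> 0 \<Longrightarrow> v x \<le> (M / unit_ball_vol (real DIM('a))) powr (1 / (q + 1)) * norm x powr (- a0)" for x
      by (simp add: a0_def n_def)
    then show ?thesis unfolding P_def
      by (intro exI[of _ "(M / unit_ball_vol (real DIM('a))) powr (1 / (q + 1))"]) auto
  qed
  let ?K = "\<integral>\<^sup>+z. k z \<partial>lborel"
  have step: "P (q * a - \<alpha> + \<delta>)" if a: "P a" "0 \<le> a" "a \<le> a0" "\<alpha> \<le> q * a" for a
  proof -
    obtain C where C: "C \<ge> 0" "\<And>x. x \<noteq> 0 \<Longrightarrow> norm x \<le> 1 \<Longrightarrow> v x \<le> C * norm x powr (- a)"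
      using a(1) unfolding P_def by auto
    define b' where "b' = q * a - \<alpha> + \<delta>"
    have "q * a \<le> q * a0" using a q by (intro mult_left_mono) auto
    then have b': "0 \<le> b'" "b' \<le> q * a" "q * a - \<alpha> < b'" "b' \<le> real DIM('a) - \<alpha>"
      using a \<delta> by (auto simp: b'_def n_def)
    obtain C' where C': "C' \<ge> 0" "\<And>x. x \<noteq> 0 \<Longrightarrow>
      (\<integral>\<^sup>+y. k (x - y) * ennreal (indicator (cball 0 1) y * norm y powr (- (q * a))) \<partial>lborel) \<le> ennreal (C' * norm x powr (- b'))"
      by (rule riesz_potential_le[OF k_measurable Ck(2,1) b']) (assumption, rule that)
    define Kr where "Kr = enn2real ?K"
    have Kr: "ennreal Kr = ?K" "Kr \<ge> 0" using k_integral by (simp_all add: Kr_def)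
    let ?C = "c * (C powr q * C' + B powr q * Kr)"
    have "v x \<le> ?C * norm x powr (- b')" if x: "x \<noteq> 0" "norm x \<le> 1" for x
    proof -
      have "ennreal (v x) \<le> ennreal c * (ennreal (C powr q) * ennreal (C' * norm x powr (- b')) + ennreal (B powr q) * ennreal Kr)"
        unfolding Vv[OF x(1), symmetric] eq[of x] Kr
        by (rule order_trans[OF mult_left_mono[OF tail_bound[OF v(3,2) a(2) C B(2,1)]]])
           (auto intro!: mult_left_mono add_mono C' x)
      also have "\<dots> = ennreal (c * (C powr q * (C' * norm x powr (- b')) + B powr q * Kr))"
        using c C'(1) Kr(2) by (simp flip: ennreal_mult ennreal_plus)
      finally have "v x \<le> c * (C powr q * (C' * norm x powr (- b')) + B powr q * Kr)"
        using c C' Kr by (subst (asm) ennreal_le_iff) auto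
      also have "\<dots> \<le> c * (C powr q * (C' * norm x powr (- b')) + B powr q * Kr * norm x powr (- b'))"
      proof -
        have "1 \<le> norm x powr (- b')" using powr_mono2'[of "- b'" "norm x" 1] b'(1) x by simp
        then have "B powr q * Kr * 1 \<le> B powr q * Kr * norm x powr (- b')" using Kr by (intro mult_left_mono) auto
        then show ?thesis using c by (intro mult_left_mono add_left_mono) auto
      qed
      also have "\<dots> = ?C * norm x powr (- b')" by (simp add: algebra_simps)
      finally show ?thesis .
    qed
    moreover have "?C \<ge> 0" using c C' Kr by simp
    ultimately show ?thesis unfolding P_def b'_def[symmetric] by blast
  qed
  \<comment> \<open>The iteration stops as soon as \<open>q * a < \<alpha>\<close>. Then the kernel
    times \<open>v powr q\<close> has at the origin a singularity of exponent at most
    \<open>n - \<alpha> + q * a\<close>, which is below \<open>n\<close>, so the potential is finite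
    there.\<close>
  have iter: "\<exists>a. 0 \<le> a \<and> a \<le> a0 \<and> P a \<and> (q * a < \<alpha> \<or> a \<le> a0 - real m * \<eta>)" for m
  proof (induction m)
    case 0
    then show ?case using P0 sub by (intro exI[of _ a0]) auto
  next
    case (Suc m)
    then obtain a where a: "0 \<le> a" "a \<le> a0" "P a" "q * a < \<alpha> \<or> a \<le> a0 - real m * \<eta>" by auto
    show ?case
    proof (cases "q * a < \<alpha>")
      case True
      then show ?thesis using a by auto
    next
      case False
      have "(q - 1) * a \<le> (q - 1) * a0" using a q by (intro mult_left_mono) auto
      then have "q * a - \<alpha> + \<delta> \<le> a - \<eta>" by (simp add: \<eta>_def algebra_simps)
      then show ?thesis using a False step[of a] \<delta>(1) \<eta>
        by (intro exI[of _ "q * a - \<alpha> + \<delta>"]) (auto simp: algebra_simps)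
    qed
  qed
  obtain m :: nat where "a0 / \<eta> < real m" using reals_Archimedean2 by blast
  then have "a0 - real m * \<eta> < 0" using \<eta> by (simp add: field_simps)
  with iter[of m] obtain a where a: "0 \<le> a" "P a" "q * a < \<alpha>" by fastforce
  obtain C where C: "C \<ge> 0" "\<And>x. x \<noteq> 0 \<Longrightarrow> norm x \<le> 1 \<Longrightarrow> v x \<le> C * norm x powr (- a)"
    using a(2) unfolding P_def by auto
  have "(\<integral>\<^sup>+y. k (0 - y) * ennreal (indicator (cball 0 1) y * norm y powr (- (q * a))) \<partial>lborel)
     \<le> (\<integral>\<^sup>+y. ennreal Ck * ennreal (indicator (cball 0 1) y * norm y powr (- (n - \<alpha> + q * a))) \<partial>(lborel :: 'a measure))"
  proof (rule nn_integral_mono_AE)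
    show "AE y in lborel. k (0 - y) * ennreal (indicator (cball 0 1) y * norm y powr (- (q * a)))
      \<le> ennreal Ck * ennreal (indicator (cball 0 1) y * norm y powr (- (n - \<alpha> + q * a)))"
      using AE_lborel_singleton[of 0]
    proof eventually_elim
      case (elim y)
      have "k (0 - y) * ennreal (indicator (cball 0 1) y * norm y powr (- (q * a)))
         \<le> ennreal (Ck * norm y powr (\<alpha> - n)) * ennreal (indicator (cball 0 1) y * norm y powr (- (q * a)))"
        using Ck(2)[of "0 - y"] elim by (intro mult_right_mono) (auto simp: n_def)
      also have "\<dots> = ennreal (Ck * norm y powr (\<alpha> - n) * (indicator (cball 0 1) y * norm y powr (- (q * a))))"
        using Ck by (intro ennreal_mult[symmetric]) auto
      also have "Ck * norm y powr (\<alpha> - n) * (indicator (cball 0 1) y * norm y powr (- (q * a)))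
         = Ck * (indicator (cball 0 1) y * norm y powr (- (n - \<alpha> + q * a)))"
      proof -
        have "norm y powr (- (n - \<alpha> + q * a)) = norm y powr (\<alpha> - n) * norm y powr (- (q * a))"
          by (simp flip: powr_add)
        then show ?thesis by (simp only: mult_ac)
      qed
      also have "ennreal \<dots> = ennreal Ck * ennreal (indicator (cball 0 1) y * norm y powr (- (n - \<alpha> + q * a)))"
        using Ck by (intro ennreal_mult) auto
      finally show ?case .
    qed
  qed
  also have "\<dots> = ennreal Ck * (\<integral>\<^sup>+y. ennreal (indicator (cball 0 1) y * norm y powr (- (n - \<alpha> + q * a))) \<partial>(lborel :: 'a measure))"
    by (rule nn_integral_cmult) measurable
  also have "\<dots> < \<infinity>"
  proof -
    have "0 \<le> q * a" using a q by simp
    then show ?thesis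
      using nn_integral_norm_powr_inside[of "n - \<alpha> + q * a", where 'a='a] a n by (simp add: ennreal_mult_less_top n_def)
  qed
  finally have "(\<integral>\<^sup>+y. k (0 - y) * ennreal (indicator (cball 0 1) y * norm y powr (- (q * a))) \<partial>lborel) < \<infinity>" .
  then have "(\<integral>\<^sup>+y. k (0 - y) * ennreal (v y powr q) \<partial>lborel) < \<infinity>"
    using k_integral by (intro le_less_trans[OF tail_bound[OF v(3,2) a(1) C B(2,1)]]) (simp_all add: ennreal_mult_less_top)
  then show ?thesis unfolding eq by (simp add: ennreal_mult_less_top)
qed

text \<open>Finiteness at the origin bounds the decreasing potential everywhere. The remaining
  constant \<open>c\<close> is removed by scaling, which is possible because the two sides of the
  equation have different degrees.\<close>

theorem bounded_solution_exists:
  obtains u :: "'a \<Rightarrow> real" and M where "u \<in> borel_measurable borel" "\<And>x. 0 < u x" "\<And>x. u x \<le> M"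
    "(\<integral>\<^sup>+x. ennreal (u x powr (q + 1)) \<partial>lborel) < \<infinity>"
    "\<And>x. (\<integral>\<^sup>+y. k (x - y) * ennreal (u y powr q) \<partial>lborel) = ennreal (u x)"
proof -
  obtain v :: "'a \<Rightarrow> real" and V :: "'a \<Rightarrow> ennreal" and c :: real where c: "c > 0"
    and v: "radially_decreasing v" "\<And>x. 0 \<le> v x" "v \<in> borel_measurable borel" and Vv: "\<And>x. x \<noteq> 0 \<Longrightarrow> V x = ennreal (v x)"
    and fin: "(\<integral>\<^sup>+x. ennreal (v x powr (q + 1)) \<partial>lborel) < \<infinity>"
    and V_mono: "\<And>x y. norm x \<le> norm y \<Longrightarrow> V y \<le> V x"
    and V_pos: "\<And>x. 0 < V x"
    and eq: "\<And>x. V x = ennreal c * (\<integral>\<^sup>+y. k (x - y) * ennreal (v y powr q) \<partial>lborel)"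
    by (rule euler_lagrange) blast
  have [measurable]: "v \<in> borel_measurable borel" by fact
  have V0: "V 0 < \<infinity>" by (rule bootstrap[OF c v Vv fin eq])
  have V_fin: "V x < \<infinity>" for x using le_less_trans[OF V_mono[of 0 x] V0] by simp
  \<comment> \<open>The solution of \<open>t powr (q - 1) = c\<close>, so that the factor
    \<open>t powr q\<close> produced by the nonlinearity equals \<open>t * c\<close>.\<close>
  define t where "t = c powr (1 / (q - 1))"
  have t: "t > 0" using c by (simp add: t_def)
  have tc: "t powr q = t * c"
  proof -
    have "t powr (q - 1) = c" using q c by (simp add: t_def powr_powr)
    then show ?thesis using t powr_add[of t 1 "q - 1"] by simp
  qed
  define u where "u x = t * enn2real (V x)" for x
  have uV: "ennreal (u x) = ennreal t * V x" for x
    using V_fin[of x] t by (simp add: u_def ennreal_mult')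
  have u_AE: "AE x in lborel. u x = t * v x"
    using AE_lborel_singleton[of 0] by eventually_elim (simp add: u_def Vv v)
  have [measurable]: "V \<in> borel_measurable borel" unfolding eq[abs_def] by measurable
  show thesis
  proof (rule that[of u "t * enn2real (V 0)"])
    show "u \<in> borel_measurable borel" unfolding u_def[abs_def] by measurable
    show "0 < u x" for x using t V_pos[of x] V_fin[of x] by (simp add: u_def enn2real_positive_iff less_top)
    show "u x \<le> t * enn2real (V 0)" for x
      using t V_mono[of 0 x] V0 unfolding u_def by (intro mult_left_mono enn2real_mono) auto
    have "(\<integral>\<^sup>+x. ennreal (u x powr (q + 1)) \<partial>lborel) = (\<integral>\<^sup>+x. ennreal (t powr (q + 1)) * ennreal (v x powr (q + 1)) \<partial>lborel)"
      by (rule nn_integral_cong_AE, use u_AE in eventually_elim) (use t v in \<open>simp add: powr_mult flip: ennreal_mult\<close>)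
    also have "\<dots> < \<infinity>" using fin by (simp add: nn_integral_cmult ennreal_mult_less_top)
    finally show "(\<integral>\<^sup>+x. ennreal (u x powr (q + 1)) \<partial>lborel) < \<infinity>" .
    show "(\<integral>\<^sup>+y. k (x - y) * ennreal (u y powr q) \<partial>lborel) = ennreal (u x)" for x
    proof -
      have "(\<integral>\<^sup>+y. k (x - y) * ennreal (u y powr q) \<partial>lborel) = (\<integral>\<^sup>+y. ennreal (t powr q) * (k (x - y) * ennreal (v y powr q)) \<partial>lborel)"
        by (rule nn_integral_cong_AE, use u_AE in eventually_elim)
           (use t v in \<open>simp add: powr_mult ennreal_mult' mult_ac\<close>)
      also have "\<dots> = ennreal (t powr q) * (\<integral>\<^sup>+y. k (x - y) * ennreal (v y powr q) \<partial>lborel)"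
        by (rule nn_integral_cmult) simp
      also have "\<dots> = ennreal t * V x"
        unfolding tc eq[of x] using t c by (simp add: ennreal_mult mult.assoc)
      finally show ?thesis by (simp add: uV)
    qed
  qed
qed

end

section \<open>Differentiability of Bessel potentials\<close>

text \<open>The mean value inequality bounds the increments of \<open>F\<close> by \<open>W\<close>
  times the distance, and with the linear term the remainder quotients by \<open>2 * W\<close>.
  Dominated convergence then applies along every sequence tending to \<open>x0\<close>.\<close>

lemma
  fixes F :: "'a::euclidean_space \<Rightarrow> 'b \<Rightarrow> real" and G :: "'a \<Rightarrow> 'b \<Rightarrow> 'a"
  assumes der: "\<And>x \<omega>. \<omega> \<in> space M \<Longrightarrow> ((\<lambda>x. F x \<omega>) has_derivative (\<lambda>h. G x \<omega> \<bullet> h)) (at x)"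
    and F: "\<And>x. integrable M (F x)" and G [measurable]: "\<And>x. G x \<in> borel_measurable M"
    and W: "integrable M W" and le: "\<And>x \<omega>. \<omega> \<in> space M \<Longrightarrow> x \<in> ball x0 1 \<Longrightarrow> norm (G x \<omega>) \<le> W \<omega>"
  shows has_derivative_integral_dominated:
      "((\<lambda>x. LINT \<omega>|M. F x \<omega>) has_derivative (\<lambda>h. (LINT \<omega>|M. G x0 \<omega>) \<bullet> h)) (at x0)"
    and isCont_integral_dominated:
      "(\<And>\<omega>. \<omega> \<in> space M \<Longrightarrow> isCont (\<lambda>x. G x \<omega>) x0) \<Longrightarrow> isCont (\<lambda>x. LINT \<omega>|M. G x \<omega>) x0"
proof -
  have [measurable]: "F x \<in> borel_measurable M" for x using F by auto
  have G_int: "integrable M (G x)" if "x \<in> ball x0 1" for x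
    by (rule Bochner_Integration.integrable_bound[OF W]) (use that le in \<open>auto intro!: AE_I2 order_trans[OF _ abs_ge_self]\<close>)
  have G0: "integrable M (G x0)" by (rule G_int) simp
  have lip: "\<bar>F x \<omega> - F x0 \<omega>\<bar> \<le> W \<omega> * norm (x - x0)" if x: "x \<in> ball x0 1" and \<omega>: "\<omega> \<in> space M" for x \<omega>
  proof -
    have "norm (F x \<omega> - F x0 \<omega>) \<le> W \<omega> * norm (x - x0)"
    proof (rule differentiable_bound[where S="ball x0 1" and f="\<lambda>x. F x \<omega>"])
      show "((\<lambda>x. F x \<omega>) has_derivative (\<lambda>h. G y \<omega> \<bullet> h)) (at y within ball x0 1)" if "y \<in> ball x0 1" for y
        using der[OF \<omega>] by (rule has_derivative_at_withinI)
      show "onorm (\<lambda>h. G y \<omega> \<bullet> h) \<le> W \<omega>" if "y \<in> ball x0 1" for y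
        using le[OF \<omega> that] by (intro onorm_le order_trans[OF Cauchy_Schwarz_ineq2[unfolded real_norm_def[symmetric]]] mult_right_mono) auto
    qed (use x in auto)
    then show ?thesis by simp
  qed
  show "((\<lambda>x. LINT \<omega>|M. F x \<omega>) has_derivative (\<lambda>h. (LINT \<omega>|M. G x0 \<omega>) \<bullet> h)) (at x0)"
    unfolding has_derivative_at2 tendsto_at_iff_sequentially
  proof (intro conjI allI impI)
    show "bounded_linear ((\<bullet>) (LINT \<omega>|M. G x0 \<omega>))" by (rule bounded_linear_inner_right)
    fix X :: "nat \<Rightarrow> 'a"
    assume X: "\<forall>i. X i \<in> UNIV - {x0}" and Xl: "X \<longlonglongrightarrow> x0"
    obtain N where N: "\<And>i. i \<ge> N \<Longrightarrow> X i \<in> ball x0 1"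
      using Xl by (force simp: lim_sequentially dist_commute)
    let ?Q = "\<lambda>i \<omega>. (1 / norm (X i - x0)) * (F (X i) \<omega> - (F x0 \<omega> + G x0 \<omega> \<bullet> (X i - x0)))"
    have eq: "(1 / norm (X i - x0)) *\<^sub>R ((LINT \<omega>|M. F (X i) \<omega>) - ((LINT \<omega>|M. F x0 \<omega>) + (LINT \<omega>|M. G x0 \<omega>) \<bullet> (X i - x0)))
       = (LINT \<omega>|M. ?Q i \<omega>)" for i
      using F G0 by (simp add: Bochner_Integration.integral_diff Bochner_Integration.integral_add)
    have "(\<lambda>i. LINT \<omega>|M. ?Q (i + N) \<omega>) \<longlonglongrightarrow> (LINT \<omega>|M. 0)"
    proof (rule integral_dominated_convergence[where w="\<lambda>\<omega>. 2 * W \<omega>"])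
      show "integrable M (\<lambda>\<omega>. 2 * W \<omega>)" using W by simp
      show "AE \<omega> in M. (\<lambda>i. ?Q (i + N) \<omega>) \<longlonglongrightarrow> 0"
      proof (rule AE_I2)
        fix \<omega> assume "\<omega> \<in> space M"
        from der[OF this, of x0] have "((\<lambda>y. (1 / norm (y - x0)) *\<^sub>R (F y \<omega> - (F x0 \<omega> + G x0 \<omega> \<bullet> (y - x0)))) \<longlongrightarrow> 0) (at x0)"
          unfolding has_derivative_at2 by blast
        then have "(\<lambda>i. ?Q i \<omega>) \<longlonglongrightarrow> 0"
          unfolding tendsto_at_iff_sequentially using X Xl by (auto simp: comp_def)
        then show "(\<lambda>i. ?Q (i + N) \<omega>) \<longlonglongrightarrow> 0" by (rule LIMSEQ_ignore_initial_segment)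
      qed
      show "AE \<omega> in M. norm (?Q (i + N) \<omega>) \<le> 2 * W \<omega>" for i
      proof (rule AE_I2)
        fix \<omega> assume \<omega>: "\<omega> \<in> space M"
        let ?x = "X (i + N)"
        have pos: "norm (?x - x0) > 0" using X by auto
        have "\<bar>F ?x \<omega> - (F x0 \<omega> + G x0 \<omega> \<bullet> (?x - x0))\<bar> \<le> \<bar>F ?x \<omega> - F x0 \<omega>\<bar> + \<bar>G x0 \<omega> \<bullet> (?x - x0)\<bar>" by simp
        also have "\<dots> \<le> W \<omega> * norm (?x - x0) + norm (G x0 \<omega>) * norm (?x - x0)"
          using \<omega> N by (intro add_mono lip Cauchy_Schwarz_ineq2) auto
        also have "\<dots> \<le> W \<omega> * norm (?x - x0) + W \<omega> * norm (?x - x0)"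
          using \<omega> by (intro add_left_mono mult_right_mono le) auto
        finally show "norm (?Q (i + N) \<omega>) \<le> 2 * W \<omega>"
          using pos by (simp add: abs_mult divide_simps mult_ac)
      qed
    qed auto
    then have "(\<lambda>i. LINT \<omega>|M. ?Q i \<omega>) \<longlonglongrightarrow> 0" by (simp add: LIMSEQ_offset)
    then show "((\<lambda>y. (1 / norm (y - x0)) *\<^sub>R ((LINT \<omega>|M. F y \<omega>) - ((LINT \<omega>|M. F x0 \<omega>) + (LINT \<omega>|M. G x0 \<omega>) \<bullet> (y - x0)))) \<circ> X) \<longlonglongrightarrow> 0"
      unfolding comp_def eq .
  qed
  assume cont: "\<And>\<omega>. \<omega> \<in> space M \<Longrightarrow> isCont (\<lambda>x. G x \<omega>) x0"
  show "isCont (\<lambda>x. LINT \<omega>|M. G x \<omega>) x0"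
    unfolding isCont_def tendsto_at_iff_sequentially
  proof (intro allI impI)
    fix X :: "nat \<Rightarrow> 'a"
    assume X: "\<forall>i. X i \<in> UNIV - {x0}" and Xl: "X \<longlonglongrightarrow> x0"
    obtain N where N: "\<And>i. i \<ge> N \<Longrightarrow> X i \<in> ball x0 1"
      using Xl by (force simp: lim_sequentially dist_commute)
    have "(\<lambda>i. LINT \<omega>|M. G (X (i + N)) \<omega>) \<longlonglongrightarrow> (LINT \<omega>|M. G x0 \<omega>)"
    proof (rule integral_dominated_convergence[where w=W])
      show "AE \<omega> in M. (\<lambda>i. G (X (i + N)) \<omega>) \<longlonglongrightarrow> G x0 \<omega>"
        using cont Xl by (intro AE_I2 LIMSEQ_ignore_initial_segment isCont_tendsto_compose[where g="\<lambda>x. G x _"]) auto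
      show "AE \<omega> in M. norm (G (X (i + N)) \<omega>) \<le> W \<omega>" for i
        using N by (intro AE_I2 le) auto
    qed (use W in auto)
    then show "((\<lambda>x. LINT \<omega>|M. G x \<omega>) \<circ> X) \<longlonglongrightarrow> (LINT \<omega>|M. G x0 \<omega>)"
      unfolding comp_def by (rule LIMSEQ_offset)
  qed
qed

section \<open>Gradient bounds for Gaussian averages\<close>

definition gauss_grad :: "real \<Rightarrow> 'a::euclidean_space \<Rightarrow> 'a" where
  "gauss_grad s z = (- (2 * pi / s) * gauss s z) *\<^sub>R z"

lemma measurable_gauss_grad [measurable]:
  fixes f :: "'b \<Rightarrow> 'a::euclidean_space"
  assumes [measurable]: "f \<in> borel_measurable M" "h \<in> borel_measurable M"
  shows "(\<lambda>x. gauss_grad (h x) (f x)) \<in> borel_measurable M"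
  unfolding gauss_grad_def by measurable

lemma gauss_has_derivative:
  fixes z :: "'a::euclidean_space"
  assumes "s > 0"
  shows "(gauss s has_derivative (\<lambda>h. gauss_grad s z \<bullet> h)) (at z)"
proof -
  have "((\<lambda>z. exp (- (pi * (z \<bullet> z) / s))) has_derivative (\<lambda>h. exp (- (pi * (z \<bullet> z) / s)) * (- (pi * (z \<bullet> h + h \<bullet> z) / s)))) (at z)"
    using assms by (auto intro!: derivative_eq_intros)
  then show ?thesis
    unfolding gauss_def[abs_def] gauss_grad_def power2_norm_eq_inner
    by (rule has_derivative_eq_rhs) (auto simp: fun_eq_iff inner_commute gauss_def power2_norm_eq_inner)
qed

text \<open>Half of the Gaussian exponent absorbs the factor \<open>norm z\<close>; in the scaled
  variable this is \<open>t * exp (- (pi * t^2 / 2)) \<le> 1\<close>. The price is a wider Gaussian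
  and the factor \<open>s powr (- 1 / 2)\<close>.\<close>

lemma norm_gauss_grad_le:
  fixes z :: "'a::euclidean_space"
  assumes s: "s > 0"
  shows "norm (gauss_grad s z) \<le> 2 * pi * s powr (- 1 / 2) * gauss (2 * s) z"
proof -
  define t where "t = norm z / sqrt s"
  have nz: "norm z = sqrt s * t" "t \<ge> 0" using s by (simp_all add: t_def)
  have "t \<le> 1 + t\<^sup>2" using zero_le_power2[of "t - 1"] nz(2) by (simp add: power2_eq_square algebra_simps)
  also have "\<dots> \<le> exp (t\<^sup>2)" by (rule exp_ge_add_one_self)
  also have "\<dots> \<le> exp (pi * t\<^sup>2 / 2)" using pi_gt3 mult_right_mono[of 2 pi "t\<^sup>2"] by simp
  finally have t: "t * exp (- (pi * t\<^sup>2 / 2)) \<le> 1" by (simp add: exp_minus divide_simps)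
  have "gauss s z = exp (- (pi * t\<^sup>2))" "gauss (2 * s) z = exp (- (pi * t\<^sup>2 / 2))"
    using s by (simp_all add: gauss_def nz power_mult_distrib)
  then have g: "gauss s z = exp (- (pi * t\<^sup>2 / 2)) * gauss (2 * s) z" by (simp flip: exp_add)
  have "norm (gauss_grad s z) = 2 * pi / s * (gauss s z * norm z)"
    using s by (simp add: gauss_grad_def abs_mult)
  also have "\<dots> = 2 * pi / s * sqrt s * (t * exp (- (pi * t\<^sup>2 / 2))) * gauss (2 * s) z"
    by (simp add: g nz mult_ac)
  also have "\<dots> \<le> 2 * pi / s * sqrt s * 1 * gauss (2 * s) z"
    using s t by (intro mult_right_mono mult_left_mono) auto
  also have "2 * pi / s * sqrt s * 1 = 2 * pi * s powr (- 1 / 2)"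
  proof -
    have "s powr (- 1 / 2) = s powr (- 1) * s powr (1 / 2)" using powr_add[of s "- 1" "1 / 2"] by simp
    also have "s powr (- 1) = 1 / s" using s by (simp add: powr_minus_divide)
    also have "s powr (1 / 2) = sqrt s" using s by (simp add: powr_half_sqrt)
    finally show ?thesis by simp
  qed
  finally show ?thesis .
qed

text \<open>This supplies one dominating function for all centres in a unit ball, using
  \<open>(r + 1)^2 \<le> 2 * r^2 + 2\<close>.\<close>

lemma gauss_shift_le:
  fixes x x0 y :: "'a::euclidean_space"
  assumes s: "s > 0" and x: "x \<in> ball x0 1"
  shows "gauss (2 * s) (x - y) \<le> exp (pi / (2 * s)) * gauss (4 * s) (x0 - y)"
proof -
  have "norm (x0 - y) \<le> norm (x - y) + 1"
    using norm_triangle_ineq[of "x0 - x" "x - y"] x by (simp add: dist_norm)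
  then have "(norm (x0 - y))\<^sup>2 \<le> (norm (x - y) + 1)\<^sup>2" by (intro power_mono) auto
  also have "\<dots> \<le> 2 * (norm (x - y))\<^sup>2 + 2"
    using zero_le_power2[of "norm (x - y) - 1"] by (simp add: power2_eq_square algebra_simps)
  finally have "pi * (norm (x0 - y))\<^sup>2 \<le> pi * (2 * (norm (x - y))\<^sup>2 + 2)" by simp
  then have "- (pi * (norm (x - y))\<^sup>2 / (2 * s)) \<le> pi / (2 * s) + - (pi * (norm (x0 - y))\<^sup>2 / (4 * s))"
    using s by (simp add: field_simps)
  then show ?thesis unfolding gauss_def mult_exp_exp by simp
qed

context
  fixes f :: "'a::euclidean_space \<Rightarrow> real" and B :: real
  assumes f_measurable [measurable]: "f \<in> borel_measurable borel"
    and f_bounds: "\<And>y. 0 \<le> f y" "\<And>y. f y \<le> B"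
begin

lemma integrable_gauss_shift: "s > 0 \<Longrightarrow> integrable lborel (\<lambda>y. gauss s (x - y :: 'a))"
  by (intro integrableI_nonneg) (auto simp: nn_integral_lborel_reflect[where F="\<lambda>z. ennreal (gauss s z)"] nn_integral_gauss)

lemma integral_gauss_shift: "s > 0 \<Longrightarrow> (LINT y|lborel. gauss s (x - y :: 'a)) = s powr (DIM('a) / 2)"
  by (subst integral_eq_nn_integral) (auto simp: nn_integral_lborel_reflect[where F="\<lambda>z. ennreal (gauss s z)"] nn_integral_gauss)

lemma B_nonneg: "0 \<le> B" using f_bounds[of 0] by linarith

lemma
  assumes s: "s > 0"
  shows integrable_heat: "integrable lborel (\<lambda>y. gauss s (x - y) * f y)"
    and heat_has_derivative: "((\<lambda>x. LINT y|lborel. gauss s (x - y) * f y) has_derivative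
      (\<lambda>h. (LINT y|lborel. f y *\<^sub>R gauss_grad s (x - y)) \<bullet> h)) (at x)"
    and heat_grad_isCont: "isCont (\<lambda>x. LINT y|lborel. f y *\<^sub>R gauss_grad s (x - y)) x"
    and norm_heat_grad_le: "norm (LINT y|lborel. f y *\<^sub>R gauss_grad s (x - y)) \<le> 2 * pi * B * (s powr (- 1 / 2) * (2 * s) powr (DIM('a) / 2))"
    and heat_le: "\<bar>LINT y|lborel. gauss s (x - y) * f y\<bar> \<le> B * s powr (DIM('a) / 2)"
proof -
  show i: "integrable lborel (\<lambda>y. gauss s (x - y) * f y)" for x
    by (rule Bochner_Integration.integrable_bound[OF integrable_mult_right[OF integrable_gauss_shift[OF s, of x], of B]])
       (use f_bounds B_nonneg in \<open>auto simp: abs_mult mult.commute[of B] intro!: mult_left_mono\<close>)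
  have der: "((\<lambda>x. gauss s (x - y) * f y) has_derivative (\<lambda>h. (f y *\<^sub>R gauss_grad s (x - y)) \<bullet> h)) (at x)" for x y
  proof -
    have "((\<lambda>x. gauss s (x - y)) has_derivative (\<lambda>h. gauss_grad s (x - y) \<bullet> h)) (at x)"
      by (rule has_derivative_compose[where f="\<lambda>x. x - y" and g="gauss s", OF _ gauss_has_derivative[OF s]])
         (auto intro!: derivative_eq_intros)
    from has_derivative_mult_left[OF this, of "f y"] show ?thesis by (simp add: mult.commute)
  qed
  have le: "norm (f y *\<^sub>R gauss_grad s (x - y)) \<le> B * (2 * pi * s powr (- 1 / 2) * gauss (2 * s) (x - y))" for x y
    using f_bounds[of y] B_nonneg unfolding norm_scaleR by (intro mult_mono norm_gauss_grad_le s) auto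
  define C where "C = B * (2 * pi * s powr (- 1 / 2) * exp (pi / (2 * s)))"
  have W: "integrable lborel (\<lambda>y. C * gauss (4 * s) (x - y))"
    using s by (intro integrable_mult_right integrable_gauss_shift) auto
  have leW: "norm (f y *\<^sub>R gauss_grad s (x' - y)) \<le> C * gauss (4 * s) (x - y)" if "x' \<in> ball x 1" for x' y
  proof -
    have "B * (2 * pi * s powr (- 1 / 2) * gauss (2 * s) (x' - y)) \<le> B * (2 * pi * s powr (- 1 / 2) * (exp (pi / (2 * s)) * gauss (4 * s) (x - y)))"
      using B_nonneg by (intro mult_left_mono gauss_shift_le s that) auto
    from order_trans[OF le[of y x'] this] show ?thesis unfolding C_def mult.assoc .
  qed
  show "((\<lambda>x. LINT y|lborel. gauss s (x - y) * f y) has_derivative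
      (\<lambda>h. (LINT y|lborel. f y *\<^sub>R gauss_grad s (x - y)) \<bullet> h)) (at x)"
    by (rule has_derivative_integral_dominated[OF der i _ W leW]) auto
  show "isCont (\<lambda>x. LINT y|lborel. f y *\<^sub>R gauss_grad s (x - y)) x"
  proof (rule isCont_integral_dominated[OF der i _ W leW])
    show "isCont (\<lambda>x. f y *\<^sub>R gauss_grad s (x - y)) x" for y
      unfolding gauss_grad_def gauss_def by (intro continuous_intros) (use s in auto)
  qed auto
  have "norm (LINT y|lborel. f y *\<^sub>R gauss_grad s (x - y)) \<le> (LINT y|lborel. B * (2 * pi * s powr (- 1 / 2) * gauss (2 * s) (x - y)))"
    by (rule order_trans[OF integral_norm_bound], rule integral_mono')
       (use s le B_nonneg integrable_gauss_shift[of "2 * s" x] in auto)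
  also have "\<dots> = 2 * pi * B * (s powr (- 1 / 2) * (2 * s) powr (DIM('a) / 2))"
    using s by (simp add: integral_gauss_shift)
  finally show "norm (LINT y|lborel. f y *\<^sub>R gauss_grad s (x - y)) \<le> 2 * pi * B * (s powr (- 1 / 2) * (2 * s) powr (DIM('a) / 2))" .
  have "\<bar>LINT y|lborel. gauss s (x - y) * f y\<bar> = (LINT y|lborel. gauss s (x - y) * f y)"
    using f_bounds by (intro abs_of_nonneg integral_nonneg_AE AE_I2 mult_nonneg_nonneg) auto
  also have "\<dots> \<le> (LINT y|lborel. gauss s (x - y) * B)"
    using f_bounds s by (intro integral_mono i integrable_mult_left integrable_gauss_shift mult_left_mono) auto
  also have "\<dots> = B * s powr (DIM('a) / 2)" using s by (simp add: integral_gauss_shift)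
  finally show "\<bar>LINT y|lborel. gauss s (x - y) * f y\<bar> \<le> B * s powr (DIM('a) / 2)" .
qed

text \<open>Passing from order \<open>\<alpha>\<close> to order \<open>\<beta>\<close> changes the
  weight only by a power of \<open>s\<close> and a constant, and at order \<open>\<beta>\<close> the
  integral is the total mass of the kernel.\<close>

lemma integrable_bessel_weight_powr:
  assumes "\<beta> > 0" "\<alpha> > 0"
  shows "integrable lborel (\<lambda>s. bessel_weight n \<alpha> s * s powr ((n + \<beta> - \<alpha>) / 2))"
proof -
  define D where "D a = (4 * pi) powr (a / 2) * Gamma (a / 2)" for a :: real
  have D: "D \<beta> > 0" "D \<alpha> > 0" using assms by (simp_all add: D_def Gamma_real_pos)
  have "(\<integral>\<^sup>+s. ennreal (bessel_weight n \<beta> s * s powr (n / 2)) \<partial>lborel) = 1"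
    using nn_integral_bessel_weight_exp[OF assms(1), of 0 n] bessel_weight_nonneg[OF assms(1)] by (simp add: ennreal_mult')
  then have i: "integrable lborel (\<lambda>s. bessel_weight n \<beta> s * s powr (n / 2))"
    using bessel_weight_nonneg[OF assms(1)] by (intro integrableI_nonneg) auto
  have "bessel_weight n \<alpha> s * s powr ((n + \<beta> - \<alpha>) / 2) = D \<beta> / D \<alpha> * (bessel_weight n \<beta> s * s powr (n / 2))" for s
  proof (cases "s > 0")
    case True
    have "s powr ((\<alpha> - n) / 2 - 1) * s powr ((n + \<beta> - \<alpha>) / 2) = s powr ((\<beta> - n) / 2 - 1) * s powr (n / 2)"
      unfolding powr_add[symmetric] by (rule arg_cong[where f="(powr) s"]) (simp add: field_simps)
    then show ?thesis using True D unfolding bessel_weight_def D_def[symmetric] by (simp add: mult_ac)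
  qed (simp add: bessel_weight_0)
  then show ?thesis using i by simp
qed

text \<open>Differentiating a Gaussian average costs \<open>s powr (- 1 / 2)\<close>, which amounts
  to lowering the order of the weight by 1. The dominating function \<open>W\<close> is thus
  integrable because \<open>\<alpha> - 1\<close> is positive.\<close>

theorem bessel_potential_C1:
  assumes \<alpha>: "\<alpha> > 1" and u: "\<And>x. (\<integral>\<^sup>+y. bessel_kernel \<alpha> (x - y) * ennreal (f y) \<partial>lborel) = ennreal (u x)" and u0: "\<And>x. 0 \<le> u x"
  shows "is_C1 u"
proof -
  let ?w = "bessel_weight DIM('a) \<alpha>"
  let ?P = "\<lambda>s x. LINT y|lborel. gauss s (x - y) * f y"
  let ?Q = "\<lambda>s x. LINT y|lborel. f y *\<^sub>R gauss_grad s (x - y)"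
  have \<alpha>0: "\<alpha> > 0" using \<alpha> by simp
  note w0 = bessel_weight_nonneg[OF \<alpha>0]
  have P0: "0 \<le> ?P s x" for s x
    using f_bounds by (intro integral_nonneg_AE AE_I2) auto
  have ueq: "u x = (LINT s|lborel. ?w s * ?P s x)" for x
  proof -
    have "ennreal (u x) = (\<integral>\<^sup>+y. \<integral>\<^sup>+s. ennreal (?w s) * (ennreal (gauss s (x - y)) * ennreal (f y)) \<partial>lborel \<partial>lborel)"
      unfolding u[symmetric] bessel_kernel_def by (simp add: nn_integral_multc[symmetric] mult.assoc)
    also have "\<dots> = (\<integral>\<^sup>+s. \<integral>\<^sup>+y. ennreal (?w s) * (ennreal (gauss s (x - y)) * ennreal (f y)) \<partial>lborel \<partial>lborel)"
      by (rule lborel_pair.Fubini') simp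
    also have "\<dots> = (\<integral>\<^sup>+s. ennreal (?w s * ?P s x) \<partial>lborel)"
    proof (rule nn_integral_cong)
      fix s :: real
      show "(\<integral>\<^sup>+y. ennreal (?w s) * (ennreal (gauss s (x - y)) * ennreal (f y)) \<partial>lborel) = ennreal (?w s * ?P s x)"
      proof (cases "s > 0")
        case True
        have "(\<integral>\<^sup>+y. ennreal (gauss s (x - y) * f y) \<partial>lborel) = ennreal (?P s x)"
          by (rule nn_integral_eq_integral[OF integrable_heat[OF True]]) (use f_bounds in auto)
        then show ?thesis using w0 f_bounds P0 by (simp add: nn_integral_cmult ennreal_mult)
      qed (simp add: bessel_weight_0)
    qed
    finally have eq: "ennreal (u x) = (\<integral>\<^sup>+s. ennreal (?w s * ?P s x) \<partial>lborel)" .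
    have "(LINT s|lborel. ?w s * ?P s x) = enn2real (\<integral>\<^sup>+s. ennreal (?w s * ?P s x) \<partial>lborel)"
      using w0 P0 by (intro integral_eq_nn_integral) auto
    then show ?thesis unfolding eq[symmetric] using u0[of x] by simp
  qed
  have der: "((\<lambda>x. ?w s * ?P s x) has_derivative (\<lambda>h. (?w s *\<^sub>R ?Q s x) \<bullet> h)) (at x)" for s x
  proof (cases "s > 0")
    case True
    from has_derivative_mult_right[OF heat_has_derivative[OF True, of x], of "?w s"] show ?thesis by simp
  qed (simp add: bessel_weight_0)
  have int: "integrable lborel (\<lambda>s. ?w s * ?P s x)" for x
  proof (rule Bochner_Integration.integrable_bound)
    show "integrable lborel (\<lambda>s. B * (?w s * s powr ((DIM('a) + \<alpha> - \<alpha>) / 2)))"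
      by (intro integrable_mult_right integrable_bessel_weight_powr \<alpha>0)
    show "AE s in lborel. norm (?w s * ?P s x) \<le> norm (B * (?w s * s powr ((DIM('a) + \<alpha> - \<alpha>) / 2)))"
    proof (rule AE_I2)
      fix s :: real
      show "norm (?w s * ?P s x) \<le> norm (B * (?w s * s powr ((DIM('a) + \<alpha> - \<alpha>) / 2)))"
      proof (cases "s > 0")
        case True
        then show ?thesis using mult_left_mono[OF heat_le[OF True, of x] w0[of _ s]] w0 B_nonneg
          by (simp add: abs_mult mult_ac)
      qed (simp add: bessel_weight_0)
    qed
  qed simp
  define W where "W s = 2 * pi * B * 2 powr (DIM('a) / 2) * (?w s * s powr ((DIM('a) + (\<alpha> - 1) - \<alpha>) / 2))" for s
  have W: "integrable lborel W"
    unfolding W_def using \<alpha> by (intro integrable_mult_right integrable_bessel_weight_powr) auto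
  have leW: "norm (?w s *\<^sub>R ?Q s x) \<le> W s" for s x
  proof (cases "s > 0")
    case True
    have "s powr (- 1 / 2) * s powr (DIM('a) / 2) = s powr ((DIM('a) + (\<alpha> - 1) - \<alpha>) / 2)"
      unfolding powr_add[symmetric] by (rule arg_cong[where f="(powr) s"]) (simp add: field_simps)
    then have "s powr (- 1 / 2) * (2 * s) powr (DIM('a) / 2) = 2 powr (DIM('a) / 2) * s powr ((DIM('a) + (\<alpha> - 1) - \<alpha>) / 2)"
      using True by (simp add: powr_mult)
    then show ?thesis
      using mult_left_mono[OF norm_heat_grad_le[OF True, of x] w0[of _ s]] w0 by (simp add: W_def mult_ac)
  qed (simp add: bessel_weight_0 W_def)
  have gm: "(\<lambda>s. ?w s *\<^sub>R ?Q s x) \<in> borel_measurable lborel" for x by simp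
  have D: "(u has_derivative (\<lambda>h. (LINT s|lborel. ?w s *\<^sub>R ?Q s x) \<bullet> h)) (at x)" for x
    unfolding ueq[abs_def]
    by (rule has_derivative_integral_dominated[OF der int gm W leW])
  have C: "isCont (\<lambda>x. LINT s|lborel. ?w s *\<^sub>R ?Q s x) x" for x
  proof (rule isCont_integral_dominated[OF der int gm W leW])
    show "isCont (\<lambda>x. ?w s *\<^sub>R ?Q s x) x" for s
      using heat_grad_isCont[of s x] by (cases "s > 0") (auto intro!: continuous_intros simp: bessel_weight_0)
  qed
  show ?thesis
    unfolding is_C1_def
  proof (intro exI conjI allI)
    show "(u has_derivative blinfun_apply (blinfun_inner_right (LINT s|lborel. ?w s *\<^sub>R ?Q s x))) (at x)" for x
      using D[of x] by (rule has_derivative_eq_rhs) (auto simp: fun_eq_iff)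
    show "continuous_on UNIV (\<lambda>x. blinfun_inner_right (LINT s|lborel. ?w s *\<^sub>R ?Q s x))"
      using C by (intro bounded_linear.continuous_on[OF bounded_linear_blinfun_inner_right] continuous_at_imp_continuous_on) auto
  qed
qed

end

section \<open>The Pohozaev identity\<close>

lemma tendsto_powr_exp_at_top:
  "((\<lambda>s::real. s powr a * exp (- s / (4 * pi))) \<longlongrightarrow> 0) at_top"
  by real_asymp

lemma tendsto_powr_exp_inverse_at_right:
  assumes "r > 0"
  shows "((\<lambda>s::real. s powr a * exp (- (pi * r / s))) \<longlongrightarrow> 0) (at_right 0)"
  using assms by real_asymp

text \<open>The additional factor of \<open>s\<close> raises the order by 2: for positive \<alpha>
  this is \<open>\<alpha>\<close> times the Bessel kernel of order
  \<open>\<alpha> + 2\<close>.\<close>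

definition bessel_kernel_up :: "real \<Rightarrow> 'a::euclidean_space \<Rightarrow> ennreal" where
  "bessel_kernel_up \<alpha> z = (\<integral>\<^sup>+s. ennreal (bessel_weight DIM('a) \<alpha> s * (s / (2 * pi)) * gauss s z) \<partial>lborel)"

lemma measurable_bessel_kernel_up [measurable]: "bessel_kernel_up \<alpha> \<in> borel_measurable borel"
  unfolding bessel_kernel_up_def[abs_def] by measurable

lemma bessel_kernel_up_pos: "\<alpha> > 0 \<Longrightarrow> 0 < bessel_kernel_up \<alpha> z"
  unfolding bessel_kernel_up_def
  using bessel_weight_pos[of \<alpha>] by (intro nn_integral_pos) auto

text \<open>The factor \<open>s\<close> is harmless for \<open>s \<le> 1\<close> and bounded by a
  moment of the weight for \<open>s > 1\<close>. The factor \<open>1 / s\<close> is absorbed by half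
  of the Gaussian exponent, which amounts to evaluating the kernel at
  \<open>z / sqrt 2\<close>.\<close>

lemma integrable_bessel_kernel_integrands:
  fixes z :: "'a::euclidean_space" and \<alpha> :: real
  assumes \<alpha>: "0 < \<alpha>" "\<alpha> < DIM('a)" and z: "z \<noteq> 0"
  shows "integrable lborel (\<lambda>s. bessel_weight DIM('a) \<alpha> s * gauss s z)"
    and "integrable lborel (\<lambda>s. bessel_weight DIM('a) \<alpha> s * (s / (2 * pi)) * gauss s z)"
    and "integrable lborel (\<lambda>s. bessel_weight DIM('a) \<alpha> s * (2 * pi * (norm z)\<^sup>2 / s) * gauss s z)"
proof -
  let ?w = "bessel_weight DIM('a) \<alpha>"
  note w0 = bessel_weight_nonneg[OF \<alpha>(1)]
  have i: "integrable lborel (\<lambda>s. ?w s * gauss s z)" if "z \<noteq> 0" for z :: 'a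
  proof -
    obtain C where "\<And>z::'a. z \<noteq> 0 \<Longrightarrow> bessel_kernel \<alpha> z \<le> ennreal (C * norm z powr (\<alpha> - DIM('a)))"
      by (rule bessel_kernel_le_riesz[OF \<alpha>]) blast
    from le_less_trans[OF this[OF that] ennreal_less_top] have "(\<integral>\<^sup>+s. ennreal (?w s * gauss s z) \<partial>lborel) < \<infinity>"
      by (simp add: bessel_kernel_def w0 ennreal_mult')
    then show ?thesis using w0 by (intro integrableI_nonneg) auto
  qed
  from this[OF z] show "integrable lborel (\<lambda>s. ?w s * gauss s z)" .
  have j: "integrable lborel (\<lambda>s. ?w s * s powr ((DIM('a) + (\<alpha> + 2) - \<alpha>) / 2))"
    using \<alpha> by (intro integrable_bessel_weight_powr) auto
  show "integrable lborel (\<lambda>s. ?w s * (s / (2 * pi)) * gauss s z)"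
  proof (rule Bochner_Integration.integrable_bound[OF Bochner_Integration.integrable_add[OF i[OF z] j]])
    show "AE s in lborel. norm (?w s * (s / (2 * pi)) * gauss s z) \<le> norm (?w s * gauss s z + ?w s * s powr ((DIM('a) + (\<alpha> + 2) - \<alpha>) / 2))"
    proof (rule AE_I2)
      fix s :: real
      show "norm (?w s * (s / (2 * pi)) * gauss s z) \<le> norm (?w s * gauss s z + ?w s * s powr ((DIM('a) + (\<alpha> + 2) - \<alpha>) / 2))"
      proof (cases "s > 0")
        case True
        have "s / (2 * pi) \<le> s" using True pi_gt3 by (simp add: divide_simps)
        then have "s / (2 * pi) * gauss s z \<le> s * gauss s z" by (intro mult_right_mono) auto
        also have "\<dots> \<le> gauss s z + s powr ((DIM('a) + (\<alpha> + 2) - \<alpha>) / 2)"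
        proof (cases "s \<le> 1")
          case le: True
          then have "s * gauss s z \<le> 1 * gauss s z" by (intro mult_right_mono) auto
          then show ?thesis by (simp add: add_increasing2)
        next
          case False
          then have "s powr 1 \<le> s powr ((DIM('a) + (\<alpha> + 2) - \<alpha>) / 2)" by (intro powr_mono) auto
          moreover have "s * gauss s z \<le> s * 1" using True by (intro mult_left_mono gauss_le_1) auto
          moreover have "s powr 1 = s" using True by simp
          ultimately show ?thesis using gauss_nonneg[of s z] by linarith
        qed
        finally have "?w s * (s / (2 * pi) * gauss s z) \<le> ?w s * (gauss s z + s powr ((DIM('a) + (\<alpha> + 2) - \<alpha>) / 2))"
          by (intro mult_left_mono w0)
        then show ?thesis using True w0[of "DIM('a)" s] by (simp add: abs_mult distrib_left mult.assoc)
      qed (simp add: bessel_weight_0)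
    qed
  qed simp
  define z' where "z' = (1 / sqrt 2) *\<^sub>R z"
  have z': "z' \<noteq> 0" using z by (simp add: z'_def)
  show "integrable lborel (\<lambda>s. ?w s * (2 * pi * (norm z)\<^sup>2 / s) * gauss s z)"
  proof (rule Bochner_Integration.integrable_bound[OF integrable_mult_right[OF i[OF z'], of 4]])
    show "AE s in lborel. norm (?w s * (2 * pi * (norm z)\<^sup>2 / s) * gauss s z) \<le> norm (4 * (?w s * gauss s z'))"
    proof (rule AE_I2)
      fix s :: real
      show "norm (?w s * (2 * pi * (norm z)\<^sup>2 / s) * gauss s z) \<le> norm (4 * (?w s * gauss s z'))"
      proof (cases "s > 0")
        case True
        define t where "t = pi * (norm z)\<^sup>2 / (2 * s)"
        have g: "gauss s z' = exp (- t)" "gauss s z = exp (- t) * exp (- t)"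
          using True by (simp_all add: gauss_def z'_def t_def power_mult_distrib power_divide field_simps flip: exp_add)
        have t0: "t \<ge> 0" using True by (simp add: t_def)
        have "t \<le> exp t" using exp_ge_add_one_self[of t] by linarith
        then have "t * exp (- t) \<le> 1" by (simp add: exp_minus divide_simps)
        then have "4 * (t * exp (- t)) * exp (- t) \<le> 4 * 1 * exp (- t)" by (intro mult_right_mono mult_left_mono) auto
        moreover have "2 * pi * (norm z)\<^sup>2 / s = 4 * t" using True by (simp add: t_def field_simps)
        ultimately have "(2 * pi * (norm z)\<^sup>2 / s) * gauss s z \<le> 4 * gauss s z'" by (simp add: g mult_ac)
        then have "?w s * ((2 * pi * (norm z)\<^sup>2 / s) * gauss s z) \<le> ?w s * (4 * gauss s z')"
          by (intro mult_left_mono w0)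
        then show ?thesis using True w0[of "DIM('a)" s] by (simp add: abs_mult mult_ac)
      qed (simp add: bessel_weight_0)
    qed
  qed simp
qed

text \<open>The function \<open>s \<mapsto> s * bessel_weight n \<alpha> s * gauss s z\<close> vanishes at both ends of \<open>(0, \<infinity>)\<close>, so
  its derivative integrates to zero. This is Euler's identity for the failure of the kernel to be
  homogeneous of degree \<open>\<alpha> - n\<close>.\<close>

lemma bessel_kernel_scaling:
  fixes z :: "'a::euclidean_space" and \<alpha> :: real
  assumes \<alpha>: "0 < \<alpha>" "\<alpha> < DIM('a)" and z: "z \<noteq> 0"
  shows "(\<integral>\<^sup>+s. ennreal (bessel_weight DIM('a) \<alpha> s * (2 * pi * (norm z)\<^sup>2 / s) * gauss s z) \<partial>lborel)
    = ennreal (DIM('a) - \<alpha>) * bessel_kernel \<alpha> z + bessel_kernel_up \<alpha> z"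
proof -
  let ?w = "bessel_weight DIM('a) \<alpha>"
  note w0 = bessel_weight_nonneg[OF \<alpha>(1)]
  note I = integrable_bessel_kernel_integrands[OF \<alpha> z]
  define r where "r = (norm z)\<^sup>2"
  have r: "r > 0" using z by (simp add: r_def)
  define D where "D = (4 * pi) powr (\<alpha> / 2) * Gamma (\<alpha> / 2)"
  have D: "D > 0" using \<alpha> by (simp add: D_def Gamma_real_pos)
  define e where "e = (\<alpha> - DIM('a)) / 2"
  define G where "G s = s powr e * exp (- s / (4 * pi)) * exp (- (pi * r / s)) / D" for s
  \<comment> \<open>\<open>f\<close> is the derivative of \<open>2 * G\<close>: the coefficient of
    the kernel stems from the power \<open>e\<close>, the term with \<open>s / (2 * pi)\<close> from
    the exponential factor of the weight.\<close>
  define f where "f s = ?w s * (2 * pi * (norm z)\<^sup>2 / s) * gauss s z - (DIM('a) - \<alpha>) * (?w s * gauss s z) - ?w s * (s / (2 * pi)) * gauss s z" for s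
  have f_int: "integrable lborel f" unfolding f_def using I by auto
  have wg: "?w s * gauss s z = G s / s" if "s > 0" for s
  proof -
    have "s powr (e - 1) = s powr e / s" using that by (simp add: powr_diff)
    then show ?thesis using that by (simp add: bessel_weight_def gauss_def G_def D_def e_def r_def)
  qed
  have f_eq: "f s = 2 * ((e / s - 1 / (4 * pi) + pi * r / s\<^sup>2) * G s)" if "s > 0" for s
  proof -
    have "f s = (2 * pi * r / s) * (?w s * gauss s z) - (DIM('a) - \<alpha>) * (?w s * gauss s z) - (s / (2 * pi)) * (?w s * gauss s z)"
      by (simp add: f_def r_def mult_ac)
    then show ?thesis unfolding wg[OF that] using that by (simp add: e_def power2_eq_square field_simps)
  qed
  have "(LBINT s=ereal 0..\<infinity>. f s) = 0 - 0"
  proof (rule interval_integral_FTC_integrable[where F="\<lambda>s. 2 * G s"])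
    fix s :: real assume "ereal 0 < ereal s" "ereal s < \<infinity>"
    then have s: "s > 0" by simp
    have "((\<lambda>s. 2 * G s) has_real_derivative f s) (at s)"
      unfolding f_eq[OF s] unfolding G_def using s D
      by (auto intro!: derivative_eq_intros simp: powr_diff power2_eq_square field_simps)
    then show "((\<lambda>s. 2 * G s) has_vector_derivative f s) (at s)"
      by (simp add: has_real_derivative_iff_has_vector_derivative)
    have "isCont (\<lambda>s. 2 * ((e / s - 1 / (4 * pi) + pi * r / s\<^sup>2) * G s)) s"
      unfolding G_def using s D by (intro continuous_intros) auto
    moreover have "eventually (\<lambda>s. f s = 2 * ((e / s - 1 / (4 * pi) + pi * r / s\<^sup>2) * G s)) (nhds s)"
      using eventually_nhds_in_open[of "{0<..}" s] s by (auto elim!: eventually_mono simp: f_eq)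
    ultimately show "isCont f s" by (simp add: isCont_cong)
  next
    show "set_integrable lborel (einterval (ereal 0) \<infinity>) f"
      using f_int unfolding set_integrable_def by (rule integrable_mult_indicator[rotated]) auto
    have "((\<lambda>s. 2 * (exp (- s / (4 * pi)) / D * (s powr e * exp (- (pi * r / s))))) \<longlongrightarrow> 2 * (exp (- 0 / (4 * pi)) / D * 0)) (at_right 0)"
      using D by (intro tendsto_intros tendsto_powr_exp_inverse_at_right[OF r]) auto
    then show "(((\<lambda>s. 2 * G s) \<circ> real_of_ereal) \<longlongrightarrow> 0) (at_right (ereal 0))"
      by (simp add: ereal_tendsto_simps G_def mult_ac)
    have "((\<lambda>s. pi * r / s) \<longlongrightarrow> 0) at_top" by real_asymp
    then have "((\<lambda>s. 2 * ((s powr e * exp (- s / (4 * pi))) * exp (- (pi * r / s)) / D)) \<longlongrightarrow> 2 * (0 * exp (- 0) / D)) at_top"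
      using D by (intro tendsto_intros tendsto_powr_exp_at_top) auto
    then show "(((\<lambda>s. 2 * G s) \<circ> real_of_ereal) \<longlongrightarrow> 0) (at_left \<infinity>)"
      by (simp add: ereal_tendsto_simps G_def)
  qed simp
  moreover have "(LBINT s=ereal 0..\<infinity>. f s) = (LINT s|lborel. f s)"
  proof -
    have "f s = indicator {0<..} s *\<^sub>R f s" for s
      by (cases "s > 0") (auto simp: f_def bessel_weight_0)
    then have "(LINT s|lborel. f s) = (LINT s|lborel. indicator {0<..} s *\<^sub>R f s)"
      by (intro Bochner_Integration.integral_cong refl)
    then show ?thesis
      by (simp add: interval_lebesgue_integral_def set_lebesgue_integral_def)
  qed
  ultimately have "(LINT s|lborel. f s) = 0" by simp
  then have eq: "(LINT s|lborel. ?w s * (2 * pi * (norm z)\<^sup>2 / s) * gauss s z)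
     = (DIM('a) - \<alpha>) * (LINT s|lborel. ?w s * gauss s z) + (LINT s|lborel. ?w s * (s / (2 * pi)) * gauss s z)"
    unfolding f_def using I by simp
  have nn: "0 \<le> ?w s * (s / (2 * pi)) * gauss s z" "0 \<le> ?w s * (2 * pi * (norm z)\<^sup>2 / s) * gauss s z" for s
    using w0 by (cases "s > 0"; simp add: bessel_weight_0)+
  have "(\<integral>\<^sup>+s. ennreal (?w s * (2 * pi * (norm z)\<^sup>2 / s) * gauss s z) \<partial>lborel) = ennreal (LINT s|lborel. ?w s * (2 * pi * (norm z)\<^sup>2 / s) * gauss s z)"
    by (rule nn_integral_eq_integral[OF I(3)]) (use nn in auto)
  also have "\<dots> = ennreal (DIM('a) - \<alpha>) * ennreal (LINT s|lborel. ?w s * gauss s z) + ennreal (LINT s|lborel. ?w s * (s / (2 * pi)) * gauss s z)"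
  proof -
    have A: "0 \<le> (LINT s|lborel. ?w s * gauss s z)"
      using w0 by (intro integral_nonneg_AE AE_I2) auto
    have B: "0 \<le> (LINT s|lborel. ?w s * (s / (2 * pi)) * gauss s z)"
      by (intro integral_nonneg_AE AE_I2 nn)
    have d: "0 \<le> real DIM('a) - \<alpha>" using \<alpha> by simp
    show ?thesis
      unfolding eq by (subst ennreal_plus[OF mult_nonneg_nonneg[OF d A] B]) (simp only: ennreal_mult'[OF d])
  qed
  also have "ennreal (LINT s|lborel. ?w s * gauss s z) = bessel_kernel \<alpha> z"
    unfolding bessel_kernel_def
    by (subst nn_integral_eq_integral[OF I(1), symmetric]) (use w0 in \<open>auto simp: ennreal_mult'\<close>)
  also have "ennreal (LINT s|lborel. ?w s * (s / (2 * pi)) * gauss s z) = bessel_kernel_up \<alpha> z"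
    unfolding bessel_kernel_up_def
    by (subst nn_integral_eq_integral[OF I(2), symmetric]) (use nn in auto)
  finally show ?thesis .
qed

text \<open>Up to a multiple of the kernel itself, only times \<open>s > 1\<close> contribute, and these give a bounded
  integrable kernel.\<close>

lemma bform_bessel_kernel_up_finite:
  fixes f :: "'a::euclidean_space \<Rightarrow> real" and \<alpha> :: real
  assumes \<alpha>: "0 < \<alpha>" and f: "f \<in> borel_measurable borel" "\<And>x. 0 \<le> f x" and p: "1 \<le> p" "p \<le> 2"
    and fp: "(\<integral>\<^sup>+x. ennreal (f x powr p) \<partial>lborel) < \<infinity>"
    and fin: "bform (bessel_kernel \<alpha>) (\<lambda>x. ennreal (f x)) (\<lambda>x. ennreal (f x)) < \<infinity>"
  shows "bform (bessel_kernel_up \<alpha>) (\<lambda>x. ennreal (f x)) (\<lambda>x. ennreal (f x)) < \<infinity>"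
proof -
  let ?w = "bessel_weight DIM('a) \<alpha>"
  note w0 = bessel_weight_nonneg[OF \<alpha>]
  note f(1)[measurable]
  \<comment> \<open>\<open>b\<close> dominates both \<open>c s\<close> and
    \<open>c s * s powr (n / 2)\<close>, so its integral bounds the supremum and the total mass of
    \<open>K\<close> at once.\<close>
  define b where "b s = ?w s * s powr (DIM('a) / 2 + 1)" for s
  have b0: "0 \<le> b s" for s by (simp add: b_def w0)
  have "integrable lborel (\<lambda>s. ?w s * s powr ((DIM('a) + (\<alpha> + 2) - \<alpha>) / 2))"
    using \<alpha> by (intro integrable_bessel_weight_powr) auto
  then have bi: "integrable lborel b" unfolding b_def[abs_def] by (simp add: add_divide_distrib)
  have bfin: "(\<integral>\<^sup>+s. ennreal (b s) \<partial>lborel) < \<infinity>"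
    using bi b0 by (simp add: nn_integral_eq_integral)
  define c where "c s = indicator {1<..} s * ?w s * s" for s
  have c0: "0 \<le> c s" for s by (simp add: c_def w0 indicator_def)
  have [measurable]: "c \<in> borel_measurable borel" unfolding c_def[abs_def] by measurable
  have cb: "c s \<le> b s" "c s * s powr (DIM('a) / 2) \<le> b s" for s
  proof -
    have "s > 1 \<Longrightarrow> s powr 1 \<le> s powr (DIM('a) / 2 + 1)" by (intro powr_mono) auto
    then show "c s \<le> b s" using b0[of s] w0[of "DIM('a)" s] unfolding c_def b_def
      by (auto simp: indicator_def mult_left_mono)
    show "c s * s powr (DIM('a) / 2) \<le> b s" using b0[of s] unfolding c_def b_def
      by (auto simp: indicator_def powr_add)
  qed
  define K where "K z = (\<integral>\<^sup>+s. ennreal (c s) * ennreal (gauss s z) \<partial>lborel)" for z :: 'a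
  have [measurable]: "K \<in> borel_measurable borel" unfolding K_def[abs_def] by measurable
  have K1: "K z \<le> ennreal (enn2real (\<integral>\<^sup>+s. ennreal (b s) \<partial>lborel))" for z
  proof -
    have "K z \<le> (\<integral>\<^sup>+s. ennreal (b s) \<partial>lborel)"
      unfolding K_def
    proof (rule nn_integral_mono)
      fix s
      show "ennreal (c s) * ennreal (gauss s z) \<le> ennreal (b s)"
      proof (cases "s > 0")
        case True
        then have "c s * gauss s z \<le> b s * 1" using cb[of s] gauss_le_1[of s z] b0 by (intro mult_mono) auto
        then show ?thesis by (simp add: ennreal_leI c0 flip: ennreal_mult)
      qed (simp add: c_def)
    qed
    then show ?thesis using bfin by simp
  qed
  have "(\<integral>\<^sup>+z. K z \<partial>lborel) = (\<integral>\<^sup>+s. \<integral>\<^sup>+z. ennreal (c s) * ennreal (gauss s (z::'a)) \<partial>lborel \<partial>lborel)"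
    unfolding K_def by (rule lborel_pair.Fubini') simp
  also have "\<dots> \<le> (\<integral>\<^sup>+s. ennreal (b s) \<partial>lborel)"
  proof (rule nn_integral_mono)
    fix s :: real
    show "(\<integral>\<^sup>+z. ennreal (c s) * ennreal (gauss s (z::'a)) \<partial>lborel) \<le> ennreal (b s)"
    proof (cases "s > 0")
      case True
      then show ?thesis using cb[of s] by (simp add: nn_integral_cmult nn_integral_gauss) (simp add: ennreal_leI c0 flip: ennreal_mult)
    qed (simp add: c_def)
  qed
  finally have K2: "(\<integral>\<^sup>+z. K z \<partial>lborel) < \<infinity>" using bfin by (rule le_less_trans)
  have BK: "bform K (\<lambda>x. ennreal (f x)) (\<lambda>x. ennreal (f x)) < \<infinity>"
    by (rule bform_finite_Lp[OF _ f p fp K1 K2]) simp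
  have up: "bessel_kernel_up \<alpha> z \<le> bessel_kernel \<alpha> z + K z" for z
  proof -
    have "bessel_kernel_up \<alpha> z \<le> (\<integral>\<^sup>+s. ennreal (?w s) * ennreal (gauss s z) + ennreal (c s) * ennreal (gauss s z) \<partial>lborel)"
      unfolding bessel_kernel_up_def
    proof (rule nn_integral_mono)
      fix s
      show "ennreal (?w s * (s / (2 * pi)) * gauss s z) \<le> ennreal (?w s) * ennreal (gauss s z) + ennreal (c s) * ennreal (gauss s z)"
      proof (cases "s > 0")
        case True
        have "s / (2 * pi) \<le> s" using True pi_gt3 by (simp add: divide_simps)
        also have "s \<le> 1 + indicator {1<..} s * s" using True by (auto simp: indicator_def)
        finally have "?w s * (s / (2 * pi)) * gauss s z \<le> ?w s * (1 + indicator {1<..} s * s) * gauss s z"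
          by (intro mult_right_mono mult_left_mono w0) auto
        also have "\<dots> = ?w s * gauss s z + c s * gauss s z" by (simp add: c_def algebra_simps)
        finally show ?thesis by (simp add: ennreal_leI c0 w0 flip: ennreal_mult ennreal_plus)
      qed (simp add: bessel_weight_0)
    qed
    also have "\<dots> = bessel_kernel \<alpha> z + K z"
      unfolding bessel_kernel_def K_def by (rule nn_integral_add) auto
    finally show ?thesis .
  qed
  have "bform (bessel_kernel_up \<alpha>) (\<lambda>x. ennreal (f x)) (\<lambda>x. ennreal (f x))
     \<le> (\<integral>\<^sup>+x. \<integral>\<^sup>+y. ennreal (f x) * bessel_kernel \<alpha> (x - y) * ennreal (f y) + ennreal (f x) * K (x - y) * ennreal (f y) \<partial>lborel \<partial>lborel)"
    unfolding bform_def distrib_left[symmetric] distrib_right[symmetric]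
    by (intro nn_integral_mono mult_right_mono mult_left_mono up) auto
  also have "\<dots> = bform (bessel_kernel \<alpha>) (\<lambda>x. ennreal (f x)) (\<lambda>x. ennreal (f x)) + bform K (\<lambda>x. ennreal (f x)) (\<lambda>x. ennreal (f x))"
    unfolding bform_def by (simp add: nn_integral_add)
  finally show ?thesis using BK fin by (simp add: le_less_trans)
qed

section \<open>The truncated dilation field and the divergence theorem\<close>

text \<open>The outer square makes the cutoff continuously differentiable across the sphere of
  radius \<open>R\<close>. Depending on \<open>x / R\<close> only, it has a gradient whose product
  with \<open>norm x\<close> is bounded independently of \<open>R\<close>.\<close>

definition cutoff :: "real \<Rightarrow> 'a::euclidean_space \<Rightarrow> real" where
  "cutoff R x = (max 0 (1 - (norm x / R)\<^sup>2))\<^sup>2"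

definition cutoff_grad :: "real \<Rightarrow> 'a::euclidean_space \<Rightarrow> 'a" where
  "cutoff_grad R x = (- (4 * max 0 (1 - (norm x / R)\<^sup>2) / R\<^sup>2)) *\<^sub>R x"

lemma has_real_derivative_max_0_power2: "((\<lambda>t::real. (max 0 t)\<^sup>2) has_real_derivative 2 * max 0 t) (at t)"
proof (cases t "0::real" rule: linorder_cases)
  case less
  have "((\<lambda>t::real. 0) has_real_derivative 2 * max 0 t) (at t)" using less by simp
  then show ?thesis
    by (rule has_field_derivative_transform_within_open[where S="{..<0}"]) (use less in auto)
next
  case greater
  have "((\<lambda>t::real. t\<^sup>2) has_real_derivative 2 * max 0 t) (at t)"
    using greater by (auto intro!: derivative_eq_intros)
  then show ?thesis
    by (rule has_field_derivative_transform_within_open[where S="{0<..}"]) (use greater in auto)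
next
  case equal
  have "((\<lambda>h::real. (max 0 h)\<^sup>2 / h) \<longlongrightarrow> 0) (at 0)"
  proof (rule Lim_null_comparison[OF _ tendsto_norm_zero[OF tendsto_ident_at]])
    show "eventually (\<lambda>h::real. norm ((max 0 h)\<^sup>2 / h) \<le> norm h) (at 0)"
      by (intro always_eventually allI) (auto simp: max_def power2_eq_square)
  qed
  then show ?thesis unfolding equal by (simp add: DERIV_def)
qed

lemma cutoff_has_derivative:
  fixes x :: "'a::euclidean_space"
  assumes R: "R > 0"
  shows "(cutoff R has_derivative (\<lambda>h. cutoff_grad R x \<bullet> h)) (at x)"
proof -
  have "((\<lambda>x::'a. 1 - (x \<bullet> x) / R\<^sup>2) has_derivative (\<lambda>h. - (2 * (x \<bullet> h) / R\<^sup>2))) (at x)"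
  proof -
    have "((\<lambda>x::'a. 1 - c * (x \<bullet> x)) has_derivative (\<lambda>h. - (c * (x \<bullet> h + h \<bullet> x)))) (at x)" for c
      by (auto intro!: derivative_eq_intros)
    from this[of "1 / R\<^sup>2"] show ?thesis by (simp add: inner_commute[of _ x])
  qed
  from has_derivative_compose[OF this has_real_derivative_max_0_power2[THEN has_field_derivative_imp_has_derivative]]
  show ?thesis
    unfolding cutoff_def[abs_def] cutoff_grad_def power_divide power2_norm_eq_inner
    by (rule has_derivative_eq_rhs) (auto simp: fun_eq_iff)
qed

lemma
  fixes x :: "'a::euclidean_space"
  assumes R: "R > 0"
  shows cutoff_nonneg: "0 \<le> cutoff R x" and cutoff_le_1: "cutoff R x \<le> 1"
    and cutoff_eq_0: "R \<le> norm x \<Longrightarrow> cutoff R x = 0"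
    and cutoff_grad_eq_0: "R \<le> norm x \<Longrightarrow> cutoff_grad R x = 0"
    and norm_cutoff_grad_le: "norm (cutoff_grad R x) * norm x \<le> 4"
    and isCont_cutoff_grad: "isCont (cutoff_grad R) x"
proof -
  define m where "m = max 0 (1 - (norm x / R)\<^sup>2)"
  have m: "0 \<le> m" "m \<le> 1" by (auto simp: m_def)
  show "0 \<le> cutoff R x" "cutoff R x \<le> 1"
    using m by (auto simp: cutoff_def m_def[symmetric] power_le_one)
  have big: "R \<le> norm x \<Longrightarrow> m = 0"
  proof -
    assume "R \<le> norm x"
    then have "1 \<le> norm x / R" using R by (simp add: divide_simps)
    then have "1\<^sup>2 \<le> (norm x / R)\<^sup>2" by (intro power_mono) auto
    then show "m = 0" by (simp add: m_def)
  qed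
  show "R \<le> norm x \<Longrightarrow> cutoff R x = 0" "R \<le> norm x \<Longrightarrow> cutoff_grad R x = 0"
    using big by (auto simp: cutoff_def cutoff_grad_def m_def[symmetric])
  have "norm (cutoff_grad R x) * norm x = 4 * m * (norm x / R)\<^sup>2"
  proof -
    have "cutoff_grad R x = (- (4 * m / R\<^sup>2)) *\<^sub>R x" by (simp only: cutoff_grad_def m_def)
    then show ?thesis using m R by (simp add: power2_eq_square)
  qed
  also have "\<dots> \<le> 4"
  proof (cases "R \<le> norm x")
    case False
    then have "(norm x / R)\<^sup>2 \<le> 1" using R by (intro power_le_one) auto
    then have "m * (norm x / R)\<^sup>2 \<le> 1 * 1" using m by (intro mult_mono) auto
    then show ?thesis by simp
  qed (simp add: big)
  finally show "norm (cutoff_grad R x) * norm x \<le> 4" .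
  show "isCont (cutoff_grad R) x"
    unfolding cutoff_grad_def[abs_def] using R by (intro continuous_intros) auto
qed

text \<open>The differential is a multiple of the identity of norm at most 1 plus a rank-one term of
  norm at most 4. That the constant does not depend on \<open>R\<close> later gives one dominating
  function for all truncations.\<close>

lemma cutoff_field_lipschitz:
  fixes x y :: "'a::euclidean_space"
  assumes R: "R > 0"
  shows "norm (cutoff R x *\<^sub>R x - cutoff R y *\<^sub>R y) \<le> 5 * norm (x - y)"
proof (rule differentiable_bound[where S=UNIV and f="\<lambda>x. cutoff R x *\<^sub>R x"])
  fix w :: 'a
  show "((\<lambda>x. cutoff R x *\<^sub>R x) has_derivative (\<lambda>h. cutoff R w *\<^sub>R h + (cutoff_grad R w \<bullet> h) *\<^sub>R w)) (at w within UNIV)"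
    by (rule has_derivative_scaleR[OF cutoff_has_derivative[OF R] has_derivative_ident])
  show "onorm (\<lambda>h. cutoff R w *\<^sub>R h + (cutoff_grad R w \<bullet> h) *\<^sub>R w) \<le> 5"
  proof (rule onorm_le)
    fix h
    have "norm (cutoff R w *\<^sub>R h + (cutoff_grad R w \<bullet> h) *\<^sub>R w) \<le> cutoff R w * norm h + \<bar>cutoff_grad R w \<bullet> h\<bar> * norm w"
      using cutoff_nonneg[OF R, of w] by (intro order_trans[OF norm_triangle_ineq]) simp
    also have "\<dots> \<le> 1 * norm h + (norm (cutoff_grad R w) * norm h) * norm w"
      by (intro add_mono mult_right_mono cutoff_le_1[OF R] Cauchy_Schwarz_ineq2) auto
    also have "\<dots> = (1 + norm (cutoff_grad R w) * norm w) * norm h" by (simp add: algebra_simps)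
    also have "\<dots> \<le> 5 * norm h" using norm_cutoff_grad_le[OF R, of w] by (intro mult_right_mono) auto
    finally show "norm (cutoff R w *\<^sub>R h + (cutoff_grad R w \<bullet> h) *\<^sub>R w) \<le> 5 * norm h" .
  qed
qed auto

lemma cutoff_tendsto:
  fixes x :: "'a::euclidean_space"
  shows "(\<lambda>j. cutoff (real (Suc j)) x) \<longlonglongrightarrow> 1"
    and "(\<lambda>j. cutoff_grad (real (Suc j)) x \<bullet> x) \<longlonglongrightarrow> 0"
proof -
  have l: "(\<lambda>j. norm x / real (Suc j)) \<longlonglongrightarrow> 0" by real_asymp
  have "(\<lambda>j. (max 0 (1 - (norm x / real (Suc j))\<^sup>2))\<^sup>2) \<longlonglongrightarrow> (max 0 (1 - 0\<^sup>2))\<^sup>2"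
    by (intro tendsto_intros l)
  then show "(\<lambda>j. cutoff (real (Suc j)) x) \<longlonglongrightarrow> 1" by (simp add: cutoff_def)
  have "(\<lambda>j. - (4 * max 0 (1 - (norm x / real (Suc j))\<^sup>2)) * (norm x / real (Suc j))\<^sup>2) \<longlonglongrightarrow> - (4 * max 0 (1 - 0\<^sup>2)) * 0\<^sup>2"
    by (intro tendsto_intros l)
  then show "(\<lambda>j. cutoff_grad (real (Suc j)) x \<bullet> x) \<longlonglongrightarrow> 0"
    by (simp add: cutoff_grad_def power_divide power2_norm_eq_inner mult_ac)
qed

text \<open>The divergence theorem for the field \<open>x \<mapsto> \<psi> x *\<^sub>R x\<close>, obtained by differentiating
  \<open>t \<mapsto> \<integral> \<psi> (exp t *\<^sub>R x) dx = exp (- n t) * \<integral> \<psi>\<close> at \<open>t = 0\<close>.\<close>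

lemma integral_radial_divergence:
  fixes \<psi> :: "'a::euclidean_space \<Rightarrow> real" and D :: "'a \<Rightarrow> 'a"
  assumes der: "\<And>x. (\<psi> has_derivative (\<lambda>h. D x \<bullet> h)) (at x)" and cont: "continuous_on UNIV D"
    and supp: "\<And>x. R \<le> norm x \<Longrightarrow> \<psi> x = 0 \<and> D x = 0" and R: "R > 0"
  shows "(LINT x|lborel. DIM('a) * \<psi> x + D x \<bullet> x) = 0"
proof -
  have cpsi: "continuous_on UNIV \<psi>"
    using der by (auto intro!: continuous_at_imp_continuous_on has_derivative_continuous)
  have [measurable]: "\<psi> \<in> borel_measurable borel" "D \<in> borel_measurable borel"
    using cpsi cont by (auto intro: borel_measurable_continuous_onI)
  have [measurable]: "cball (0::'a) r \<in> sets borel" for r by simp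
  obtain S where S: "\<And>x. norm x \<le> R \<Longrightarrow> norm (D x) \<le> S"
  proof -
    have "compact (D ` cball 0 R)"
      by (intro compact_continuous_image continuous_on_subset[OF cont]) auto
    then obtain S where "\<forall>v\<in>D ` cball 0 R. norm v \<le> S" using compact_imp_bounded bounded_iff by blast
    then show thesis by (intro that[of S]) auto
  qed
  have S': "norm (D x) \<le> max S 0" for x
    using S[of x] supp[of x] by (cases "norm x \<le> R") auto
  have bi: "integrable lborel (\<lambda>x::'a. indicator (cball 0 r) x :: real)" for r
    by (rule integrable_real_indicator) (simp, rule emeasure_bounded_finite[OF bounded_cball])
  obtain S2 where S2: "\<And>x. norm x \<le> R \<Longrightarrow> norm (\<psi> x) \<le> S2"
  proof -
    have "compact (\<psi> ` cball 0 R)"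
      by (intro compact_continuous_image continuous_on_subset[OF cpsi]) auto
    then obtain S where "\<forall>v\<in>\<psi> ` cball 0 R. norm v \<le> S" using compact_imp_bounded bounded_iff by blast
    then show thesis by (intro that[of S]) auto
  qed
  have psi_int: "integrable lborel \<psi>"
  proof (rule Bochner_Integration.integrable_bound[OF integrable_mult_right[OF bi, of S2 R]])
    show "AE x in lborel. norm (\<psi> x) \<le> norm (S2 * indicator (cball 0 R) x)"
    proof (rule AE_I2)
      fix x show "norm (\<psi> x) \<le> norm (S2 * indicator (cball 0 R) x)"
        using S2[of x] supp[of x] by (cases "norm x \<le> R") auto
    qed
  qed simp
  define F where "F t x = \<psi> (exp t *\<^sub>R x)" for t :: real and x
  define G where "G t x = exp t * (D (exp t *\<^sub>R x) \<bullet> x)" for t :: real and x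
  have Fint: "integrable lborel (F t) \<and> (LINT x|lborel. F t x) = exp (- (DIM('a) * t)) * (LINT x|lborel. \<psi> x)" for t :: real
  proof -
    have e: "lborel = density (distr lborel borel (\<lambda>x::'a. exp t *\<^sub>R x)) (\<lambda>_. ennreal (exp t ^ DIM('a)))"
      using lborel_affine[of "exp t" "0::'a"] by simp
    have "integrable (density (distr lborel borel (\<lambda>x::'a. exp t *\<^sub>R x)) (\<lambda>_. ennreal (exp t ^ DIM('a)))) \<psi>"
      using psi_int e by simp
    then have 1: "integrable lborel (F t)"
      unfolding F_def by (subst (asm) integrable_density) (auto simp: integrable_distr_eq)
    have "(LINT x|lborel. \<psi> x) = exp t ^ DIM('a) * (LINT x|lborel. F t x)"
      by (subst e) (simp add: integral_density integral_distr F_def[abs_def])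
    moreover have "exp t ^ DIM('a) = exp (DIM('a) * t)" by (simp add: exp_of_nat_mult)
    ultimately show ?thesis using 1 by (simp add: exp_minus field_simps)
  qed
  have "((\<lambda>t. LINT x|lborel. F t x) has_derivative (\<lambda>h. (LINT x|lborel. G 0 x) \<bullet> h)) (at 0)"
  proof (rule has_derivative_integral_dominated)
    show "((\<lambda>t. F t x) has_derivative (\<lambda>h. G t x \<bullet> h)) (at t)" for t x
    proof -
      have "((\<lambda>t. exp t *\<^sub>R x) has_derivative (\<lambda>h. (exp t * h) *\<^sub>R x)) (at t)"
        by (auto intro!: derivative_eq_intros)
      from has_derivative_compose[OF this der] show ?thesis
        unfolding F_def G_def by (rule has_derivative_eq_rhs) (auto simp: fun_eq_iff)
    qed
    show "integrable lborel (F t)" for t using Fint by simp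
    show "G t \<in> borel_measurable lborel" for t unfolding G_def[abs_def] by measurable
    \<comment> \<open>For \<open>t\<close> in the unit ball the dilated function vanishes outside
      the ball of radius \<open>exp 1 * R\<close>; inside, the factors of \<open>C\<close> bound
      \<open>exp t\<close>, the field \<open>D\<close> and \<open>norm x\<close>.\<close>
    define C where "C = exp 1 * (max S 0 * (exp 1 * R))"
    show "integrable lborel (\<lambda>x::'a. C * indicator (cball 0 (exp 1 * R)) x)"
      by (intro integrable_mult_right bi)
    fix t x assume "t \<in> ball (0::real) 1"
    then have t: "t \<le> 1" "- t \<le> 1" by (auto simp: dist_real_def)
    show "norm (G t x) \<le> C * indicator (cball 0 (exp 1 * R)) x"
    proof (cases "norm x \<le> exp 1 * R")
      case True
      have "norm (D (exp t *\<^sub>R x) \<bullet> x) \<le> max S 0 * (exp 1 * R)"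
        unfolding real_norm_def using S'[of "exp t *\<^sub>R x"] True R
        by (intro order_trans[OF Cauchy_Schwarz_ineq2] mult_mono) auto
      then have "exp t * norm (D (exp t *\<^sub>R x) \<bullet> x) \<le> C"
        unfolding C_def using t(1) by (intro mult_mono) auto
      then show ?thesis using True by (simp add: G_def abs_mult)
    next
      case False
      have "R = exp t * (exp (- t) * R)" by (simp add: exp_minus)
      also have "\<dots> \<le> exp t * (exp 1 * R)" using t R by (intro mult_left_mono mult_right_mono) auto
      also have "\<dots> \<le> exp t * norm x" using False by (intro mult_left_mono) auto
      finally have "D (exp t *\<^sub>R x) = 0" using supp[of "exp t *\<^sub>R x"] by simp
      then show ?thesis using False by (simp add: G_def)
    qed
  qed
  moreover have "((\<lambda>t. LINT x|lborel. F t x) has_derivative (\<lambda>h. - (DIM('a) * (LINT x|lborel. \<psi> x)) * h)) (at 0)"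
    unfolding Fint[THEN conjunct2] by (auto intro!: derivative_eq_intros)
  ultimately have "(\<lambda>h::real. (LINT x|lborel. G 0 x) \<bullet> h) = (\<lambda>h. - (DIM('a) * (LINT x|lborel. \<psi> x)) * h)"
    by (rule has_derivative_unique)
  from fun_cong[OF this, of 1] have "(LINT x|lborel. D x \<bullet> x) = - (DIM('a) * (LINT x|lborel. \<psi> x))"
    by (simp add: G_def)
  moreover have "integrable lborel (\<lambda>x. D x \<bullet> x)"
  proof (rule Bochner_Integration.integrable_bound[OF integrable_mult_right[OF bi, of "max S 0 * R" R]])
    show "AE x in lborel. norm (D x \<bullet> x) \<le> norm (max S 0 * R * indicator (cball 0 R) x)"
    proof (rule AE_I2)
      fix x show "norm (D x \<bullet> x) \<le> norm (max S 0 * R * indicator (cball 0 R) x)"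
      proof (cases "norm x \<le> R")
        case True
        have "\<bar>D x \<bullet> x\<bar> \<le> max S 0 * R"
          using S'[of x] True R by (intro order_trans[OF Cauchy_Schwarz_ineq2] mult_mono) auto
        then show ?thesis using True by simp
      qed (use supp[of x] in auto)
    qed
  qed simp
  ultimately show ?thesis using psi_int by simp
qed

text \<open>The parameter \<open>s\<close> is a separate first factor: fixing it gives Gaussian
  identities for pairs of points, integrating it out first recovers the kernel.\<close>

interpretation triple: pair_sigma_finite "lborel :: real measure" "lborel \<Otimes>\<^sub>M lborel :: ('a::euclidean_space \<times> 'a) measure"
  by (simp add: pair_sigma_finite_def sigma_finite_lborel lborel_prod)

abbreviation "lborel2 \<equiv> lborel \<Otimes>\<^sub>M lborel"
abbreviation "triple_measure \<equiv> lborel \<Otimes>\<^sub>M lborel2"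

lemma nn_integral_triple:
  fixes \<Phi> :: "real \<times> 'a::euclidean_space \<times> 'a \<Rightarrow> ennreal"
  assumes [measurable]: "\<Phi> \<in> borel_measurable triple_measure"
  shows "(\<integral>\<^sup>+t. \<Phi> t \<partial>triple_measure) = (\<integral>\<^sup>+x. \<integral>\<^sup>+y. \<integral>\<^sup>+s. \<Phi> (s, x, y) \<partial>lborel \<partial>lborel \<partial>lborel)"
proof -
  have "(\<integral>\<^sup>+t. \<Phi> t \<partial>triple_measure) = (\<integral>\<^sup>+p. \<integral>\<^sup>+s. \<Phi> (s, p) \<partial>lborel \<partial>(lborel \<Otimes>\<^sub>M lborel))"
    by (rule triple.nn_integral_snd[symmetric]) simp
  also have "\<dots> = (\<integral>\<^sup>+x. \<integral>\<^sup>+y. \<integral>\<^sup>+s. \<Phi> (s, x, y) \<partial>lborel \<partial>lborel \<partial>lborel)"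
    by (rule lborel.nn_integral_fst[symmetric]) simp
  finally show ?thesis .
qed

lemma continuous_vanishing_bounded:
  fixes h :: "'a::euclidean_space \<Rightarrow> real"
  assumes "continuous_on UNIV h" and "\<And>x. R \<le> norm x \<Longrightarrow> h x = 0"
  obtains C where "\<And>x. \<bar>h x\<bar> \<le> C"
proof -
  have "compact (h ` cball 0 R)"
    by (intro compact_continuous_image continuous_on_subset[OF assms(1)]) auto
  then obtain S where S: "\<forall>v\<in>h ` cball 0 R. norm v \<le> S" using compact_imp_bounded bounded_iff by blast
  show thesis
  proof (rule that[of "max S 0"])
    fix x
    show "\<bar>h x\<bar> \<le> max S 0"
    proof (cases "norm x \<le> R")
      case True
      then have "\<bar>h x\<bar> \<le> S" using S by auto
      then show ?thesis by simp
    qed (use assms(2)[of x] in auto)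
  qed
qed

text \<open>Differentiating a Gaussian produces \<open>2 * pi / s\<close>; averaging over the
  exchange of the two points leaves half of it.\<close>

definition virial_weight :: "real \<Rightarrow> real \<Rightarrow> real \<Rightarrow> real" where
  "virial_weight n \<alpha> s = bessel_weight n \<alpha> s * (pi / s)"

lemma measurable_virial_weight [measurable]: "virial_weight n \<alpha> \<in> borel_measurable borel"
  unfolding virial_weight_def[abs_def] by measurable

lemma virial_weight_nonneg: "\<alpha> > 0 \<Longrightarrow> 0 \<le> virial_weight n \<alpha> s"
  using bessel_weight_nonneg[of \<alpha> n s] by (cases "s > 0") (auto simp: virial_weight_def bessel_weight_0)

section \<open>The identity for a solution\<close>

locale C1_solution =
  fixes u :: "'a::euclidean_space \<Rightarrow> real" and Du :: "'a \<Rightarrow> 'a" and \<alpha> q :: real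
  assumes \<alpha>: "0 < \<alpha>" "\<alpha> < DIM('a)" and q: "1 < q"
    and u_pos: "0 < u x"
    and u_deriv: "(u has_derivative (\<lambda>h. Du x \<bullet> h)) (at x)"
    and Du_cont: "continuous_on UNIV Du"
    and u_int: "(\<integral>\<^sup>+x. ennreal (u x powr (q + 1)) \<partial>lborel) < \<infinity>"
    and u_eq: "(\<integral>\<^sup>+y. bessel_kernel \<alpha> (x - y) * ennreal (u y powr q) \<partial>lborel) = ennreal (u x)"
begin

definition f :: "'a \<Rightarrow> real" where "f x = u x powr q"
definition Df :: "'a \<Rightarrow> 'a" where "Df x = (q * u x powr (q - 1)) *\<^sub>R Du x"

lemma u_nonneg: "0 \<le> u x" using u_pos[of x] by simp

lemma u_nonzero: "u x \<noteq> 0" using u_pos[of x] by simp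

lemma u_cont: "continuous_on UNIV u"
  using u_deriv by (auto intro!: continuous_at_imp_continuous_on has_derivative_continuous)

lemma f_pos: "0 < f x" using u_nonzero by (simp add: f_def)

lemma f_nonneg: "0 \<le> f x" by (simp add: f_def)

lemma u_powr_has_derivative: "((\<lambda>x. u x powr a) has_derivative (\<lambda>h. ((a * u x powr (a - 1)) *\<^sub>R Du x) \<bullet> h)) (at x)"
proof -
  have "((\<lambda>t. t powr a) has_derivative (*) (a * u x powr (a - 1))) (at (u x))"
    using has_real_derivative_powr[OF u_pos[of x], of a] by (simp add: has_field_derivative_def)
  from has_derivative_compose[OF u_deriv this] show ?thesis by simp
qed

lemma f_has_derivative: "(f has_derivative (\<lambda>h. Df x \<bullet> h)) (at x)"
  using u_powr_has_derivative[of q x] by (simp add: f_def[abs_def] Df_def)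

lemma cont_powr: "continuous_on UNIV (\<lambda>x. u x powr a)"
  using u_nonzero by (intro continuous_intros u_cont) auto

lemma f_cont: "continuous_on UNIV f" unfolding f_def[abs_def] by (rule cont_powr)

lemma Df_cont: "continuous_on UNIV Df"
  unfolding Df_def[abs_def] by (intro continuous_intros cont_powr Du_cont)

lemma measurable_uf [measurable]: "u \<in> borel_measurable borel" "f \<in> borel_measurable borel" "Du \<in> borel_measurable borel"
  using u_cont f_cont Du_cont by (auto intro: borel_measurable_continuous_onI)

definition mass :: real where "mass = (LINT x|lborel. u x powr (q + 1))"

lemma integrable_u: "integrable lborel (\<lambda>x. u x powr (q + 1))"
  using u_int by (intro integrableI_nonneg) auto

lemma nn_mass: "(\<integral>\<^sup>+x. ennreal (u x powr (q + 1)) \<partial>lborel) = ennreal mass"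
  unfolding mass_def by (rule nn_integral_eq_integral[OF integrable_u]) simp

lemma mass_pos: "mass > 0"
proof (rule ccontr)
  assume "\<not> mass > 0"
  then have "(\<integral>\<^sup>+x. ennreal (u x powr (q + 1)) \<partial>lborel) = 0" unfolding nn_mass by (simp add: ennreal_eq_0_iff)
  then have "AE x in (lborel :: 'a measure). False"
    by (subst (asm) nn_integral_0_iff_AE) (auto simp: u_nonzero ennreal_eq_0_iff)
  then show False by (simp add: AE_iff_null null_sets_def)
qed

lemma fu: "f x * u x = u x powr (q + 1)" using u_nonneg[of x] by (simp add: f_def powr_add)

text \<open>The equation replaces the potential of \<open>f\<close> by \<open>u\<close>, and
  \<open>f x * u x\<close> is \<open>u x powr (q + 1)\<close>.\<close>

lemma bform_f: "bform (bessel_kernel \<alpha>) (\<lambda>x. ennreal (f x)) (\<lambda>x. ennreal (f x)) = ennreal mass"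
proof -
  have "bform (bessel_kernel \<alpha>) (\<lambda>x. ennreal (f x)) (\<lambda>x. ennreal (f x)) = (\<integral>\<^sup>+x. ennreal (f x) * ennreal (u x) \<partial>lborel)"
    by (subst bform_eq_iterated) (simp_all add: f_def u_eq)
  then show ?thesis using nn_mass f_nonneg u_nonneg by (simp add: fu flip: ennreal_mult)
qed

lemma f_Lp: "(\<integral>\<^sup>+x. ennreal (f x powr ((q + 1) / q)) \<partial>lborel) < \<infinity>"
  using u_int q by (simp add: f_def powr_powr)

lemma exponent: "1 \<le> (q + 1) / q" "(q + 1) / q \<le> 2" using q by (auto simp: field_simps)

lemma bform_gauss_finite:
  assumes s: "s > 0"
  shows "bform (\<lambda>z. ennreal (gauss s z)) (\<lambda>x. ennreal (f x)) (\<lambda>x. ennreal (f x)) < \<infinity>"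
  by (rule bform_finite_Lp[where M=1, OF _ measurable_uf(2) f_nonneg exponent f_Lp])
     (use gauss_le_1[OF s] nn_integral_gauss[OF s, where 'a='a] in auto)

definition ff :: "real \<Rightarrow> 'a \<Rightarrow> 'a \<Rightarrow> real" where "ff s x y = f x * gauss s (x - y) * f y"

lemma ff_nonneg: "0 \<le> ff s x y" using f_nonneg by (simp add: ff_def)

lemma measurable_ff [measurable]:
  assumes "s \<in> borel_measurable M" "x \<in> borel_measurable M" "y \<in> borel_measurable M"
  shows "(\<lambda>t. ff (s t) (x t) (y t)) \<in> borel_measurable M"
  using assms unfolding ff_def by measurable

lemma integrable_ff:
  assumes s: "s > 0"
  shows "integrable (lborel \<Otimes>\<^sub>M lborel) (\<lambda>(x, y). ff s x y)"
proof (rule integrableI_nonneg)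
  have "(\<integral>\<^sup>+p. ennreal (case p of (x, y) \<Rightarrow> ff s x y) \<partial>(lborel \<Otimes>\<^sub>M lborel))
     = bform (\<lambda>z. ennreal (gauss s z)) (\<lambda>x. ennreal (f x)) (\<lambda>x. ennreal (f x))"
    unfolding bform_def by (subst lborel.nn_integral_fst[symmetric]) (auto simp: ff_def f_nonneg ennreal_mult')
  then show "(\<integral>\<^sup>+p. ennreal (case p of (x, y) \<Rightarrow> ff s x y) \<partial>(lborel \<Otimes>\<^sub>M lborel)) < \<infinity>"
    using bform_gauss_finite[OF s] by simp
qed (auto simp: ff_nonneg)

definition div_field :: "real \<Rightarrow> 'a \<Rightarrow> real" where
  "div_field R x = DIM('a) * cutoff R x + cutoff_grad R x \<bullet> x"

text \<open>The product \<open>coef R x * f x\<close> is the divergence of the field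
  \<open>(cutoff R x * f x) *\<^sub>R x\<close>. Dividing the gradient term by \<open>u\<close>
  keeps \<open>f\<close> as a factor, so that every term is a multiple of \<open>ff\<close>.\<close>

definition coef :: "real \<Rightarrow> 'a \<Rightarrow> real" where
  "coef R x = div_field R x + q * cutoff R x * (Du x \<bullet> x) / u x"

lemma cutoff_cont: "R > 0 \<Longrightarrow> continuous_on UNIV (cutoff R :: 'a \<Rightarrow> real)"
  using cutoff_has_derivative by (auto intro!: continuous_at_imp_continuous_on has_derivative_continuous)

lemma cutoff_grad_cont: "R > 0 \<Longrightarrow> continuous_on UNIV (cutoff_grad R :: 'a \<Rightarrow> 'a)"
  using isCont_cutoff_grad by (auto intro!: continuous_at_imp_continuous_on)

lemma div_field_le: "R > 0 \<Longrightarrow> \<bar>div_field R x\<bar> \<le> DIM('a) + 4"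
proof -
  assume R: "R > 0"
  have "\<bar>div_field R x\<bar> \<le> \<bar>DIM('a) * cutoff R x\<bar> + \<bar>cutoff_grad R x \<bullet> x\<bar>" by (simp add: div_field_def)
  also have "\<dots> \<le> real DIM('a) * 1 + 4"
    using cutoff_nonneg[OF R, of x] cutoff_le_1[OF R, of x] norm_cutoff_grad_le[OF R, of x] Cauchy_Schwarz_ineq2[of "cutoff_grad R x" x]
    by (intro add_mono) (auto simp: abs_mult)
  finally show ?thesis by simp
qed

lemma coef_cont: "R > 0 \<Longrightarrow> continuous_on UNIV (coef R)"
  unfolding coef_def[abs_def] div_field_def
  by (intro continuous_intros cutoff_cont cutoff_grad_cont u_cont Du_cont) (auto simp: u_nonzero)

lemma coef_bounded:
  assumes R: "R > 0"
  obtains C where "\<And>x. \<bar>coef R x\<bar> \<le> C"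
  by (rule continuous_vanishing_bounded[OF coef_cont[OF R], of R])
     (auto simp: coef_def div_field_def cutoff_eq_0[OF R] cutoff_grad_eq_0[OF R] intro: that)

lemma measurable_coef: "R > 0 \<Longrightarrow> coef R \<in> borel_measurable borel" "R > 0 \<Longrightarrow> div_field R \<in> borel_measurable borel"
  using coef_cont[of R] unfolding div_field_def[abs_def]
  by (auto intro!: borel_measurable_continuous_onI continuous_intros cutoff_cont cutoff_grad_cont)

text \<open>For fixed \<open>y\<close>, the divergence theorem is applied to the truncated dilation
  field multiplied by \<open>f\<close> and the Gaussian centred at \<open>y\<close>.\<close>

lemma slice_identity:
  assumes s: "s > 0" and R: "R > 0"
  shows "(LINT x|lborel. coef R x * ff s x y + cutoff R x * f x * (gauss_grad s (x - y) \<bullet> x) * f y) = 0"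
proof -
  let ?\<psi> = "\<lambda>x. cutoff R x * f x * gauss s (x - y)"
  let ?D = "\<lambda>x. (f x * gauss s (x - y)) *\<^sub>R cutoff_grad R x + (cutoff R x * gauss s (x - y)) *\<^sub>R Df x + (cutoff R x * f x) *\<^sub>R gauss_grad s (x - y)"
  have gd: "((\<lambda>x. gauss s (x - y)) has_derivative (\<lambda>h. gauss_grad s (x - y) \<bullet> h)) (at x)" for x
    by (rule has_derivative_compose[where f="\<lambda>x. x - y" and g="gauss s", OF _ gauss_has_derivative[OF s]])
       (auto intro!: derivative_eq_intros)
  have gc: "continuous_on UNIV (\<lambda>x. gauss s (x - y))" "continuous_on UNIV (\<lambda>x. gauss_grad s (x - y))"
    unfolding gauss_grad_def gauss_def by (intro continuous_intros; use s in simp)+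
  have "(LINT x|lborel. DIM('a) * ?\<psi> x + ?D x \<bullet> x) = 0"
  proof (rule integral_radial_divergence[where R=R])
    show "(?\<psi> has_derivative (\<lambda>h. ?D x \<bullet> h)) (at x)" for x
      by (rule has_derivative_eq_rhs[OF has_derivative_mult[OF has_derivative_mult[OF cutoff_has_derivative[OF R] f_has_derivative] gd]])
         (auto simp: fun_eq_iff inner_add_left algebra_simps)
    show "continuous_on UNIV ?D"
      by (intro continuous_intros f_cont Df_cont gc cutoff_cont[OF R] cutoff_grad_cont[OF R])
  qed (use R in \<open>auto simp: cutoff_eq_0 cutoff_grad_eq_0\<close>)
  moreover have "coef R x * ff s x y + cutoff R x * f x * (gauss_grad s (x - y) \<bullet> x) * f y = f y * (DIM('a) * ?\<psi> x + ?D x \<bullet> x)" for x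
  proof -
    have "Df x \<bullet> x = f x * (q * (Du x \<bullet> x) / u x)"
      using u_pos[of x] by (simp add: Df_def f_def powr_diff)
    then show ?thesis by (simp add: coef_def div_field_def ff_def inner_add_left algebra_simps)
  qed
  ultimately show ?thesis by simp
qed

definition pair_field :: "real \<Rightarrow> 'a \<Rightarrow> 'a \<Rightarrow> real" where
  "pair_field R x y = (cutoff R x *\<^sub>R x - cutoff R y *\<^sub>R y) \<bullet> (x - y)"

lemma pair_field_le: "R > 0 \<Longrightarrow> \<bar>pair_field R x y\<bar> \<le> 5 * (norm (x - y))\<^sup>2"
proof -
  assume R: "R > 0"
  have "\<bar>pair_field R x y\<bar> \<le> norm (cutoff R x *\<^sub>R x - cutoff R y *\<^sub>R y) * norm (x - y)"
    unfolding pair_field_def by (rule Cauchy_Schwarz_ineq2)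
  also have "\<dots> \<le> (5 * norm (x - y)) * norm (x - y)"
    by (intro mult_right_mono cutoff_field_lipschitz R) simp
  finally show ?thesis by (simp add: power2_eq_square)
qed

lemma measurable_pair_field [measurable]: "(\<lambda>(x, y). pair_field R x y) \<in> borel_measurable (lborel \<Otimes>\<^sub>M lborel)"
  unfolding pair_field_def cutoff_def by measurable

text \<open>Integrate \<open>slice_identity\<close> over \<open>y\<close>. The gradient of the
  Gaussian is odd in \<open>x - y\<close>, so averaging its term with the one for the exchanged
  points turns the field into its difference, that is, into \<open>pair_field\<close>.\<close>

lemma pair_identity:
  assumes s: "s > 0" and R: "R > 0"
  shows "(LINT (x, y)|lborel2. coef R x * ff s x y) = pi / s * (LINT (x, y)|lborel2. pair_field R x y * ff s x y)"
proof -
  let ?P = "lborel \<Otimes>\<^sub>M lborel :: ('a \<times> 'a) measure"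
  have [measurable]: "coef R \<in> borel_measurable borel" "(cutoff R :: 'a \<Rightarrow> real) \<in> borel_measurable borel"
    using measurable_coef[OF R] cutoff_cont[OF R] by (auto intro: borel_measurable_continuous_onI)
  obtain C where C: "\<And>x. \<bar>coef R x\<bar> \<le> C" by (rule coef_bounded[OF R]) blast
  have C0: "0 \<le> C" using C[of 0] by linarith
  have i1: "integrable ?P (\<lambda>(x, y). coef R x * ff s x y)"
    by (rule Bochner_Integration.integrable_bound[OF integrable_mult_right[OF integrable_ff[OF s], of C]])
       (use C C0 ff_nonneg in \<open>auto simp: abs_mult intro!: mult_right_mono AE_I2\<close>)
  let ?B = "\<lambda>(x, y). cutoff R x * f x * (gauss_grad s (x - y) \<bullet> x) * f y"
  have i2: "integrable ?P ?B"
  proof (rule Bochner_Integration.integrable_bound)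
    show "integrable ?P (\<lambda>p. (2 * pi * s powr (- 1 / 2) * R) * (case p of (x, y) \<Rightarrow> ff (2 * s) x y))"
      using s by (intro integrable_mult_right integrable_ff) auto
    show "AE p in ?P. norm (?B p) \<le> norm ((2 * pi * s powr (- 1 / 2) * R) * (case p of (x, y) \<Rightarrow> ff (2 * s) x y))"
    proof (rule AE_I2, clarify)
      fix x y :: 'a
      have "\<bar>cutoff R x * (gauss_grad s (x - y) \<bullet> x)\<bar> \<le> 2 * pi * s powr (- 1 / 2) * gauss (2 * s) (x - y) * R"
      proof (cases "R \<le> norm x")
        case False
        have "\<bar>cutoff R x * (gauss_grad s (x - y) \<bullet> x)\<bar> \<le> 1 * \<bar>gauss_grad s (x - y) \<bullet> x\<bar>"
          unfolding abs_mult using cutoff_nonneg[OF R, of x] cutoff_le_1[OF R, of x] by (intro mult_right_mono) auto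
        also have "\<dots> \<le> norm (gauss_grad s (x - y)) * norm x" using Cauchy_Schwarz_ineq2 by simp
        also have "\<dots> \<le> 2 * pi * s powr (- 1 / 2) * gauss (2 * s) (x - y) * R"
          using False by (intro mult_mono norm_gauss_grad_le s) auto
        finally show ?thesis .
      qed (use R in \<open>simp add: cutoff_eq_0\<close>)
      then have "\<bar>cutoff R x * (gauss_grad s (x - y) \<bullet> x)\<bar> * (f x * f y) \<le> 2 * pi * s powr (- 1 / 2) * gauss (2 * s) (x - y) * R * (f x * f y)"
        using f_nonneg by (intro mult_right_mono) auto
      then show "norm (cutoff R x * f x * (gauss_grad s (x - y) \<bullet> x) * f y) \<le> norm ((2 * pi * s powr (- 1 / 2) * R) * ff (2 * s) x y)"
        using R f_nonneg[of x] f_nonneg[of y] by (simp add: abs_mult ff_def mult_ac)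
    qed
  qed simp
  have i12: "integrable ?P (\<lambda>(x, y). coef R x * ff s x y + cutoff R x * f x * (gauss_grad s (x - y) \<bullet> x) * f y)"
    by (rule iffD1[OF Bochner_Integration.integrable_cong[OF refl] Bochner_Integration.integrable_add[OF i1 i2]]) auto
  have "(LINT (x, y)|?P. coef R x * ff s x y) + (LINT p|?P. ?B p) = (LINT p|?P. (case p of (x, y) \<Rightarrow> coef R x * ff s x y) + ?B p)"
    by (rule Bochner_Integration.integral_add[OF i1 i2, symmetric])
  also have "\<dots> = (LINT (x, y)|?P. coef R x * ff s x y + cutoff R x * f x * (gauss_grad s (x - y) \<bullet> x) * f y)"
    by (intro Bochner_Integration.integral_cong refl) auto
  also have "\<dots> = 0"
    using lborel_pair.integral_snd[OF i12] by (simp add: slice_identity[OF s R])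
  finally have "(LINT (x, y)|?P. coef R x * ff s x y) + (LINT p|?P. ?B p) = 0" .
  moreover have "(LINT p|?P. ?B p) = - (pi / s) * (LINT (x, y)|?P. pair_field R x y * ff s x y)"
  proof -
    have i2': "integrable ?P (\<lambda>(x, y). ?B (y, x))"
      using lborel_pair.integrable_product_swap[OF i2] by simp
    have "(LINT p|?P. ?B p) = (LINT (x, y)|?P. ?B (y, x))"
      by (rule lborel_pair.integral_product_swap[symmetric]) simp
    then have "2 * (LINT p|?P. ?B p) = (LINT p|?P. ?B p) + (LINT (x, y)|?P. ?B (y, x))" by simp
    also have "\<dots> = (LINT p|?P. ?B p + (case p of (x, y) \<Rightarrow> ?B (y, x)))"
      using i2 i2' by (intro Bochner_Integration.integral_add[symmetric]) auto
    also have "\<dots> = (LINT p|?P. - (2 * pi / s) * (case p of (x, y) \<Rightarrow> pair_field R x y * ff s x y))"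
    proof (rule Bochner_Integration.integral_cong[OF refl], clarify)
      fix x y :: 'a
      show "cutoff R x * f x * (gauss_grad s (x - y) \<bullet> x) * f y + cutoff R y * f y * (gauss_grad s (y - x) \<bullet> y) * f x
         = - (2 * pi / s) * (pair_field R x y * ff s x y)"
        unfolding gauss_grad_def gauss_diff_commute[of s y x] pair_field_def ff_def
        by (simp add: inner_diff_left inner_diff_right inner_commute algebra_simps)
    qed
    also have "\<dots> = - (2 * pi / s) * (LINT (x, y)|?P. pair_field R x y * ff s x y)"
      by (rule integral_mult_right_zero)
    finally show ?thesis by simp
  qed
  ultimately show ?thesis by simp
qed

lemma integrable_triple_kernel:
  "integrable triple_measure (\<lambda>(s, x, y). bessel_weight (real DIM('a)) \<alpha> s * ff s x y)"
proof (rule integrableI_nonneg)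
  have "(\<integral>\<^sup>+t. ennreal (case t of (s, x, y) \<Rightarrow> bessel_weight (real DIM('a)) \<alpha> s * ff s x y) \<partial>triple_measure)
     = (\<integral>\<^sup>+x. \<integral>\<^sup>+y. \<integral>\<^sup>+s. ennreal (f x) * (ennreal (bessel_weight (real DIM('a)) \<alpha> s) * ennreal (gauss s (x - y))) * ennreal (f y) \<partial>lborel \<partial>lborel \<partial>lborel)"
    by (subst nn_integral_triple)
       (auto simp: ff_def f_nonneg bessel_weight_nonneg[OF \<alpha>(1)] ennreal_mult' mult_ac intro!: nn_integral_cong)
  also have "\<dots> = bform (bessel_kernel \<alpha>) (\<lambda>x. ennreal (f x)) (\<lambda>x. ennreal (f x))"
    unfolding bform_def bessel_kernel_def by (simp add: nn_integral_cmult nn_integral_multc)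
  finally show "(\<integral>\<^sup>+t. ennreal (case t of (s, x, y) \<Rightarrow> bessel_weight (real DIM('a)) \<alpha> s * ff s x y) \<partial>triple_measure) < \<infinity>"
    by (simp add: bform_f)
qed (auto simp: ff_nonneg bessel_weight_nonneg[OF \<alpha>(1)])

text \<open>The pointwise limit of the truncated integrands as \<open>R\<close> grows; five times it
  dominates all of them, by \<open>pair_field_le\<close>.\<close>

definition virial :: "real \<times> 'a \<times> 'a \<Rightarrow> real" where
  "virial = (\<lambda>(s, x, y). (norm (x - y))\<^sup>2 * (virial_weight (real DIM('a)) \<alpha> s * ff s x y))"

lemma measurable_virial [measurable]: "virial \<in> borel_measurable triple_measure"
  unfolding virial_def by measurable

lemmas weight_div_nonneg = virial_weight_nonneg[OF \<alpha>(1)]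

lemma virial_nonneg: "0 \<le> virial t"
  using weight_div_nonneg ff_nonneg by (auto simp: virial_def split: prod.split intro!: mult_nonneg_nonneg)

text \<open>This is \<open>bessel_kernel_scaling\<close> integrated against
  \<open>f x * f y\<close>; the diagonal, where it does not apply, is a null set. The factor 2
  restores the \<open>2 * pi / s\<close> of that identity.\<close>

lemma nn_virial:
  "2 * (\<integral>\<^sup>+t. ennreal (virial t) \<partial>triple_measure)
   = ennreal (real DIM('a) - \<alpha>) * ennreal mass + bform (bessel_kernel_up \<alpha>) (\<lambda>x. ennreal (f x)) (\<lambda>x. ennreal (f x))"
proof -
  let ?k = "bessel_kernel \<alpha> :: 'a \<Rightarrow> ennreal" and ?ku = "bessel_kernel_up \<alpha> :: 'a \<Rightarrow> ennreal"
  have "2 * (\<integral>\<^sup>+t. ennreal (virial t) \<partial>triple_measure) = (\<integral>\<^sup>+t. ennreal (2 * virial t) \<partial>triple_measure)"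
    by (simp add: nn_integral_cmult ennreal_mult')
  also have "\<dots> = (\<integral>\<^sup>+x. \<integral>\<^sup>+y. \<integral>\<^sup>+s. ennreal (2 * virial (s, x, y)) \<partial>lborel \<partial>lborel \<partial>lborel)"
    by (rule nn_integral_triple) simp
  also have "\<dots> = (\<integral>\<^sup>+x. \<integral>\<^sup>+y. ennreal (real DIM('a) - \<alpha>) * (ennreal (f x) * ?k (x - y) * ennreal (f y)) + ennreal (f x) * ?ku (x - y) * ennreal (f y) \<partial>lborel \<partial>lborel)"
  proof (rule nn_integral_cong, rule nn_integral_cong_AE)
    fix x :: 'a
    show "AE y in lborel. (\<integral>\<^sup>+s. ennreal (2 * virial (s, x, y)) \<partial>lborel) = ennreal (real DIM('a) - \<alpha>) * (ennreal (f x) * ?k (x - y) * ennreal (f y)) + ennreal (f x) * ?ku (x - y) * ennreal (f y)"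
      using AE_lborel_singleton[of x]
    proof eventually_elim
      case (elim y)
      have ne: "x - y \<noteq> 0" using elim by simp
      let ?G = "\<lambda>s. bessel_weight (real DIM('a)) \<alpha> s * (2 * pi * (norm (x - y))\<^sup>2 / s) * gauss s (x - y)"
      have "2 * virial (s, x, y) = (f x * f y) * ?G s" for s
        by (simp add: virial_def virial_weight_def ff_def mult_ac)
      then have "(\<integral>\<^sup>+s. ennreal (2 * virial (s, x, y)) \<partial>lborel) = (\<integral>\<^sup>+s. ennreal (f x * f y) * ennreal (?G s) \<partial>lborel)"
        using f_nonneg by (intro nn_integral_cong) (simp only:, rule ennreal_mult', simp)
      also have "\<dots> = ennreal (f x * f y) * (\<integral>\<^sup>+s. ennreal (?G s) \<partial>lborel)"
        by (rule nn_integral_cmult) measurable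
      also have "\<dots> = ennreal (f x) * ennreal (f y) * (ennreal (real DIM('a) - \<alpha>) * ?k (x - y) + ?ku (x - y))"
        unfolding bessel_kernel_scaling[OF \<alpha> ne] by (simp add: ennreal_mult' f_nonneg)
      finally show ?case by (simp add: distrib_left mult_ac)
    qed
  qed
  also have "\<dots> = ennreal (real DIM('a) - \<alpha>) * bform ?k (\<lambda>x. ennreal (f x)) (\<lambda>x. ennreal (f x)) + bform ?ku (\<lambda>x. ennreal (f x)) (\<lambda>x. ennreal (f x))"
    unfolding bform_def by (simp add: nn_integral_add nn_integral_cmult)
  finally show ?thesis by (simp add: bform_f)
qed

lemma integrable_virial: "integrable triple_measure virial"
proof (rule integrableI_nonneg)
  have "bform (bessel_kernel_up \<alpha>) (\<lambda>x. ennreal (f x)) (\<lambda>x. ennreal (f x)) < \<infinity>"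
    by (rule bform_bessel_kernel_up_finite[OF \<alpha>(1) measurable_uf(2) f_nonneg exponent f_Lp]) (simp add: bform_f)
  then have "2 * (\<integral>\<^sup>+t. ennreal (virial t) \<partial>triple_measure) < \<infinity>"
    unfolding nn_virial by (simp add: ennreal_mult_less_top)
  then show "(\<integral>\<^sup>+t. ennreal (virial t) \<partial>triple_measure) < \<infinity>" by (auto simp: ennreal_mult_less_top)
qed (auto simp: virial_nonneg)

text \<open>The inequality is strict because a positive kernel paired with the positive
  \<open>f\<close> cannot give 0, and \<open>mass\<close> is finite.\<close>

lemma virial_lower_bound: "(real DIM('a) - \<alpha>) * mass < 2 * (LINT t|triple_measure. virial t)"
proof -
  let ?B = "bform (bessel_kernel_up \<alpha>) (\<lambda>x. ennreal (f x)) (\<lambda>x. ennreal (f x))"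
  have "?B \<noteq> 0"
  proof
    assume "?B = 0"
    then have "AE x in lborel. (\<integral>\<^sup>+y. ennreal (f x) * bessel_kernel_up \<alpha> (x - y) * ennreal (f y) \<partial>lborel) = 0"
      unfolding bform_def by (subst (asm) nn_integral_0_iff_AE) auto
    then have "AE x in (lborel :: 'a measure). False"
    proof eventually_elim
      case (elim x)
      then have "AE y in lborel. ennreal (f x) * bessel_kernel_up \<alpha> (x - y) * ennreal (f y) = 0"
        by (subst (asm) nn_integral_0_iff_AE) auto
      then have "AE y in (lborel :: 'a measure). False"
      proof eventually_elim
        case (elim y)
        then show ?case using f_pos[of x] f_pos[of y] bessel_kernel_up_pos[OF \<alpha>(1), of "x - y"] by auto
      qed
      then show False by (simp add: AE_iff_null null_sets_def)
    qed
    then show False by (simp add: AE_iff_null null_sets_def)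
  qed
  have "ennreal ((real DIM('a) - \<alpha>) * mass) < ennreal (2 * (LINT t|triple_measure. virial t))"
  proof -
    have "ennreal ((real DIM('a) - \<alpha>) * mass) + 0 < ennreal ((real DIM('a) - \<alpha>) * mass) + ?B"
      using \<open>?B \<noteq> 0\<close> by (subst ennreal_add_left_cancel_less) (auto simp: zero_less_iff_neq_zero)
    also have "\<dots> = 2 * (\<integral>\<^sup>+t. ennreal (virial t) \<partial>triple_measure)"
      unfolding nn_virial using \<alpha> mass_pos by (simp add: ennreal_mult')
    also have "(\<integral>\<^sup>+t. ennreal (virial t) \<partial>triple_measure) = ennreal (LINT t|triple_measure. virial t)"
      by (rule nn_integral_eq_integral[OF integrable_virial]) (simp add: virial_nonneg)
    finally show ?thesis by (simp add: ennreal_mult')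
  qed
  then show ?thesis using \<alpha> mass_pos by (subst (asm) ennreal_less_iff) auto
qed

text \<open>Integrating out \<open>s\<close> recovers the kernel almost everywhere, and integrating
  out \<open>y\<close> then yields \<open>u x\<close> by the equation. Boundedness of
  \<open>h\<close> reduces integrability to that of the energy.\<close>

lemma kernel_slice:
  fixes h :: "'a \<Rightarrow> real"
  assumes [measurable]: "h \<in> borel_measurable borel" and C: "\<And>x. \<bar>h x\<bar> \<le> C"
  shows "integrable triple_measure (\<lambda>(s, x, y). h x * (bessel_weight (real DIM('a)) \<alpha> s * ff s x y))"
    and "(LINT (s, x, y)|triple_measure. h x * (bessel_weight (real DIM('a)) \<alpha> s * ff s x y)) = (LINT x|lborel. h x * u x powr (q + 1))"
proof -
  have C0: "0 \<le> C" using C[of 0] by linarith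
  show i: "integrable triple_measure (\<lambda>(s, x, y). h x * (bessel_weight (real DIM('a)) \<alpha> s * ff s x y))"
    by (rule Bochner_Integration.integrable_bound[OF integrable_mult_right[OF integrable_triple_kernel, of C]])
       (use C C0 ff_nonneg bessel_weight_nonneg[OF \<alpha>(1)] in \<open>auto simp: abs_mult intro!: mult_right_mono AE_I2\<close>)
  have fin: "AE z in lborel. bessel_kernel \<alpha> (z::'a) \<noteq> \<infinity>"
    using nn_integral_bessel_kernel[OF \<alpha>(1), where 'a='a] by (intro nn_integral_PInf_AE) auto
  have i1: "integrable (lborel \<Otimes>\<^sub>M lborel) (\<lambda>p. LINT s|lborel. h (fst p) * (bessel_weight (real DIM('a)) \<alpha> s * ff s (fst p) (snd p)))"
    using triple.integrable_snd[of "\<lambda>s p. h (fst p) * (bessel_weight (real DIM('a)) \<alpha> s * ff s (fst p) (snd p))"] i unfolding case_prod_unfold by simp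
  have "(LINT (s, x, y)|triple_measure. h x * (bessel_weight (real DIM('a)) \<alpha> s * ff s x y)) = (LINT p|lborel2. LINT s|lborel. h (fst p) * (bessel_weight (real DIM('a)) \<alpha> s * ff s (fst p) (snd p)))"
    using triple.integral_snd[of "\<lambda>s p. h (fst p) * (bessel_weight (real DIM('a)) \<alpha> s * ff s (fst p) (snd p))"] i unfolding case_prod_unfold by simp
  also have "\<dots> = (LINT x|lborel. LINT y|lborel. LINT s|lborel. h x * (bessel_weight (real DIM('a)) \<alpha> s * ff s x y))"
    using lborel_pair.integral_fst'[OF i1] by simp
  also have "\<dots> = (LINT x|lborel. h x * u x powr (q + 1))"
  proof (rule Bochner_Integration.integral_cong[OF refl])
    fix x :: 'a
    have "(LINT s|lborel. bessel_weight (real DIM('a)) \<alpha> s * ff s x y) = f x * (f y * (LINT s|lborel. bessel_weight (real DIM('a)) \<alpha> s * gauss s (x - y)))" for y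
    proof -
      have "(LINT s|lborel. bessel_weight (real DIM('a)) \<alpha> s * ff s x y) = (LINT s|lborel. (f x * f y) * (bessel_weight (real DIM('a)) \<alpha> s * gauss s (x - y)))"
        by (simp add: ff_def mult_ac)
      then show ?thesis by simp
    qed
    then have "(LINT y|lborel. LINT s|lborel. h x * (bessel_weight (real DIM('a)) \<alpha> s * ff s x y)) = h x * (f x * (LINT y|lborel. f y * (LINT s|lborel. bessel_weight (real DIM('a)) \<alpha> s * gauss s (x - y))))"
      by simp
    also have "(LINT y|lborel. f y * (LINT s|lborel. bessel_weight (real DIM('a)) \<alpha> s * gauss s (x - y))) = u x"
    proof -
      have "(LINT y|lborel. f y * (LINT s|lborel. bessel_weight (real DIM('a)) \<alpha> s * gauss s (x - y))) = enn2real (\<integral>\<^sup>+y. ennreal (f y * (LINT s|lborel. bessel_weight (real DIM('a)) \<alpha> s * gauss s (x - y))) \<partial>lborel)"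
        using f_nonneg bessel_weight_nonneg[OF \<alpha>(1)]
        by (intro integral_eq_nn_integral) (auto intro!: AE_I2 mult_nonneg_nonneg integral_nonneg_AE)
      also have "(\<integral>\<^sup>+y. ennreal (f y * (LINT s|lborel. bessel_weight (real DIM('a)) \<alpha> s * gauss s (x - y))) \<partial>lborel) = (\<integral>\<^sup>+y. bessel_kernel \<alpha> (x - y) * ennreal (u y powr q) \<partial>lborel)"
      proof (rule nn_integral_cong_AE)
        show "AE y in lborel. ennreal (f y * (LINT s|lborel. bessel_weight (real DIM('a)) \<alpha> s * gauss s (x - y))) = bessel_kernel \<alpha> (x - y) * ennreal (u y powr q)"
          using AE_lborel_singleton[of x]
        proof eventually_elim
          case (elim y)
          have "ennreal (LINT s|lborel. bessel_weight (real DIM('a)) \<alpha> s * gauss s (x - y)) = bessel_kernel \<alpha> (x - y)"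
            unfolding bessel_kernel_def using elim integrable_bessel_kernel_integrands(1)[OF \<alpha>, of "x - y"]
            by (subst nn_integral_eq_integral[symmetric]) (auto simp: ennreal_mult' bessel_weight_nonneg[OF \<alpha>(1)])
          then show ?case by (simp add: ennreal_mult' f_nonneg f_def mult.commute)
        qed
      qed
      also have "\<dots> = ennreal (u x)" by (rule u_eq)
      finally show ?thesis using u_nonneg[of x] by simp
    qed
    finally show "(LINT y|lborel. LINT s|lborel. h x * (bessel_weight (real DIM('a)) \<alpha> s * ff s x y)) = h x * u x powr (q + 1)"
      by (simp add: fu)
  qed
  finally show "(LINT (s, x, y)|triple_measure. h x * (bessel_weight (real DIM('a)) \<alpha> s * ff s x y)) = (LINT x|lborel. h x * u x powr (q + 1))" .
qed

text \<open>The divergence theorem for \<open>cutoff R x * u x powr (q + 1)\<close> contains the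
  same term in \<open>Du x\<close> as \<open>coef\<close>. Eliminating it leaves
  \<open>div_field\<close>, in which no derivative of \<open>u\<close> occurs.\<close>

lemma coef_integral:
  assumes R: "R > 0"
  shows "(q + 1) * (LINT x|lborel. coef R x * u x powr (q + 1)) = (LINT x|lborel. div_field R x * u x powr (q + 1))"
proof -
  have [measurable]: "coef R \<in> borel_measurable borel" "div_field R \<in> borel_measurable borel"
    using measurable_coef[OF R] by auto
  let ?\<psi> = "\<lambda>x. cutoff R x * u x powr (q + 1)"
  let ?D = "\<lambda>x. u x powr (q + 1) *\<^sub>R cutoff_grad R x + cutoff R x *\<^sub>R (((q + 1) * u x powr q) *\<^sub>R Du x)"
  have div0: "(LINT x|lborel. DIM('a) * ?\<psi> x + ?D x \<bullet> x) = 0"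
  proof (rule integral_radial_divergence[where R=R])
    show "(?\<psi> has_derivative (\<lambda>h. ?D x \<bullet> h)) (at x)" for x
      using has_derivative_mult[OF cutoff_has_derivative[OF R] u_powr_has_derivative[of "q + 1"]]
      by (rule has_derivative_eq_rhs) (auto simp: fun_eq_iff inner_add_left algebra_simps)
    show "continuous_on UNIV ?D"
      by (intro continuous_intros cont_powr Du_cont cutoff_cont[OF R] cutoff_grad_cont[OF R])
  qed (use R in \<open>auto simp: cutoff_eq_0 cutoff_grad_eq_0\<close>)
  obtain C where C: "\<And>x. \<bar>coef R x\<bar> \<le> C" by (rule coef_bounded[OF R]) blast
  have ic: "integrable lborel (\<lambda>x. coef R x * u x powr (q + 1))"
    by (rule Bochner_Integration.integrable_bound[OF integrable_mult_right[OF integrable_u, of C]])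
       (use order_trans[OF C abs_ge_self] in \<open>auto simp: abs_mult intro!: mult_right_mono AE_I2\<close>)
  have id: "integrable lborel (\<lambda>x. div_field R x * u x powr (q + 1))"
    by (rule Bochner_Integration.integrable_bound[OF integrable_mult_right[OF integrable_u, of "DIM('a) + 4"]])
       (use div_field_le[OF R] in \<open>auto simp: abs_mult intro!: mult_right_mono AE_I2\<close>)
  have "q * (DIM('a) * ?\<psi> x + ?D x \<bullet> x) = (q + 1) * (coef R x * u x powr (q + 1)) - div_field R x * u x powr (q + 1)" for x
  proof -
    have "u x powr (q + 1) = u x powr q * u x" using u_nonneg[of x] by (simp add: powr_add)
    then show ?thesis using u_nonzero[of x] by (simp add: coef_def div_field_def inner_add_left field_simps)
  qed
  then have "q * (LINT x|lborel. DIM('a) * ?\<psi> x + ?D x \<bullet> x) = (LINT x|lborel. (q + 1) * (coef R x * u x powr (q + 1)) - div_field R x * u x powr (q + 1))"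
    by (subst integral_mult_right_zero[symmetric]) simp
  also have "\<dots> = (q + 1) * (LINT x|lborel. coef R x * u x powr (q + 1)) - (LINT x|lborel. div_field R x * u x powr (q + 1))"
    using ic id by simp
  finally show ?thesis unfolding div0 by simp
qed

text \<open>Integrate \<open>pair_identity\<close> over \<open>s\<close> with the Bessel weight.
  Fubini is justified by \<open>virial\<close> on one side and by \<open>kernel_slice\<close> on the
  other, where \<open>coef_integral\<close> then removes the gradient.\<close>

lemma truncated_pohozaev:
  assumes R: "R > 0"
  shows "(LINT (s, x, y)|triple_measure. pair_field R x y * (virial_weight (real DIM('a)) \<alpha> s * ff s x y))
    = (LINT x|lborel. div_field R x * u x powr (q + 1)) / (q + 1)"
proof -
  have [measurable]: "coef R \<in> borel_measurable borel" using measurable_coef[OF R] by auto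
  obtain C where C: "\<And>x. \<bar>coef R x\<bar> \<le> C" by (rule coef_bounded[OF R]) blast
  have i2: "integrable triple_measure (\<lambda>(s, x, y). pair_field R x y * (virial_weight (real DIM('a)) \<alpha> s * ff s x y))"
  proof (rule Bochner_Integration.integrable_bound[OF integrable_mult_right[OF integrable_virial, of 5]])
    show "AE t in triple_measure. norm (case t of (s, x, y) \<Rightarrow> pair_field R x y * (virial_weight (real DIM('a)) \<alpha> s * ff s x y)) \<le> norm (5 * virial t)"
    proof (rule AE_I2, clarify)
      fix s and x y :: 'a
      have "\<bar>pair_field R x y\<bar> * (virial_weight (real DIM('a)) \<alpha> s * ff s x y) \<le> 5 * (norm (x - y))\<^sup>2 * (virial_weight (real DIM('a)) \<alpha> s * ff s x y)"
        using weight_div_nonneg ff_nonneg by (intro mult_right_mono pair_field_le R mult_nonneg_nonneg) auto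
      then show "norm (pair_field R x y * (virial_weight (real DIM('a)) \<alpha> s * ff s x y)) \<le> norm (5 * virial (s, x, y))"
        using weight_div_nonneg[of s] ff_nonneg[of s x y] virial_nonneg[of "(s, x, y)"]
        unfolding real_norm_def abs_mult[of "pair_field R x y"] abs_of_nonneg[OF mult_nonneg_nonneg[OF weight_div_nonneg ff_nonneg]]
        by (simp add: virial_def mult.assoc)
    qed
  next
    show "(\<lambda>(s, x, y). pair_field R x y * (virial_weight (real DIM('a)) \<alpha> s * ff s x y)) \<in> borel_measurable triple_measure"
      unfolding pair_field_def cutoff_def by measurable
  qed
  have "(LINT (s, x, y)|triple_measure. pair_field R x y * (virial_weight (real DIM('a)) \<alpha> s * ff s x y))
     = (LINT s|lborel. LINT p|lborel2. (case (s, p) of (s, x, y) \<Rightarrow> pair_field R x y * (virial_weight (real DIM('a)) \<alpha> s * ff s x y)))"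
    by (rule triple.integral_fst'[OF i2, symmetric])
  also have "\<dots> = (LINT s|lborel. LINT p|lborel2. (case (s, p) of (s, x, y) \<Rightarrow> coef R x * (bessel_weight (real DIM('a)) \<alpha> s * ff s x y)))"
  proof (rule Bochner_Integration.integral_cong[OF refl])
    fix s :: real
    let ?P = "lborel \<Otimes>\<^sub>M lborel :: ('a \<times> 'a) measure"
    show "(LINT p|?P. (case (s, p) of (s, x, y) \<Rightarrow> pair_field R x y * (virial_weight (real DIM('a)) \<alpha> s * ff s x y)))
       = (LINT p|?P. (case (s, p) of (s, x, y) \<Rightarrow> coef R x * (bessel_weight (real DIM('a)) \<alpha> s * ff s x y)))"
    proof (cases "s > 0")
      case True
      have "(LINT p|?P. (case (s, p) of (s, x, y) \<Rightarrow> pair_field R x y * (virial_weight (real DIM('a)) \<alpha> s * ff s x y)))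
         = (LINT p|?P. (virial_weight (real DIM('a)) \<alpha> s) * (case p of (x, y) \<Rightarrow> pair_field R x y * ff s x y))"
        by (intro Bochner_Integration.integral_cong refl) (auto simp: mult_ac)
      also have "\<dots> = bessel_weight (real DIM('a)) \<alpha> s * (pi / s * (LINT (x, y)|?P. pair_field R x y * ff s x y))"
        by (simp only: integral_mult_right_zero virial_weight_def mult.assoc)
      also have "\<dots> = (LINT p|?P. bessel_weight (real DIM('a)) \<alpha> s * (case p of (x, y) \<Rightarrow> coef R x * ff s x y))"
        by (simp only: pair_identity[OF True R, symmetric] integral_mult_right_zero)
      also have "\<dots> = (LINT p|?P. (case (s, p) of (s, x, y) \<Rightarrow> coef R x * (bessel_weight (real DIM('a)) \<alpha> s * ff s x y)))"
        by (intro Bochner_Integration.integral_cong refl) (auto simp: mult_ac)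
      finally show ?thesis .
    qed (simp add: bessel_weight_0 virial_weight_def case_prod_beta)
  qed
  also have "\<dots> = (LINT (s, x, y)|triple_measure. coef R x * (bessel_weight (real DIM('a)) \<alpha> s * ff s x y))"
    by (rule triple.integral_fst'[OF kernel_slice(1)[OF _ C]]) simp
  also have "\<dots> = (LINT x|lborel. coef R x * u x powr (q + 1))"
    by (rule kernel_slice(2)[OF _ C]) simp
  also have "\<dots> = (LINT x|lborel. div_field R x * u x powr (q + 1)) / (q + 1)"
    using coef_integral[OF R] q by (simp add: field_simps)
  finally show ?thesis .
qed

text \<open>As \<open>R\<close> grows, \<open>pair_field\<close> tends to the squared distance and
  \<open>div_field\<close> to the dimension. Integrability of \<open>virial\<close> and of
  \<open>u powr (q + 1)\<close> supplies the domination, so no decay of \<open>u\<close>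
  enters.\<close>

lemma pohozaev: "(LINT t|triple_measure. virial t) = DIM('a) * mass / (q + 1)"
proof (rule LIMSEQ_unique)
  let ?H = "\<lambda>j. LINT (s, x, y)|triple_measure. pair_field (real (Suc j)) x y * (virial_weight (real DIM('a)) \<alpha> s * ff s x y)"
  show "?H \<longlonglongrightarrow> (LINT t|triple_measure. virial t)"
  proof (rule integral_dominated_convergence[where w="\<lambda>t. 5 * virial t"])
    show "integrable triple_measure (\<lambda>t. 5 * virial t)" using integrable_virial by simp
    show "(\<lambda>(s, x, y). pair_field (real (Suc j)) x y * (virial_weight (real DIM('a)) \<alpha> s * ff s x y)) \<in> borel_measurable triple_measure" for j
      unfolding pair_field_def cutoff_def by measurable
    show "AE t in triple_measure. norm (case t of (s, x, y) \<Rightarrow> pair_field (real (Suc j)) x y * (virial_weight (real DIM('a)) \<alpha> s * ff s x y)) \<le> 5 * virial t" for j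
    proof (rule AE_I2, clarify)
      fix s and x y :: 'a
      have "\<bar>pair_field (real (Suc j)) x y\<bar> * (virial_weight (real DIM('a)) \<alpha> s * ff s x y) \<le> 5 * (norm (x - y))\<^sup>2 * (virial_weight (real DIM('a)) \<alpha> s * ff s x y)"
        using weight_div_nonneg ff_nonneg by (intro mult_right_mono pair_field_le mult_nonneg_nonneg) auto
      then show "norm (pair_field (real (Suc j)) x y * (virial_weight (real DIM('a)) \<alpha> s * ff s x y)) \<le> 5 * virial (s, x, y)"
        unfolding real_norm_def abs_mult[of "pair_field (real (Suc j)) x y"] abs_of_nonneg[OF mult_nonneg_nonneg[OF weight_div_nonneg ff_nonneg]]
        by (simp add: virial_def mult.assoc)
    qed
    show "AE t in triple_measure. (\<lambda>j. case t of (s, x, y) \<Rightarrow> pair_field (real (Suc j)) x y * (virial_weight (real DIM('a)) \<alpha> s * ff s x y)) \<longlonglongrightarrow> virial t"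
    proof (rule AE_I2, clarify)
      fix s and x y :: 'a
      have "(\<lambda>j. pair_field (real (Suc j)) x y) \<longlonglongrightarrow> (1 *\<^sub>R x - 1 *\<^sub>R y) \<bullet> (x - y)"
        unfolding pair_field_def by (intro tendsto_intros cutoff_tendsto)
      then have "(\<lambda>j. pair_field (real (Suc j)) x y * (virial_weight (real DIM('a)) \<alpha> s * ff s x y)) \<longlonglongrightarrow> ((1 *\<^sub>R x - 1 *\<^sub>R y) \<bullet> (x - y)) * (virial_weight (real DIM('a)) \<alpha> s * ff s x y)"
        by (rule tendsto_mult_right)
      then show "(\<lambda>j. pair_field (real (Suc j)) x y * (virial_weight (real DIM('a)) \<alpha> s * ff s x y)) \<longlonglongrightarrow> virial (s, x, y)"
        by (simp add: virial_def power2_norm_eq_inner)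
    qed
  qed simp
  have "(\<lambda>j. LINT x|lborel. div_field (real (Suc j)) x * u x powr (q + 1)) \<longlonglongrightarrow> (LINT x|lborel. DIM('a) * u x powr (q + 1))"
  proof (rule integral_dominated_convergence[where w="\<lambda>x. (DIM('a) + 4) * u x powr (q + 1)"])
    show "integrable lborel (\<lambda>x. (DIM('a) + 4) * u x powr (q + 1))" using integrable_u by simp
    show "(\<lambda>x. div_field (real (Suc j)) x * u x powr (q + 1)) \<in> borel_measurable lborel" for j
      using measurable_coef(2)[of "real (Suc j)"] by (intro borel_measurable_times) auto
    show "AE x in lborel. norm (div_field (real (Suc j)) x * u x powr (q + 1)) \<le> (DIM('a) + 4) * u x powr (q + 1)" for j
      using div_field_le[of "real (Suc j)"] by (auto simp: abs_mult intro!: AE_I2 mult_right_mono)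
    show "AE x in lborel. (\<lambda>j. div_field (real (Suc j)) x * u x powr (q + 1)) \<longlonglongrightarrow> DIM('a) * u x powr (q + 1)"
    proof (rule AE_I2)
      fix x :: 'a
      have "(\<lambda>j. div_field (real (Suc j)) x * u x powr (q + 1)) \<longlonglongrightarrow> (real DIM('a) * 1 + 0) * u x powr (q + 1)"
        unfolding div_field_def by (intro tendsto_intros cutoff_tendsto)
      then show "(\<lambda>j. div_field (real (Suc j)) x * u x powr (q + 1)) \<longlonglongrightarrow> DIM('a) * u x powr (q + 1)" by simp
    qed
  qed simp
  then have "(\<lambda>j. (LINT x|lborel. div_field (real (Suc j)) x * u x powr (q + 1)) / (q + 1)) \<longlonglongrightarrow> DIM('a) * mass / (q + 1)"
    using q by (intro tendsto_divide tendsto_const) (auto simp: mass_def)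
  moreover have "?H j = (LINT x|lborel. div_field (real (Suc j)) x * u x powr (q + 1)) / (q + 1)" for j
    by (rule truncated_pohozaev) simp
  ultimately show "?H \<longlonglongrightarrow> DIM('a) * mass / (q + 1)" by (simp only:)
qed

theorem subcritical: "q < (DIM('a) + \<alpha>) / (real DIM('a) - \<alpha>)"
proof -
  have "(real DIM('a) - \<alpha>) * mass < 2 * DIM('a) / (q + 1) * mass"
    using virial_lower_bound unfolding pohozaev by simp
  then have "DIM('a) - \<alpha> < 2 * DIM('a) / (q + 1)" by (simp only: mult_less_cancel_right_pos[OF mass_pos])
  then show ?thesis using q \<alpha> by (simp add: field_simps)
qed

end

section \<open>The integral equation\<close>

text \<open>\<open>g\<close> agrees with the mixture only off a null set, but the set of
  \<open>y\<close> with \<open>x - y\<close> in it is null for each \<open>x\<close>. The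
  convolutions therefore agree at every point.\<close>

lemma nn_integral_bessel_convolution:
  fixes g :: "'a::euclidean_space \<Rightarrow> real"
  assumes g: "is_bessel_kernel \<alpha> g" and \<alpha>: "\<alpha> > 0" and h: "\<And>y. 0 \<le> h y"
  shows "(\<integral>\<^sup>+y. ennreal (g (x - y) * h y) \<partial>lebesgue) = (\<integral>\<^sup>+y. bessel_kernel \<alpha> (x - y) * ennreal (h y) \<partial>lborel)"
proof -
  obtain N where N: "{z. ennreal (g z) \<noteq> bessel_kernel \<alpha> z} \<subseteq> N" "N \<in> sets lborel" "emeasure lborel N = 0"
    using is_bessel_kernel_AE[OF g \<alpha>] by (auto elim: AE_E)
  have [measurable]: "N \<in> sets borel" using N(2) by simp
  have "(\<integral>\<^sup>+y. indicator N (x - y) \<partial>lborel) = (\<integral>\<^sup>+z. indicator N z \<partial>lborel)"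
    by (rule nn_integral_lborel_reflect) simp
  then have "AE y in lborel. indicator N (x - y) = (0 :: ennreal)"
    using N(3) by (simp add: nn_integral_0_iff_AE)
  then have "AE y in lborel. ennreal (g (x - y) * h y) = bessel_kernel \<alpha> (x - y) * ennreal (h y)"
  proof eventually_elim
    case (elim y)
    then have "ennreal (g (x - y)) = bessel_kernel \<alpha> (x - y)" using N(1) by (auto simp: indicator_def split: if_splits)
    then show ?case using h[of y] by (simp add: ennreal_mult'')
  qed
  then show ?thesis
    unfolding nn_integral_completion by (rule nn_integral_cong_AE)
qed

text \<open>The integrand is nonnegative, so a finite value of its extended integral expresses
  integrability and the value of the Bochner integral together.\<close>

lemma bessel_convolution_iff:
  fixes g :: "'a::euclidean_space \<Rightarrow> real" and h :: "'a \<Rightarrow> real"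
  assumes g: "is_bessel_kernel \<alpha> g" and \<alpha>: "\<alpha> > 0" and h: "\<And>y. 0 \<le> h y" "h \<in> borel_measurable borel" and r: "0 \<le> r"
  shows "(integrable lebesgue (\<lambda>y. g (x - y) * h y) \<and> r = (LINT y|lebesgue. g (x - y) * h y))
     \<longleftrightarrow> (\<integral>\<^sup>+y. bessel_kernel \<alpha> (x - y) * ennreal (h y) \<partial>lborel) = ennreal r"
proof -
  have g0: "0 \<le> g z" for z using g by (auto simp: is_bessel_kernel_def less_imp_le)
  have gm: "g \<in> borel_measurable lebesgue" using g by (auto simp: is_bessel_kernel_def)
  \<comment> \<open>\<open>g\<close> is merely Lebesgue measurable, so the reflection has to be
    measurable between the completed spaces; Borel measurability would not permit the
    composition.\<close>
  have "(\<lambda>y. x + (\<Sum>j\<in>Basis. ((- 1) * (y \<bullet> j)) *\<^sub>R j)) \<in> lebesgue \<rightarrow>\<^sub>M lebesgue"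
    by (rule lebesgue_affine_measurable) simp
  moreover have "(\<Sum>j\<in>Basis. ((- 1) * (y \<bullet> j)) *\<^sub>R j) = - y" for y :: 'a
    using euclidean_representation[of y] by (simp add: sum_negf)
  ultimately have "(\<lambda>y. x - y) \<in> lebesgue \<rightarrow>\<^sub>M lebesgue" by simp
  from measurable_compose[OF this gm] have [measurable]: "(\<lambda>y. g (x - y)) \<in> borel_measurable lebesgue" .
  have [measurable]: "h \<in> borel_measurable lebesgue" using h(2) by (intro measurable_completion) simp
  have m: "(\<lambda>y. g (x - y) * h y) \<in> borel_measurable lebesgue" by measurable
  have nn: "0 \<le> g (x - y) * h y" for y using g0 h by simp
  let ?N = "\<integral>\<^sup>+y. ennreal (g (x - y) * h y) \<partial>lebesgue"
  have "(integrable lebesgue (\<lambda>y. g (x - y) * h y) \<and> r = (LINT y|lebesgue. g (x - y) * h y)) \<longleftrightarrow> ?N = ennreal r"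
  proof
    assume "integrable lebesgue (\<lambda>y. g (x - y) * h y) \<and> r = (LINT y|lebesgue. g (x - y) * h y)"
    then show "?N = ennreal r" using nn by (simp add: nn_integral_eq_integral)
  next
    assume N: "?N = ennreal r"
    then have "integrable lebesgue (\<lambda>y. g (x - y) * h y)"
      using m nn by (intro integrableI_nonneg) auto
    moreover have "(LINT y|lebesgue. g (x - y) * h y) = r"
      using m nn N r by (subst integral_eq_nn_integral) auto
    ultimately show "integrable lebesgue (\<lambda>y. g (x - y) * h y) \<and> r = (LINT y|lebesgue. g (x - y) * h y)" by simp
  qed
  then show ?thesis by (simp only: nn_integral_bessel_convolution[OF g \<alpha> h(1)])
qed

lemma subcritical_solution_exists:
  fixes g :: "'a::euclidean_space \<Rightarrow> real" and \<alpha> q :: real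
  assumes \<alpha>: "0 < \<alpha>" "\<alpha> < DIM('a)" and q: "1 < q" "q < (real DIM('a) + \<alpha>) / (real DIM('a) - \<alpha>)"
    and g: "is_bessel_kernel \<alpha> g"
  shows "\<exists>u. positive_solution g q u \<and> in_Lp (q + 1) u \<and> (\<alpha> > 1 \<longrightarrow> is_C1 u)"
proof -
  interpret riesz_kernel "bessel_kernel \<alpha> :: 'a \<Rightarrow> ennreal" \<alpha> q
  proof
    show "\<exists>C\<ge>0. \<forall>z::'a. z \<noteq> 0 \<longrightarrow> bessel_kernel \<alpha> z \<le> ennreal (C * norm z powr (\<alpha> - real DIM('a)))"
      by (rule bessel_kernel_le_riesz[OF \<alpha>]) blast
  qed (use \<alpha> q bessel_kernel_antimono bessel_kernel_pos bform_bessel_kernel_le nn_integral_bessel_kernel[OF \<alpha>(1), where 'a='a] in auto)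
  obtain u :: "'a \<Rightarrow> real" and M where um [measurable]: "u \<in> borel_measurable borel" and pos: "\<And>x. 0 < u x" and M: "\<And>x. u x \<le> M"
    and fin: "(\<integral>\<^sup>+x. ennreal (u x powr (q + 1)) \<partial>lborel) < \<infinity>"
    and eq: "\<And>x. (\<integral>\<^sup>+y. bessel_kernel \<alpha> (x - y) * ennreal (u y powr q) \<partial>lborel) = ennreal (u x)"
    by (rule bounded_solution_exists) blast
  have u0: "0 \<le> u x" for x using pos[of x] by simp
  have "positive_solution g q u"
    unfolding positive_solution_def
  proof (intro conjI allI pos)
    fix x
    have "integrable lebesgue (\<lambda>y. g (x - y) * u y powr q) \<and> u x = (LINT y|lebesgue. g (x - y) * u y powr q)"
      using eq[of x] u0 by (subst bessel_convolution_iff[OF g \<alpha>(1)]) auto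
    then show "integrable lebesgue (\<lambda>y. g (x - y) * u y powr q)" "u x = (LINT y|lebesgue. g (x - y) * u y powr q)"
      by auto
  qed
  moreover have "in_Lp (q + 1) u"
    unfolding in_Lp_def
  proof
    show "u \<in> borel_measurable lebesgue" by (rule measurable_completion) simp
    have "integrable lborel (\<lambda>x. \<bar>u x\<bar> powr (q + 1))"
      using fin u0 by (intro integrableI_nonneg) auto
    then show "integrable lebesgue (\<lambda>x. \<bar>u x\<bar> powr (q + 1))" by (subst integrable_completion) auto
  qed
  moreover have "\<alpha> > 1 \<longrightarrow> is_C1 u"
  proof
    assume "\<alpha> > 1"
    show "is_C1 u"
    proof (rule bessel_potential_C1[OF _ _ _ \<open>\<alpha> > 1\<close> eq u0])
      \<comment> \<open>Differentiability of the potential is available for bounded densities; here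
        the bound on the constructed solution is used.\<close>
      show "u y powr q \<le> M powr q" for y using M u0 q by (intro powr_mono2) auto
    qed auto
  qed
  ultimately show ?thesis by blast
qed

lemma solution_imp_subcritical:
  fixes g :: "'a::euclidean_space \<Rightarrow> real" and \<alpha> q :: real
  assumes \<alpha>: "0 < \<alpha>" "\<alpha> < DIM('a)" and q: "1 < q" and g: "is_bessel_kernel \<alpha> g"
    and u: "positive_solution g q u" "is_C1 u" "in_Lp (q + 1) u"
  shows "q < (real DIM('a) + \<alpha>) / (real DIM('a) - \<alpha>)"
proof -
  obtain u' :: "'a \<Rightarrow> 'a \<Rightarrow>\<^sub>L real" where u': "\<And>x. (u has_derivative blinfun_apply (u' x)) (at x)" "continuous_on UNIV u'"
    using u(2) by (auto simp: is_C1_def)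
  have pos: "0 < u x" for x using u(1) unfolding positive_solution_def by blast
  have u0: "0 \<le> u x" for x using pos[of x] by simp
  have "continuous_on UNIV u"
    using u'(1) by (auto intro!: continuous_at_imp_continuous_on has_derivative_continuous)
  then have [measurable]: "u \<in> borel_measurable borel" by (rule borel_measurable_continuous_onI)
  define Du where "Du x = (\<Sum>b\<in>Basis. blinfun_apply (u' x) b *\<^sub>R b)" for x
  have Du: "blinfun_apply (u' x) h = Du x \<bullet> h" for x h
  proof -
    have "blinfun_apply (u' x) h = blinfun_apply (u' x) (\<Sum>b\<in>Basis. (h \<bullet> b) *\<^sub>R b)" by (simp add: euclidean_representation)
    also have "\<dots> = Du x \<bullet> h"
      unfolding Du_def inner_sum_left blinfun.sum_right blinfun.scaleR_right
      by (intro sum.cong refl) (simp add: inner_commute[of h] mult.commute)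
    finally show ?thesis .
  qed
  interpret C1_solution u Du \<alpha> q
  proof
    show "(u has_derivative (\<lambda>h. Du x \<bullet> h)) (at x)" for x
      using u'(1)[of x] by (rule has_derivative_eq_rhs) (auto simp: Du fun_eq_iff)
    show "continuous_on UNIV Du"
      unfolding Du_def[abs_def] using u'(2) by (intro continuous_intros)
    have "integrable lborel (\<lambda>x. \<bar>u x\<bar> powr (q + 1))"
      using u(3) unfolding in_Lp_def by (subst (asm) integrable_completion) auto
    from nn_integral_eq_integral[OF this] show "(\<integral>\<^sup>+x. ennreal (u x powr (q + 1)) \<partial>lborel) < \<infinity>"
      using u0 by simp
    show "(\<integral>\<^sup>+y. bessel_kernel \<alpha> (x - y) * ennreal (u y powr q) \<partial>lborel) = ennreal (u x)" for x
    proof (rule iffD1[OF bessel_convolution_iff[OF g \<alpha>(1)]])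
      show "integrable lebesgue (\<lambda>y. g (x - y) * u y powr q) \<and> u x = (LINT y|lebesgue. g (x - y) * u y powr q)"
        using u(1) unfolding positive_solution_def by blast
    qed (rule u0 | simp)+
  qed (use \<alpha> q pos in auto)
  show ?thesis by (rule subcritical)
qed

theorem theorem2p8:
  fixes g :: "real ^ 'n \<Rightarrow> real" and \<alpha> q :: real
  assumes "CARD('n) \<ge> 3"
    and "0 < \<alpha>" and "\<alpha> < real CARD('n)"
    and "q > 1"
    and "is_bessel_kernel \<alpha> g"
  shows "(q < (real CARD('n) + \<alpha>) / (real CARD('n) - \<alpha>) \<longrightarrow>
            (\<exists>u. positive_solution g q u \<and> in_Lp (q + 1) u \<and> (\<alpha> > 1 \<longrightarrow> is_C1 u))) \<and>
         ((\<exists>u. positive_solution g q u \<and> is_C1 u \<and> in_Lp (q + 1) u) \<longrightarrow>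
            q < (real CARD('n) + \<alpha>) / (real CARD('n) - \<alpha>))"
proof -
  have d: "real DIM(real ^ 'n) = real CARD('n)" by simp
  have \<alpha>: "\<alpha> < real DIM(real ^ 'n)" using assms(3) by simp
  show ?thesis
  proof (intro conjI impI)
    assume "q < (real CARD('n) + \<alpha>) / (real CARD('n) - \<alpha>)"
    then show "\<exists>u. positive_solution g q u \<and> in_Lp (q + 1) u \<and> (\<alpha> > 1 \<longrightarrow> is_C1 u)"
      by (intro subcritical_solution_exists[OF assms(2) \<alpha> assms(4) _ assms(5)]) (simp only: d)
  next
    assume "\<exists>u. positive_solution g q u \<and> is_C1 u \<and> in_Lp (q + 1) u"
    then show "q < (real CARD('n) + \<alpha>) / (real CARD('n) - \<alpha>)"
      using solution_imp_subcritical[OF assms(2) \<alpha> assms(4,5)] unfolding d by auto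
  qed
qed

end
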